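(* Let $(X,\|\cdot\|)$ be a (real or complex) Asplund space. Then there exists a rich family $\mathcal{A}\subset\mathcal{S}_{\square}(X\times X^* )$ such that: (i) For all $V\times Y,\ V'\times Y'\in\mathcal{A}$: $V\subset V'$ if and only if $Y\subset Y'$ (and hence if and only if $V\times Y\subset V'\times Y'$). (ii) The family $\mathcal{A}_X:=\{V\in\mathcal{S}(X): V\times Y\in\mathcal{A}\text{ for some }Y\in\mathcal{S}(X^* )\}$ is rich in $\mathcal{S}(X)$. (iii) The family $\mathcal{A}^{X^*}:=\{Y\in\mathcal{S}(X^* ): V\times Y\in\mathcal{A}\text{ for some }V\in\mathcal{S}(X)\}$ is rich in $\mathcal{S}(X^* )$. (iv) There are one-to-one inclusion preserving mappings between $\mathcal{A}$, $\mathcal{A}_X$, and $\mathcal{A}^{X^*}$. (v) For every $\gamma:=V\times Y\in\mathcal{A}$ there is a projection $P_\gamma:X^*\to X^*$ such that $\|P_\gamma\|=1$, $P_\gamma X^*=Y$, $P_\gamma^{-1}(0)=V^\perp$, and $P_\gamma^*X^{**}=\overline{V}^{\,w^*}$. (vi) $(P_\gamma:\gamma\in\mathcal{A})$ is a $1$-projectional skeleton on $(X^*,\|\cdot\|)$ with $\bigcup\{P_\gamma^*X^{**}:\gamma\in\mathcal{A}\}\supset X$. (vii) The skeleton from (vi) can be indexed also by the rich families $\mathcal{A}_X$ or $\mathcal{A}^{X^*}$.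
   Context: Linear subspaces and linear maps are over the scalar field ($\mathbb{R}$ or $\mathbb{C}$) of $X$. $X$ is identified with its canonical image in $X^{**}$. $\overline{A}$ denotes norm closure, and $\overline{V}^{\,w^*}$ denotes the weak$^*$ closure of $V$ in $X^{**}$. For $V\subset X$, $V^\perp=\{x^*\in X^*: x^*(v)=0\ \forall v\in V\}$. A projection on a Banach space $Z$ is a bounded linear operator $P:Z\to Z$ with $P\circ P=P$. A real Banach space is Asplund if every convex continuous function defined on an open convex subset $\Omega$ of it is Fréchet differentiable at each point of a dense subset of $\Omega$. A complex Banach space $X$ is Asplund if the real Banach space $X_{\mathbb{R}}$ (that is, $X$ with multiplication restricted to real scalars and the same norm) is Asplund. For a Banach space $X$, $\mathcal{S}(X)$ is the family of all closed separable linear subspaces of $X$. A family $\mathcal{R}\subset\mathcal{S}(X)$ is rich in $X$ (also: rich in $\mathcal{S}(X)$) if (a) for every $V\in\mathcal{S}(X)$ there is $V'\in\mathcal{R}$ with $V'\supset V$, and (b) whenever $V_1\subset V_2\subset\cdots$ is an increasing sequence in $\mathcal{R}$, then $\overline{\bigcup_i V_i}\in\mathcal{R}$. For Banach spaces $X,Z$ over the same field, $\mathcal{S}_{\square}(X\times Z)\subset\mathcal{S}(X\times Z)$ is the family of all rectangles $V\times Y$ with $V\in\mathcal{S}(X)$, $Y\in\mathcal{S}(Z)$; a rich family $\mathcal{A}\subset\mathcal{S}_{\square}(X\times X^* )$ means one that is rich in $X\times X^*$. Rich families are ordered by inclusion when used as index sets. A partially ordered set is $\sigma$-complete if every increasing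 sequence in it has a supremum. A projectional skeleton on a Banach space $Z$ is a family of projections $(P_s:s\in\Gamma)$ on $Z$, indexed by an up-directed $\sigma$-complete partially ordered set $\Gamma$, such that: $P_sZ$ is separable for every $s\in\Gamma$; $Z=\bigcup_{s\in\Gamma}P_sZ$; $P_t\circ P_s=P_s=P_s\circ P_t$ whenever $s\le t$ in $\Gamma$; and if $s_1<s_2<\cdots$ in $\Gamma$ and $t=\sup_n s_n$, then $P_tZ=\overline{\bigcup_n P_{s_n}Z}$. It is a $1$-projectional skeleton if moreover $\|P_s\|\le 1$ for all $s\in\Gamma$. *)

theory Defs
  imports "HOL-Analysis.Analysis"
begin

section \<open>Scalars and Banach spaces over them\<close>

text \<open>
  The real and the complex case are treated uniformly: a scalar field is an isometric copy of
  the reals or of the complex numbers.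
\<close>

class real_or_complex = real_normed_field +
  assumes real_or_complex:
    "\<exists>h :: 'a \<Rightarrow> complex.
       (\<forall>a b. h (a + b) = h a + h b) \<and> (\<forall>a b. h (a * b) = h a * h b) \<and>
       (\<forall>a. cmod (h a) = norm a) \<and> (range h = \<real> \<or> range h = UNIV)"

instance real :: real_or_complex
  by standard (rule exI[of _ complex_of_real], auto simp: Reals_def)

instance complex :: real_or_complex
  by standard (rule exI[of _ "\<lambda>z. z"], auto)

text \<open>
  A Banach space over the scalar field \<open>'k\<close> is a type of class \<open>banach\<close> (a real Banach space)
  together with a multiplication by scalars from \<open>'k\<close> that extends the real one and for which
  the norm is homogeneous. Forgetting \<open>smul\<close> leaves the underlying real Banach space.
\<close>

locale banach_space_over = vector_space smul
  for smul :: "'k::real_or_complex \<Rightarrow> 'a::banach \<Rightarrow> 'a" +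
  assumes scale_of_real: "smul (of_real r) x = r *\<^sub>R x"
    and norm_scale: "norm (smul c x) = norm c * norm x"

lemma banach_space_over_real:
  "banach_space_over (scaleR :: real \<Rightarrow> 'a::banach \<Rightarrow> 'a)"
  by unfold_locales (auto simp: algebra_simps)

lemma banach_space_over_complex:
  "banach_space_over ((*) :: complex \<Rightarrow> complex \<Rightarrow> complex)"
  by unfold_locales (auto simp: algebra_simps norm_mult scaleR_conv_of_real)

section \<open>Asplund spaces\<close>

text \<open>
  Only the real structure of the space enters, also for complex spaces. The predicate
  \<open>differentiable\<close> is Frechet differentiability.
\<close>

definition asplund :: "'a::banach itself \<Rightarrow> bool" where
  "asplund _ \<longleftrightarrow>
     (\<forall>\<Omega> :: 'a set. \<forall>f :: 'a \<Rightarrow> real.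
        open \<Omega> \<and> convex \<Omega> \<and> convex_on \<Omega> f \<and> continuous_on \<Omega> f \<longrightarrow>
        (\<exists>D \<subseteq> \<Omega>. \<Omega> \<subseteq> closure D \<and> (\<forall>x\<in>D. f differentiable (at x))))"

section \<open>Dual and bidual\<close>

text \<open>
  Elements of \<open>'a \<Rightarrow>\<^sub>L 'k\<close> are merely real-linear. The dual is therefore the subset of
  \<open>'k\<close>-linear functionals, with the operator norm of \<open>'a \<Rightarrow>\<^sub>L 'k\<close>; it is the whole type when the
  scalars are real.
\<close>

definition dual :: "('k::real_or_complex \<Rightarrow> 'a::banach \<Rightarrow> 'a) \<Rightarrow> ('a \<Rightarrow>\<^sub>L 'k) set" where
  "dual smul = {f. Vector_Spaces.linear smul (*) (blinfun_apply f)}"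

definition dual_scale ::
    "'k::real_or_complex \<Rightarrow> ('a::banach \<Rightarrow>\<^sub>L 'k) \<Rightarrow> ('a \<Rightarrow>\<^sub>L 'k)" where
  "dual_scale c f = blinfun_mult_right c o\<^sub>L f"

lemma dual_scale_apply: "blinfun_apply (dual_scale c f) x = c * blinfun_apply f x"
  by (simp add: dual_scale_def)

lemma dual_real: "dual (scaleR :: real \<Rightarrow> 'a::banach \<Rightarrow> 'a) = UNIV"
proof -
  have "Vector_Spaces.linear scaleR (*) (blinfun_apply f)" for f :: "'a \<Rightarrow>\<^sub>L real"
    by unfold_locales (auto simp: algebra_simps blinfun.bilinear_simps)
  then show ?thesis
    by (auto simp: dual_def)
qed

definition annihilator ::
    "('k::real_or_complex \<Rightarrow> 'a::banach \<Rightarrow> 'a) \<Rightarrow> 'a set \<Rightarrow> ('a \<Rightarrow>\<^sub>L 'k) set" where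
  "annihilator smul V = {f \<in> dual smul. \<forall>v\<in>V. blinfun_apply f v = 0}"

text \<open>
  The dual is not a type, so elements of the bidual are represented as functions that are
  extensional on the dual, as in the carrier of \<open>product_topology\<close>.
\<close>

definition bidual ::
    "('k::real_or_complex \<Rightarrow> 'a::banach \<Rightarrow> 'a) \<Rightarrow> (('a \<Rightarrow>\<^sub>L 'k) \<Rightarrow> 'k) set" where
  "bidual smul =
     {\<phi> \<in> extensional (dual smul).
        (\<forall>f\<in>dual smul. \<forall>g\<in>dual smul. \<phi> (f + g) = \<phi> f + \<phi> g) \<and>
        (\<forall>c. \<forall>f\<in>dual smul. \<phi> (dual_scale c f) = c * \<phi> f) \<and>
        (\<exists>B. \<forall>f\<in>dual smul. norm (\<phi> f) \<le> B * norm f)}"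

definition canonical ::
    "('k::real_or_complex \<Rightarrow> 'a::banach \<Rightarrow> 'a) \<Rightarrow> 'a \<Rightarrow> ('a \<Rightarrow>\<^sub>L 'k) \<Rightarrow> 'k" where
  "canonical smul x = (\<lambda>f\<in>dual smul. blinfun_apply f x)"

text \<open>The weak* topology is that of pointwise convergence on the dual.\<close>

definition weak_star_topology ::
    "('k::real_or_complex \<Rightarrow> 'a::banach \<Rightarrow> 'a) \<Rightarrow> (('a \<Rightarrow>\<^sub>L 'k) \<Rightarrow> 'k) topology" where
  "weak_star_topology smul =
     subtopology (product_topology (\<lambda>_. euclidean) (dual smul)) (bidual smul)"

definition adjoint_range ::
    "('k::real_or_complex \<Rightarrow> 'a::banach \<Rightarrow> 'a) \<Rightarrow> (('a \<Rightarrow>\<^sub>L 'k) \<Rightarrow> ('a \<Rightarrow>\<^sub>L 'k)) \<Rightarrow>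
     (('a \<Rightarrow>\<^sub>L 'k) \<Rightarrow> 'k) set" where
  "adjoint_range smul P = (\<lambda>\<phi>. compose (dual smul) \<phi> P) ` bidual smul"

section \<open>Rich families\<close>

text \<open>
  Below, a normed space is given by a carrier \<open>Z\<close> inside a type, with scalar multiplication
  \<open>s\<close>. The carriers in use (a whole type, the dual, and their product) are closed subspaces, so
  that closures may be taken in the ambient type.
\<close>

definition sep_subspaces ::
    "('k::real_or_complex \<Rightarrow> 'z::real_normed_vector \<Rightarrow> 'z) \<Rightarrow> 'z set \<Rightarrow> 'z set set" where
  "sep_subspaces s Z =
     {V. V \<subseteq> Z \<and> module.subspace s V \<and> closed V \<and> separable_space (top_of_set V)}"

definition rich ::
    "('k::real_or_complex \<Rightarrow> 'z::real_normed_vector \<Rightarrow> 'z) \<Rightarrow> 'z set \<Rightarrow> 'z set set \<Rightarrow> bool" where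
  "rich s Z R \<longleftrightarrow>
     R \<subseteq> sep_subspaces s Z \<and>
     (\<forall>V\<in>sep_subspaces s Z. \<exists>V'\<in>R. V \<subseteq> V') \<and>
     (\<forall>W :: nat \<Rightarrow> 'z set. range W \<subseteq> R \<and> incseq W \<longrightarrow> closure (\<Union>i. W i) \<in> R)"

definition rectangles ::
    "('k::real_or_complex \<Rightarrow> 'a::banach \<Rightarrow> 'a) \<Rightarrow> ('a \<times> ('a \<Rightarrow>\<^sub>L 'k)) set set" where
  "rectangles smul =
     {V \<times> Y | V Y. V \<in> sep_subspaces smul UNIV \<and> Y \<in> sep_subspaces dual_scale (dual smul)}"

definition first_sides ::
    "('k::real_or_complex \<Rightarrow> 'a::banach \<Rightarrow> 'a) \<Rightarrow> ('a \<times> ('a \<Rightarrow>\<^sub>L 'k)) set set \<Rightarrow> 'a set set" where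
  "first_sides smul A =
     {V \<in> sep_subspaces smul UNIV. \<exists>Y \<in> sep_subspaces dual_scale (dual smul). V \<times> Y \<in> A}"

definition second_sides ::
    "('k::real_or_complex \<Rightarrow> 'a::banach \<Rightarrow> 'a) \<Rightarrow> ('a \<times> ('a \<Rightarrow>\<^sub>L 'k)) set set \<Rightarrow>
     ('a \<Rightarrow>\<^sub>L 'k) set set" where
  "second_sides smul A =
     {Y \<in> sep_subspaces dual_scale (dual smul). \<exists>V \<in> sep_subspaces smul UNIV. V \<times> Y \<in> A}"

definition inclusion_isomorphic :: "'a set set \<Rightarrow> 'b set set \<Rightarrow> bool" where
  "inclusion_isomorphic A B \<longleftrightarrow>
     (\<exists>f. bij_betw f A B \<and> (\<forall>\<gamma>\<in>A. \<forall>\<delta>\<in>A. f \<gamma> \<subseteq> f \<delta> \<longleftrightarrow> \<gamma> \<subseteq> \<delta>))"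

section \<open>Projectional skeletons\<close>

definition projection_on ::
    "('k::real_or_complex \<Rightarrow> 'z::real_normed_vector \<Rightarrow> 'z) \<Rightarrow> 'z set \<Rightarrow> ('z \<Rightarrow> 'z) \<Rightarrow> bool" where
  "projection_on s Z P \<longleftrightarrow>
     P \<in> Z \<rightarrow> Z \<and>
     (\<forall>x\<in>Z. \<forall>y\<in>Z. P (x + y) = P x + P y) \<and>
     (\<forall>c. \<forall>x\<in>Z. P (s c x) = s c (P x)) \<and>
     (\<exists>B. \<forall>x\<in>Z. norm (P x) \<le> B * norm x) \<and>
     (\<forall>x\<in>Z. P (P x) = P x)"

definition op_norm_on :: "'z::real_normed_vector set \<Rightarrow> ('z \<Rightarrow> 'z) \<Rightarrow> real" where
  "op_norm_on Z P = (SUP x \<in> {x \<in> Z. norm x \<le> 1}. norm (P x))"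

definition supremum_on :: "'i set \<Rightarrow> ('i \<Rightarrow> 'i \<Rightarrow> bool) \<Rightarrow> 'i set \<Rightarrow> 'i \<Rightarrow> bool" where
  "supremum_on \<Gamma> le S t \<longleftrightarrow>
     t \<in> \<Gamma> \<and> (\<forall>s\<in>S. le s t) \<and> (\<forall>u\<in>\<Gamma>. (\<forall>s\<in>S. le s u) \<longrightarrow> le t u)"

definition directed_sigma_complete :: "'i set \<Rightarrow> ('i \<Rightarrow> 'i \<Rightarrow> bool) \<Rightarrow> bool" where
  "directed_sigma_complete \<Gamma> le \<longleftrightarrow>
     reflp_on \<Gamma> le \<and> antisymp_on \<Gamma> le \<and> transp_on \<Gamma> le \<and>
     \<Gamma> \<noteq> {} \<and> (\<forall>s\<in>\<Gamma>. \<forall>t\<in>\<Gamma>. \<exists>u\<in>\<Gamma>. le s u \<and> le t u) \<and>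
     (\<forall>\<sigma> :: nat \<Rightarrow> 'i. range \<sigma> \<subseteq> \<Gamma> \<and> (\<forall>n. le (\<sigma> n) (\<sigma> (Suc n))) \<longrightarrow>
        (\<exists>t. supremum_on \<Gamma> le (range \<sigma>) t))"

definition projectional_skeleton ::
    "('k::real_or_complex \<Rightarrow> 'z::real_normed_vector \<Rightarrow> 'z) \<Rightarrow> 'z set \<Rightarrow>
     'i set \<Rightarrow> ('i \<Rightarrow> 'i \<Rightarrow> bool) \<Rightarrow> ('i \<Rightarrow> 'z \<Rightarrow> 'z) \<Rightarrow> bool" where
  "projectional_skeleton s Z \<Gamma> le P \<longleftrightarrow>
     directed_sigma_complete \<Gamma> le \<and>
     (\<forall>\<gamma>\<in>\<Gamma>. projection_on s Z (P \<gamma>)) \<and>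
     (\<forall>\<gamma>\<in>\<Gamma>. separable_space (top_of_set (P \<gamma> ` Z))) \<and>
     Z = (\<Union>\<gamma>\<in>\<Gamma>. P \<gamma> ` Z) \<and>
     (\<forall>\<gamma>\<in>\<Gamma>. \<forall>\<delta>\<in>\<Gamma>. le \<gamma> \<delta> \<longrightarrow>
        (\<forall>x\<in>Z. P \<delta> (P \<gamma> x) = P \<gamma> x \<and> P \<gamma> (P \<delta> x) = P \<gamma> x)) \<and>
     (\<forall>\<sigma> :: nat \<Rightarrow> 'i. \<forall>t.
        range \<sigma> \<subseteq> \<Gamma> \<and> (\<forall>n. le (\<sigma> n) (\<sigma> (Suc n)) \<and> \<sigma> n \<noteq> \<sigma> (Suc n)) \<and>
        supremum_on \<Gamma> le (range \<sigma>) t \<longrightarrow>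
        P t ` Z = closure (\<Union>n. P (\<sigma> n) ` Z))"

definition one_projectional_skeleton ::
    "('k::real_or_complex \<Rightarrow> 'z::real_normed_vector \<Rightarrow> 'z) \<Rightarrow> 'z set \<Rightarrow>
     'i set \<Rightarrow> ('i \<Rightarrow> 'i \<Rightarrow> bool) \<Rightarrow> ('i \<Rightarrow> 'z \<Rightarrow> 'z) \<Rightarrow> bool" where
  "one_projectional_skeleton s Z \<Gamma> le P \<longleftrightarrow>
     projectional_skeleton s Z \<Gamma> le P \<and> (\<forall>\<gamma>\<in>\<Gamma>. op_norm_on Z (P \<gamma>) \<le> 1)"

end

theory Submission
  imports Defs
begin

text \<open>
  Bounded sets of functionals on an Asplund space have small weak* slices. Deriving the dual
  ball transfinitely by removing small slices yields a well-ordered tower of weak* compact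
  convex sets; from the last one meeting a half-space \<open>{f. f x \<ge> a}\<close> a finite net of functionals
  is chosen. The countable set of these functionals, over rational \<open>a\<close> and accuracies \<open>1/n\<close>,
  depends on \<open>x\<close> alone, and those attached to a dense subset of a closed subspace \<open>V\<close> restrict to
  a dense subset of the dual of \<open>V\<close>.

  Separable subspaces \<open>V\<close> and \<open>Y\<close> are generated by countable sets that are closed under these
  functionals, under norming vectors and under approximation of distances. On such a pair,
  restriction to \<open>V\<close> is an isometry of \<open>Y\<close> onto the dual of \<open>V\<close>, whose inverse gives the projection.
  The generating sets are parts of fixed transfinite sequences in which no vector lies in the
  closed span of its predecessors, which makes them recoverable from \<open>V\<close> alone and from \<open>Y\<close> alone.
\<close>

section \<open>Small slices of the dual ball\<close>

text \<open>The generators have to be attached to single vectors. Functionals chosen separately for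
  each \<open>V\<close> need not be compatible along increasing sequences of subspaces, and the
  second side would not be a monotone function of the first. The derived tower is canonical: it is
  fixed by \<open>e\<close> alone, before any subspace is chosen. For \<open>f\<close> in the unit
  ball, the last member meeting the extensions in the ball of the restriction of \<open>f\<close> to
  \<open>V\<close> is also the last member meeting a half-space given by a vector from a dense
  subset of \<open>V\<close> and a rational number. Countably many parameters therefore recover it.

  Differentiability of convex functions enters twice: for support functions it yields small slices,
  and for distances to subspaces it yields separating functionals.

  The geometry is done with real functionals; those over the scalar field are rebuilt from their
  real parts. All families in the theorem are images of one family of countable sets under order
  embeddings, so statements about order are checked for inclusion of index sets and then
  transported.\<close>

definition polar_ball :: "('a::real_normed_vector \<times> real) set \<Rightarrow> ('a \<Rightarrow>\<^sub>L real) set" where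
  "polar_ball S = {f. norm f \<le> 1 \<and> (\<forall>(x, a)\<in>S. blinfun_apply f x \<le> a)}"

lemma polar_ball_Un: "polar_ball (S \<union> T) = polar_ball S \<inter> polar_ball T"
  by (auto simp: polar_ball_def)

lemma polar_ball_mono: "S \<subseteq> T \<Longrightarrow> polar_ball T \<subseteq> polar_ball S"
  by (auto simp: polar_ball_def)

text \<open>Banach-Alaoglu: additivity, homogeneity, the bound by \<open>norm x\<close> and the
  constraints are closed conditions on functions, so the image is a closed part of a product of
  compact intervals. The weak* topology appears here as the product topology on functions.\<close>

lemma compact_polar_ball: "compact (blinfun_apply ` polar_ball S)"
proof -
  let ?K = "{\<phi> :: 'a \<Rightarrow> real. (\<forall>x y. \<phi> (x + y) = \<phi> x + \<phi> y) \<and> (\<forall>r x. \<phi> (r *\<^sub>R x) = r * \<phi> x) \<and>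
     (\<forall>x. \<bar>\<phi> x\<bar> \<le> norm x)} \<inter> (\<Inter>p\<in>S. {\<phi>. \<phi> (fst p) \<le> snd p})"
  have "blinfun_apply ` polar_ball S = ?K"
  proof (intro equalityI subsetI)
    fix \<phi> assume "\<phi> \<in> blinfun_apply ` polar_ball S"
    then obtain f where f: "\<phi> = blinfun_apply f" "norm f \<le> 1" "\<forall>p\<in>S. f (fst p) \<le> snd p"
      by (fastforce simp: polar_ball_def)
    have "\<bar>f x\<bar> \<le> norm x" for x
      using norm_blinfun[of f x] mult_right_mono[OF f(2) norm_ge_zero[of x]] by simp
    then show "\<phi> \<in> ?K"
      using f by (auto simp: blinfun.bilinear_simps)
  next
    fix \<phi> assume \<phi>: "\<phi> \<in> ?K"
    then have "bounded_linear \<phi>"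
      by (intro bounded_linear_intro[where K = 1]) auto
    then have a: "blinfun_apply (Blinfun \<phi>) = \<phi>"
      by (rule bounded_linear_Blinfun_apply)
    have "norm (Blinfun \<phi>) \<le> 1"
      by (rule norm_blinfun_bound) (use \<phi> a in auto)
    then have "Blinfun \<phi> \<in> polar_ball S"
      using \<phi> a by (auto simp: polar_ball_def)
    then show "\<phi> \<in> blinfun_apply ` polar_ball S"
      by (metis a image_eqI)
  qed
  moreover have "closed ?K"
    by (intro closed_Int closed_INT ballI closed_Collect_conj closed_Collect_all closed_Collect_eq
        closed_Collect_le continuous_intros continuous_on_product_coordinates)
  moreover have "compact (PiE UNIV (\<lambda>x :: 'a. cball 0 (norm x) :: real set))"
    using compactin_PiE[of "\<lambda>_. euclidean" UNIV "\<lambda>x :: 'a. cball 0 (norm x) :: real set"]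
    by (simp add: euclidean_product_topology)
  moreover have "?K \<subseteq> PiE UNIV (\<lambda>x :: 'a. cball 0 (norm x) :: real set)"
    by auto
  ultimately show ?thesis
    by (metis (no_types, lifting) compact_Int_closed inf.absorb_iff2)
qed

text \<open>The form in which weak* compactness is used throughout: emptiness is always witnessed by
  finitely many half-spaces. Working with sets of constraints instead of sets of functionals makes
  this directly applicable.\<close>

lemma polar_ball_fip:
  assumes "polar_ball S = {}"
  obtains F where "finite F" "F \<subseteq> S" "polar_ball F = {}"
proof -
  have "\<exists>F. finite F \<and> F \<subseteq> S \<and> polar_ball F = {}"
  proof (rule ccontr)
    assume no: "\<not> ?thesis"
    have eq: "blinfun_apply ` polar_ball {} \<inter> (\<Inter>p\<in>F. {\<phi>. \<phi> (fst p) \<le> snd p}) =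
        blinfun_apply ` polar_ball F" for F :: "('a \<times> real) set"
      by (auto simp: polar_ball_def image_iff split_beta)
    have "blinfun_apply ` polar_ball {} \<inter> (\<Inter>p\<in>S. {\<phi>. \<phi> (fst p) \<le> snd p}) \<noteq> {}"
    proof (rule compact_imp_fip_image[OF compact_polar_ball])
      show "closed {\<phi> :: 'a \<Rightarrow> real. \<phi> (fst p) \<le> snd p}" for p
        by (intro closed_Collect_le continuous_intros continuous_on_product_coordinates)
      show "blinfun_apply ` polar_ball {} \<inter> (\<Inter>p\<in>F. {\<phi>. \<phi> (fst p) \<le> snd p}) \<noteq> {}"
        if "finite F" "F \<subseteq> S" for F
        using no that unfolding eq by blast
    qed
    then show False
      using assms unfolding eq by simp
  qed
  then show ?thesis using that by blast
qed

lemma convex_polar_ball: "convex (polar_ball S)"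
proof (rule convexI)
  fix f g :: "'a \<Rightarrow>\<^sub>L real" and u v :: real
  assume f: "f \<in> polar_ball S" and g: "g \<in> polar_ball S" and uv: "0 \<le> u" "0 \<le> v" "u + v = 1"
  have "norm (u *\<^sub>R f + v *\<^sub>R g) \<le> u * norm f + v * norm g"
    by (rule norm_triangle_le) (use uv in auto)
  also have "\<dots> \<le> 1"
    using f g uv convex_bound_le[of "norm f" 1 "norm g" u v] by (auto simp: polar_ball_def)
  finally show "u *\<^sub>R f + v *\<^sub>R g \<in> polar_ball S"
    using f g uv by (auto simp: polar_ball_def blinfun.bilinear_simps intro!: convex_bound_le)
qed

text \<open>An empty slice counts as small. This is harmless in the derivation, since removing it
  changes nothing.\<close>

definition small_slice :: "real \<Rightarrow> ('a::real_normed_vector \<Rightarrow>\<^sub>L real) set \<Rightarrow> 'a \<Rightarrow> real \<Rightarrow> bool" where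
  "small_slice e K x a \<longleftrightarrow>
     (\<forall>f\<in>K. \<forall>g\<in>K. a < blinfun_apply f x \<longrightarrow> a < blinfun_apply g x \<longrightarrow> norm (f - g) \<le> e)"

text \<open>One step of the derivation behind the weak* dentability index: all small slices are
  removed simultaneously.\<close>

definition slice_derivative ::
    "real \<Rightarrow> ('a::real_normed_vector \<Rightarrow>\<^sub>L real) set \<Rightarrow> ('a \<Rightarrow>\<^sub>L real) set" where
  "slice_derivative e K = {f \<in> K. \<forall>x a. small_slice e K x a \<longrightarrow> blinfun_apply f x \<le> a}"

lemma slice_derivative_subset: "slice_derivative e K \<subseteq> K"
  by (auto simp: slice_derivative_def)

text \<open>Removing an open slice adds a closed half-space constraint. Slices, unlike general weak*
  open sets, thus leave a remainder that is again convex and weak* compact.\<close>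

lemma slice_derivative_polar_ball:
  "slice_derivative e (polar_ball S) =
     polar_ball (S \<union> {(x, a). small_slice e (polar_ball S) x a})"
  unfolding slice_derivative_def polar_ball_Un by (auto simp: polar_ball_def)

text \<open>Smulyan's argument: at a point \<open>x\<close> where the support function
  \<open>p\<close> of \<open>K\<close> is Frechet differentiable, every member of \<open>K\<close>
  that almost attains \<open>p x\<close> is close in norm to the derivative.\<close>

lemma asplund_small_slice:
  fixes K :: "('a::banach \<Rightarrow>\<^sub>L real) set"
  assumes asp: "asplund TYPE('a)" and K: "K \<noteq> {}" "K \<subseteq> polar_ball {}" and e: "0 < e"
  obtains x a f where "small_slice e K x a" "f \<in> K" "a < blinfun_apply f x"
proof -
  define p where "p x = (SUP f\<in>K. blinfun_apply f x)" for x
  have le: "\<bar>f x\<bar> \<le> norm x" if "f \<in> K" for f x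
    using that K norm_blinfun[of f x] mult_right_mono[of "norm f" 1 "norm x"]
    by (force simp: polar_ball_def)
  have bdd: "bdd_above ((\<lambda>f. blinfun_apply f x) ` K)" for x
    by (rule bdd_aboveI2[where M = "norm x"]) (use le in \<open>fastforce simp: abs_le_iff\<close>)
  have upper: "f x \<le> p x" if "f \<in> K" for f x
    unfolding p_def by (rule cSUP_upper[OF that bdd])
  have least: "p x \<le> c" if "\<And>f. f \<in> K \<Longrightarrow> f x \<le> c" for x c
    unfolding p_def by (rule cSUP_least[OF K(1)]) (use that in auto)
  have conv: "convex_on UNIV p"
    unfolding convex_on_def
    by (auto intro!: least add_mono mult_left_mono upper simp: blinfun.bilinear_simps)
  have lip: "p x - p y \<le> norm (x - y)" for x y
  proof -
    have "f x \<le> p y + norm (x - y)" if "f \<in> K" for f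
      using le[OF that, of "x - y"] upper[OF that, of y] by (simp add: blinfun.bilinear_simps)
    then have "p x \<le> p y + norm (x - y)" by (rule least)
    then show ?thesis by simp
  qed
  have "1-lipschitz_on UNIV p"
  proof (rule lipschitz_onI)
    show "dist (p x) (p y) \<le> 1 * dist x y" for x y
      using lip[of x y] lip[of y x] by (simp add: dist_norm abs_le_iff norm_minus_commute)
  qed simp
  then have "continuous_on UNIV p"
    by (rule lipschitz_on_continuous_on)
  then obtain D where "UNIV \<subseteq> closure D" "\<forall>x\<in>D. p differentiable (at x)"
    using asp conv unfolding asplund_def by (metis convex_UNIV open_UNIV)
  then obtain x where "p differentiable (at x)"
    by (metis UNIV_I closure_empty empty_iff ex_in_conv subset_eq)
  then obtain p' where p': "(p has_derivative p') (at x)"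
    by (auto simp: differentiable_def)
  then interpret p': bounded_linear p'
    by (rule has_derivative_bounded_linear)
  have "e/4 > 0" using e by simp
  then obtain d where d: "d > 0" "\<And>y. norm (y - x) < d \<Longrightarrow>
      norm (p y - p x - p' (y - x)) \<le> e/4 * norm (y - x)"
    using p' unfolding has_derivative_at_alt by meson
  \<comment> \<open>On the sphere of radius \<open>d/2\<close> the linearisation error is at most
    \<open>e/4 * (d/2)\<close>, and a member of the slice falls short of \<open>p x\<close> by less
    than the same amount. Together they give \<open>e/2 * norm h\<close> after rescaling, and two
    functionals of the slice then differ by at most \<open>e\<close>.\<close>
  define a where "a = p x - e/4 * (d/2)"
  have close: "\<bar>f h - p' h\<bar> \<le> e/2 * norm h" if f: "f \<in> K" "a < f x" for f h
  proof -
    have *: "f h - p' h \<le> e/2 * norm h" for h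
    proof (cases "h = 0")
      case True
      then show ?thesis by (simp add: p'.zero)
    next
      case False
      define k where "k = (d / 2 / norm h) *\<^sub>R h"
      have nk: "norm k = d/2" using False d by (simp add: k_def)
      have "f x + f k \<le> p (x + k)"
        using upper[OF f(1), of "x + k"] by (simp add: blinfun.bilinear_simps)
      also have "\<dots> \<le> p x + p' k + e/4 * (d/2)"
        using abs_ge_self[of "p (x + k) - p x - p' k"] d(2)[of "x + k"] nk d(1) by simp
      finally have "f k - p' k \<le> e/2 * (d/2)"
        using f(2) by (simp add: a_def)
      moreover have "f k - p' k = (d/2/norm h) * (f h - p' h)"
        by (simp add: k_def blinfun.bilinear_simps p'.scaleR algebra_simps diff_divide_distrib)
      ultimately have "(d/2/norm h) * (f h - p' h) \<le> (d/2/norm h) * (e/2 * norm h)"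
        using False by (simp add: mult.commute)
      then show ?thesis
        by (rule mult_left_le_imp_le) (use False d in auto)
    qed
    from *[of h] *[of "-h"] show ?thesis
      by (auto simp: abs_real_def blinfun.bilinear_simps p'.neg)
  qed
  have "small_slice e K x a"
    unfolding small_slice_def
  proof (intro ballI impI)
    fix f g assume fg: "f \<in> K" "g \<in> K" "a < f x" "a < g x"
    show "norm (f - g) \<le> e"
    proof (rule norm_blinfun_bound)
      show "norm ((f - g) h) \<le> e * norm h" for h
        using close[OF fg(1,3), of h] close[OF fg(2,4), of h]
        unfolding blinfun.diff_left real_norm_def by linarith
    qed (use e in simp)
  qed
  moreover have "\<exists>f\<in>K. a < f x"
    using less_cSUP_iff[OF K(1) bdd, of a x] d e by (simp add: a_def p_def)
  ultimately show ?thesis using that by blast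
qed

section \<open>Transfinite derivation of the dual ball, without ordinals\<close>

inductive_set slice_tower :: "real \<Rightarrow> ('a::real_normed_vector \<Rightarrow>\<^sub>L real) set set" for e where
  Inter: "(\<forall>K\<in>M. K \<in> slice_tower e) \<Longrightarrow> polar_ball {} \<inter> \<Inter>M \<in> slice_tower e"
| derivative: "K \<in> slice_tower e \<Longrightarrow> slice_derivative e K \<in> slice_tower e"

text \<open>Intersections serve as limit stages. The factor \<open>polar_ball {}\<close> keeps the
  intersection of the empty family, which starts the tower, inside the ball.\<close>

lemma slice_tower_polar_ball:
  assumes "K \<in> slice_tower e"
  obtains S where "K = polar_ball S"
proof -
  have "\<exists>S. K = polar_ball S"
    using assms
  proof induction
    case (Inter M)
    then obtain S where S: "\<And>K. K \<in> M \<Longrightarrow> K = polar_ball (S K)" by metis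
    have "polar_ball {} \<inter> \<Inter>M = polar_ball (\<Union>K\<in>M. S K)"
    proof (intro equalityI subsetI)
      fix f assume f: "f \<in> polar_ball {} \<inter> \<Inter>M"
      then have "f \<in> polar_ball (S K)" if "K \<in> M" for K
        using S[OF that] that by auto
      then show "f \<in> polar_ball (\<Union>K\<in>M. S K)"
        using f by (fastforce simp: polar_ball_def)
    next
      fix f assume f: "f \<in> polar_ball (\<Union>K\<in>M. S K)"
      then have "f \<in> polar_ball (S K)" if "K \<in> M" for K
        using that by (auto simp: polar_ball_def)
      then show "f \<in> polar_ball {} \<inter> \<Inter>M"
        using f S by (fastforce simp: polar_ball_def)
    qed
    then show ?case by blast
  next
    case (derivative K)
    then show ?case
      using slice_derivative_polar_ball by metis
  qed
  then show ?thesis using that by blast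
qed

text \<open>
  As in the Bourbaki-Witt theorem, every member of the tower is extreme, so the tower is a chain
  and a member and its derivative are adjacent.
\<close>

lemma slice_tower_extreme:
  assumes e: "E \<in> slice_tower e"
    and extreme: "\<And>L. L \<in> slice_tower e \<Longrightarrow> E \<subset> L \<Longrightarrow> E \<subseteq> slice_derivative e L"
    and L: "L \<in> slice_tower e"
  shows "E \<subseteq> L \<or> L \<subseteq> slice_derivative e E"
  using L
proof induction
  case (Inter M)
  have "E \<subseteq> polar_ball {}"
    using e by (metis slice_tower_polar_ball empty_subsetI polar_ball_mono)
  then show ?case using Inter by blast
next
  case (derivative K)
  then show ?case
    using extreme[of K] slice_derivative_subset[of e K] by auto
qed

lemma slice_tower_succ:
  assumes "E \<in> slice_tower e" "L \<in> slice_tower e"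
  shows "E \<subseteq> L \<or> L \<subseteq> slice_derivative e E"
proof -
  have "\<forall>L \<in> slice_tower e. E \<subset> L \<longrightarrow> E \<subseteq> slice_derivative e L"
    using assms(1)
  proof induction
    case (Inter M)
    let ?E = "polar_ball {} \<inter> \<Inter>M"
    have E: "?E \<in> slice_tower e"
      using Inter by (blast intro: slice_tower.Inter)
    show ?case
    proof (intro ballI impI)
      fix L assume L: "L \<in> slice_tower e" "?E \<subset> L"
      have "L \<subseteq> polar_ball {}"
        using L(1) by (metis slice_tower_polar_ball empty_subsetI polar_ball_mono)
      have "\<not> (\<forall>K\<in>M. L \<subseteq> K)"
        using L \<open>L \<subseteq> polar_ball {}\<close> by blast
      then obtain K where K: "K \<in> M" "\<not> L \<subseteq> K" by blast
      have ext: "\<And>L. L \<in> slice_tower e \<Longrightarrow> K \<subset> L \<Longrightarrow> K \<subseteq> slice_derivative e L"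
        and KT: "K \<in> slice_tower e"
        using Inter K(1) by auto
      have "K \<subseteq> L"
        using slice_tower_extreme[OF KT ext L(1)] K(2) slice_derivative_subset[of e K] by blast
      then have "K \<subseteq> slice_derivative e L"
        using ext[OF L(1)] K(2) by blast
      then show "?E \<subseteq> slice_derivative e L"
        using K(1) by blast
    qed
  next
    case (derivative K)
    show ?case
    proof (intro ballI impI)
      fix L assume L: "L \<in> slice_tower e" "slice_derivative e K \<subset> L"
      have "K \<subseteq> L \<or> L \<subseteq> slice_derivative e K"
        using derivative L(1) by (intro slice_tower_extreme) auto
      then have "K \<subseteq> L" using L(2) by blast
      then show "slice_derivative e K \<subseteq> slice_derivative e L"
        using derivative L(1) slice_derivative_subset[of e K] by (cases "K = L") auto
    qed
  qed
  with assms show ?thesis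
    by (intro slice_tower_extreme) auto
qed

text \<open>
  The smallest member of the tower meeting \<open>C\<close>; its derivative misses \<open>C\<close>. This replaces the
  ordinal at which the derivation leaves \<open>C\<close>.
\<close>

definition last_meeting ::
    "real \<Rightarrow> ('a::real_normed_vector \<Rightarrow>\<^sub>L real) set \<Rightarrow> ('a \<Rightarrow>\<^sub>L real) set" where
  "last_meeting e C = polar_ball {} \<inter> \<Inter>{K \<in> slice_tower e. K \<inter> C \<noteq> {}}"

lemma last_meeting_in_tower: "last_meeting e C \<in> slice_tower e"
  unfolding last_meeting_def by (rule slice_tower.Inter) auto

text \<open>This criterion transfers the last member from one set \<open>C\<close> to another: every
  other member of the tower contains \<open>K\<close> or lies in its derivative, which misses
  \<open>C\<close>.\<close>

lemma last_meeting_eqI: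
  assumes "K \<in> slice_tower e" "K \<inter> C \<noteq> {}" "slice_derivative e K \<inter> C = {}"
  shows "last_meeting e C = K"
proof -
  have "K \<subseteq> polar_ball {}"
    using assms(1) by (metis slice_tower_polar_ball empty_subsetI polar_ball_mono)
  moreover have "K \<subseteq> J" if "J \<in> slice_tower e" "J \<inter> C \<noteq> {}" for J
    using slice_tower_succ[OF assms(1) that(1)] that(2) assms(3) by blast
  ultimately show ?thesis
    using assms unfolding last_meeting_def by blast
qed

text \<open>The members meeting \<open>C\<close> form a chain. If their intersection missed
  \<open>C\<close>, finitely many constraints would show this, and by the chain property all of them
  that are not in \<open>T\<close> are valid on a single member.\<close>

lemma last_meeting_meets:
  assumes "polar_ball T \<noteq> {}"
  shows "last_meeting e (polar_ball T) \<inter> polar_ball T \<noteq> {}"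
proof
  let ?C = "polar_ball T"
  assume empty: "last_meeting e ?C \<inter> ?C = {}"
  let ?M = "{K \<in> slice_tower e. K \<inter> ?C \<noteq> {}}"
  \<comment> \<open>All constraints valid on \<open>K\<close>, not just some defining ones: this
    choice reverses inclusions, so the chain of sets becomes a chain of constraint sets.\<close>
  define S where "S K = {(x, a). \<forall>f\<in>K. blinfun_apply f x \<le> a}" for K :: "('a \<Rightarrow>\<^sub>L real) set"
  have S: "polar_ball (S K) = K" if KT: "K \<in> slice_tower e" for K
  proof
    obtain R where R: "K = polar_ball R" using KT by (rule slice_tower_polar_ball)
    have "R \<subseteq> S K" by (auto simp: S_def R polar_ball_def)
    then show "polar_ball (S K) \<subseteq> K" using R polar_ball_mono by blast
    show "K \<subseteq> polar_ball (S K)" by (auto simp: S_def R polar_ball_def)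
  qed
  have "polar_ball (T \<union> (\<Union>K\<in>?M. S K)) \<subseteq> last_meeting e ?C \<inter> ?C"
  proof
    fix f assume f: "f \<in> polar_ball (T \<union> (\<Union>K\<in>?M. S K))"
    have "f \<in> K" if "K \<in> ?M" for K
      using that f S[of K] by (auto simp: polar_ball_def)
    then show "f \<in> last_meeting e ?C \<inter> ?C"
      using f unfolding last_meeting_def by (auto simp: polar_ball_def)
  qed
  then have "polar_ball (T \<union> (\<Union>K\<in>?M. S K)) = {}" using empty by blast
  then obtain F where F: "finite F" "F \<subseteq> T \<union> (\<Union>K\<in>?M. S K)" "polar_ball F = {}"
    by (rule polar_ball_fip)
  \<comment> \<open>Makes the chain nonempty, which matters when all constraints in \<open>F\<close>
    come from \<open>T\<close>.\<close>
  have ball: "polar_ball {} \<in> ?M"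
    using assms slice_tower.Inter[of "{}" e] by (auto simp: polar_ball_def)
  have "\<exists>K\<in>?M. F - T \<subseteq> S K"
  proof -
    have "subset.chain UNIV (S ` ?M)"
      unfolding subset.chain_def
    proof (intro conjI ballI)
      fix A B assume "A \<in> S ` ?M" "B \<in> S ` ?M"
      then obtain K L where KL: "A = S K" "B = S L" "K \<in> slice_tower e" "L \<in> slice_tower e" by blast
      then have "K \<subseteq> L \<or> L \<subseteq> K"
        using slice_tower_succ[of K e L] slice_derivative_subset[of e K] by blast
      then have "A \<subseteq> B \<or> B \<subseteq> A"
        unfolding KL S_def by blast
      then show "(\<subset>)\<^sup>=\<^sup>= A B \<or> (\<subset>)\<^sup>=\<^sup>= B A" by auto
    qed auto
    then obtain A where "A \<in> S ` ?M" "F - T \<subseteq> A"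
      using finite_subset_Union_chain[of "F - T" "S ` ?M" UNIV] F ball
      by (metis (no_types, lifting) Diff_subset_conv empty_iff finite_Diff image_eqI)
    then show ?thesis by blast
  qed
  then obtain K where K: "K \<in> ?M" "F \<subseteq> T \<union> S K" by blast
  then have "polar_ball F \<supseteq> K \<inter> ?C"
    using S[of K] polar_ball_mono[of F "T \<union> S K"] by (auto simp: polar_ball_Un)
  then show False using K F(3) by blast
qed

text \<open>If the derivative still met the set, minimality would put the last member inside its own
  derivative, although an Asplund space provides a nonempty small slice to remove.\<close>

lemma slice_derivative_last_meeting:
  fixes T :: "('a::banach \<times> real) set"
  assumes asp: "asplund TYPE('a)" and "polar_ball T \<noteq> {}" "0 < e"
  shows "slice_derivative e (last_meeting e (polar_ball T)) \<inter> polar_ball T = {}"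
proof (rule ccontr)
  let ?L = "last_meeting e (polar_ball T)"
  assume "slice_derivative e ?L \<inter> polar_ball T \<noteq> {}"
  then have "?L \<subseteq> slice_derivative e ?L"
    using slice_tower.derivative[OF last_meeting_in_tower] by (auto simp: last_meeting_def)
  moreover obtain x a f where "small_slice e ?L x a" "f \<in> ?L" "a < blinfun_apply f x"
    by (rule asplund_small_slice[OF asp, of ?L e])
      (use last_meeting_meets[OF assms(2), of e] assms(3) in \<open>auto simp: last_meeting_def\<close>)
  ultimately show False
    by (force simp: slice_derivative_def)
qed

text \<open>Every point of the intersection is removed by a small slice. By compactness finitely
  many slices suffice, and one point chosen from each of them gives the net.\<close>

lemma finite_net:
  assumes "slice_derivative e (polar_ball S) \<inter> polar_ball T = {}"
  shows "\<exists>F. finite F \<and> (\<forall>f\<in>polar_ball S \<inter> polar_ball T. \<exists>g\<in>F. norm (f - g) \<le> e)"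
proof -
  let ?K = "polar_ball S"
  let ?sm = "{(x, a). small_slice e ?K x a}"
  have "polar_ball (S \<union> ?sm \<union> T) = {}"
    using assms by (simp only: slice_derivative_polar_ball polar_ball_Un)
  then obtain A where A: "finite A" "A \<subseteq> S \<union> ?sm \<union> T" "polar_ball A = {}"
    by (rule polar_ball_fip)
  define c where "c p = (SOME g. g \<in> ?K \<and> snd p < blinfun_apply g (fst p))" for p
  have "\<exists>g\<in>c ` A. norm (f - g) \<le> e" if f: "f \<in> ?K" "f \<in> polar_ball T" for f
  proof -
    have "norm f \<le> 1" "f \<notin> polar_ball A"
      using A(3) f by (auto simp: polar_ball_def)
    then obtain x a where p: "(x, a) \<in> A" "a < f x"
      by (auto simp: polar_ball_def not_le)
    have "(x, a) \<notin> S" "(x, a) \<notin> T"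
      using f p(2) by (auto simp: polar_ball_def not_le[symmetric])
    then have sm: "small_slice e ?K x a"
      using A(2) p(1) by auto
    have "c (x, a) \<in> ?K \<and> a < c (x, a) x"
      unfolding c_def by (rule someI2[where a = f]) (use f p in auto)
    then have "norm (f - c (x, a)) \<le> e"
      using sm f(1) p(2) unfolding small_slice_def by blast
    then show ?thesis using p(1) by blast
  qed
  moreover have "finite (c ` A)" using A(1) by (rule finite_imageI)
  ultimately show ?thesis by blast
qed

text \<open>Upper bounds at \<open>v\<close> and at \<open>- v\<close> force equality. The
  extensions in the unit ball of a restriction to \<open>V\<close> are therefore themselves given by
  constraints.\<close>

lemma polar_ball_eq_on:
  assumes "\<And>v. v \<in> V \<Longrightarrow> - v \<in> V"
  shows "polar_ball ((\<lambda>v. (v, blinfun_apply f v)) ` V) = {g. norm g \<le> 1 \<and> (\<forall>v\<in>V. blinfun_apply g v = blinfun_apply f v)}"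
proof -
  have "(\<forall>v\<in>V. g v \<le> f v) \<longleftrightarrow> (\<forall>v\<in>V. g v = f v)" for g :: "'a \<Rightarrow>\<^sub>L real"
    using assms by (metis blinfun.minus_right dual_order.refl neg_le_iff_le order_antisym)
  then show ?thesis by (auto simp: polar_ball_def)
qed

text \<open>
  By compactness it is enough to separate on finitely many vectors of \<open>V\<close>, where the separating
  vector is found from a point minimising the sum of the squared distances.
\<close>

lemma separate_from_restriction:
  fixes f :: "'a::real_normed_vector \<Rightarrow>\<^sub>L real"
  assumes V: "subspace V"
    and disj: "polar_ball S \<inter> polar_ball ((\<lambda>v. (v, blinfun_apply f v)) ` V) = {}"
  obtains x a where "x \<in> V" "\<And>g. g \<in> polar_ball S \<Longrightarrow> blinfun_apply g x \<le> a" "a < blinfun_apply f x"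
proof (cases "polar_ball S = {}")
  case True
  show ?thesis
    by (rule that[of 0 "-1"]) (use True subspace_0[OF V] in auto)
next
  case False
  obtain A where A: "finite A" "A \<subseteq> S \<union> (\<lambda>v. (v, blinfun_apply f v)) ` V" "polar_ball A = {}"
    using disj by (metis polar_ball_Un polar_ball_fip)
  define F where "F = fst ` A \<inter> V"
  have F: "finite F" "F \<subseteq> V" using A by (auto simp: F_def)
  have noeq: "\<exists>v\<in>F. g v \<noteq> f v" if "g \<in> polar_ball S" for g
  proof (rule ccontr)
    assume *: "\<not> ?thesis"
    have "g x \<le> a" if "(x, a) \<in> A" for x a
    proof (cases "(x, a) \<in> S")
      case True
      then show ?thesis using \<open>g \<in> polar_ball S\<close> by (auto simp: polar_ball_def)
    next
      case False
      then have "x \<in> V" "a = f x" using A(2) that by auto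
      then show ?thesis using * that by (force simp: F_def)
    qed
    then have "g \<in> polar_ball A"
      using that by (auto simp: polar_ball_def)
    then show False using A(3) by blast
  qed
  define q where "q \<phi> = (\<Sum>v\<in>F. (\<phi> v - f v)\<^sup>2)" for \<phi> :: "'a \<Rightarrow> real"
  have "continuous_on UNIV q"
    unfolding q_def by (intro continuous_intros continuous_on_product_coordinates)
  then have "\<exists>\<phi>\<in>blinfun_apply ` polar_ball S. \<forall>\<psi>\<in>blinfun_apply ` polar_ball S. q \<phi> \<le> q \<psi>"
    using False by (intro continuous_attains_inf compact_polar_ball)
      (auto intro: continuous_on_subset)
  then obtain p where p: "p \<in> polar_ball S" "\<And>g. g \<in> polar_ball S \<Longrightarrow> q p \<le> q g"
    by auto
  have qpos: "q p > 0"
    using noeq[OF p(1)] F(1) unfolding q_def by (auto intro: sum_pos2)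
  \<comment> \<open>Evaluation at \<open>x\<close> is minus half the derivative of \<open>q\<close>
    at the minimiser \<open>p\<close>. First-order optimality says that \<open>p\<close> maximises
    this evaluation over \<open>polar_ball S\<close>, and \<open>f\<close> exceeds the maximum by
    exactly \<open>q p\<close>.\<close>
  define x where "x = (\<Sum>v\<in>F. (f v - p v) *\<^sub>R v)"
  have ax: "g x = (\<Sum>v\<in>F. (f v - p v) * g v)" for g :: "'a \<Rightarrow>\<^sub>L real"
    by (simp add: x_def blinfun.sum_right blinfun.scaleR_right)
  have "x \<in> V"
    unfolding x_def using F V by (intro subspace_sum) (auto intro: subspace_scale)
  moreover have "g x \<le> p x" if g: "g \<in> polar_ball S" for g
  proof -
    define B where "B = (\<Sum>v\<in>F. (f v - p v) * (g v - p v))"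
    define C where "C = (\<Sum>v\<in>F. (g v - p v)\<^sup>2)"
    have t: "2 * B \<le> t * C" if t: "0 < t" "t \<le> 1" for t :: real
    proof -
      have "(1 - t) *\<^sub>R p + t *\<^sub>R g \<in> polar_ball S"
        using convexD[OF convex_polar_ball p(1) g] t by simp
      then have "q p \<le> q ((1 - t) *\<^sub>R p + t *\<^sub>R g)" by (rule p(2))
      also have "\<dots> = (\<Sum>v\<in>F. (p v - f v)\<^sup>2 - 2 * t * ((f v - p v) * (g v - p v)) + t\<^sup>2 * (g v - p v)\<^sup>2)"
        unfolding q_def
        by (intro sum.cong) (auto simp: blinfun.bilinear_simps power2_eq_square algebra_simps)
      also have "\<dots> = q p - 2 * t * B + t\<^sup>2 * C"
        by (simp add: q_def B_def C_def sum.distrib sum_subtractf sum_distrib_left mult.assoc)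
      finally have "t * (2 * B) \<le> t * (t * C)" by (simp add: power2_eq_square algebra_simps)
      then show ?thesis using t(1) by simp
    qed
    have "B \<le> 0"
    proof (rule ccontr)
      assume B: "\<not> B \<le> 0"
      have C: "C \<ge> 0" unfolding C_def by (rule sum_nonneg) auto
      \<comment> \<open>Chosen so that \<open>t * C\<close> is at most \<open>B\<close>, against
        \<open>2 * B \<le> t * C\<close>.\<close>
      define t where "t = min 1 (B / (C + 1))"
      have "0 < t" "t \<le> 1" using B C by (auto simp: t_def)
      moreover have "t * C \<le> B / (C + 1) * C"
        using C by (intro mult_right_mono) (auto simp: t_def)
      moreover have "B / (C + 1) * C \<le> B" using B C by (simp add: field_simps)
      ultimately show False using t[of t] B by linarith
    qed
    moreover have "g x - p x = B"
      by (simp add: ax B_def sum_subtractf[symmetric] algebra_simps)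
    ultimately show ?thesis by simp
  qed
  moreover have "f x - p x = q p"
    unfolding ax q_def sum_subtractf[symmetric]
    by (intro sum.cong) (auto simp: power2_eq_square algebra_simps)
  then have "p x < f x" using qpos by simp
  ultimately show ?thesis using that by blast
qed

section \<open>Countably many functionals attached to a vector\<close>

definition slice_net :: "nat \<Rightarrow> 'a::banach \<Rightarrow> real \<Rightarrow> ('a \<Rightarrow>\<^sub>L real) set" where
  "slice_net n x a = (let L = last_meeting (1 / Suc n) (polar_ball {(- x, - a)}) in
     SOME F. finite F \<and>
       (slice_derivative (1 / Suc n) L \<inter> polar_ball {(- x, - a)} = {} \<longrightarrow>
        (\<forall>f\<in>L \<inter> polar_ball {(- x, - a)}. \<exists>g\<in>F. norm (f - g) \<le> 1 / Suc n)))"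

text \<open>The half-space where \<open>f x\<close> is at least \<open>a\<close> is written as a
  constraint at \<open>- x\<close>. If the derivative of the last member still meets it, any finite
  set is admissible, so the choice is possible for all \<open>x\<close> and
  \<open>a\<close>.\<close>

lemma slice_net:
  shows finite_slice_net: "finite (slice_net n x a)"
    and slice_net_close: "\<And>L f. last_meeting (1 / Suc n) (polar_ball {(- x, - a)}) = L \<Longrightarrow>
      slice_derivative (1 / Suc n) L \<inter> polar_ball {(- x, - a)} = {} \<Longrightarrow>
      f \<in> L \<Longrightarrow> f \<in> polar_ball {(- x, - a)} \<Longrightarrow> \<exists>g\<in>slice_net n x a. norm (f - g) \<le> 1 / Suc n"
proof -
  let ?L = "last_meeting (1 / Suc n) (polar_ball {(- x, - a)})"
  let ?P = "\<lambda>F. finite F \<and>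
       (slice_derivative (1 / Suc n) ?L \<inter> polar_ball {(- x, - a)} = {} \<longrightarrow>
        (\<forall>f\<in>?L \<inter> polar_ball {(- x, - a)}. \<exists>g\<in>F. norm (f - g) \<le> 1 / Suc n))"
  obtain S where "?L = polar_ball S"
    by (rule slice_tower_polar_ball[OF last_meeting_in_tower])
  then have "\<exists>F. ?P F"
    using finite_net[of "1 / Suc n" S "{(- x, - a)}"] by (cases "slice_derivative (1 / Suc n) ?L \<inter> polar_ball {(- x, - a)} = {}") auto
  then have *: "?P (slice_net n x a)"
    unfolding slice_net_def Let_def by (rule someI_ex[of ?P])
  show "finite (slice_net n x a)" using * by blast
  show "\<And>L f. ?L = L \<Longrightarrow> slice_derivative (1 / Suc n) L \<inter> polar_ball {(- x, - a)} = {} \<Longrightarrow>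
      f \<in> L \<Longrightarrow> f \<in> polar_ball {(- x, - a)} \<Longrightarrow> \<exists>g\<in>slice_net n x a. norm (f - g) \<le> 1 / Suc n"
    using * by blast
qed

text \<open>The nets approximate functionals in the unit ball; the factors \<open>k\<close> reach
  functionals of arbitrary norm.\<close>

definition real_generator :: "'a::banach \<Rightarrow> ('a \<Rightarrow>\<^sub>L real) set" where
  "real_generator x = (\<Union>n. \<Union>a\<in>\<rat>. \<Union>k. (\<lambda>g. real k *\<^sub>R g) ` slice_net n x a)"

lemma countable_real_generator: "countable (real_generator x)"
  unfolding real_generator_def
  by (intro countable_UN countable_image countable_rat countableI_type countable_finite
      finite_slice_net)

text \<open>Let \<open>L\<close> be the last member meeting the set \<open>?E\<close> of extensions
  of the scaled functional. Its derivative misses \<open>?E\<close>, so a vector \<open>x\<close> of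
  \<open>V\<close> separates them. Moving \<open>x\<close> to a nearby \<open>y\<close> in
  \<open>D\<close> and taking a rational threshold \<open>b\<close> keeps the separation, so
  \<open>L\<close> is also the last member for the half-space of \<open>(y, b)\<close>. The net
  chosen there contains a functional close to some extension in \<open>L\<close>.\<close>

theorem real_generator_dense:
  fixes V D :: "'a::banach set"
  assumes asp: "asplund TYPE('a)" and V: "subspace V" and D: "D \<subseteq> V" "V \<subseteq> closure D" and e: "0 < e"
  shows "\<exists>d\<in>D. \<exists>g\<in>real_generator d. \<forall>v\<in>V. \<bar>blinfun_apply f v - blinfun_apply g v\<bar> \<le> e * norm v"
proof -
  define k where "k = Suc (nat \<lceil>norm f\<rceil>)"
  have k: "norm f \<le> real k" "real k > 0" unfolding k_def by linarith+
  define f1 where "f1 = (1 / real k) *\<^sub>R f"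
  have nf1: "norm f1 \<le> 1" using k by (simp add: f1_def)
  \<comment> \<open>Scaling back by \<open>k\<close> multiplies the accuracy of the net by
    \<open>k\<close>.\<close>
  obtain n where n: "1 / real (Suc n) < e / real k"
    using e k by (metis divide_pos_pos nat_approx_posE)
  let ?n = "1 / real (Suc n)"
  let ?E = "polar_ball ((\<lambda>v. (v, blinfun_apply f1 v)) ` V)"
  have E: "?E = {g. norm g \<le> 1 \<and> (\<forall>v\<in>V. blinfun_apply g v = f1 v)}"
    by (rule polar_ball_eq_on) (use V subspace_neg in auto)
  then have Ene: "?E \<noteq> {}" using nf1 by blast
  define L where "L = last_meeting ?n ?E"
  have L: "L \<in> slice_tower ?n" by (simp add: L_def last_meeting_in_tower)
  have LE: "L \<inter> ?E \<noteq> {}" unfolding L_def by (rule last_meeting_meets[OF Ene])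
  have L'E: "slice_derivative ?n L \<inter> ?E = {}"
    unfolding L_def by (rule slice_derivative_last_meeting[OF asp Ene]) simp
  obtain S where S: "slice_derivative ?n L = polar_ball S"
    by (rule slice_tower_polar_ball[OF slice_tower.derivative[OF L]])
  obtain x a where x: "x \<in> V" "\<And>g. g \<in> polar_ball S \<Longrightarrow> g x \<le> a" "a < f1 x"
    using separate_from_restriction[OF V, of S f1] L'E unfolding S by blast
  \<comment> \<open>Replacing \<open>x\<close> by \<open>y\<close> costs at most \<open>d\<close> on
    each side of the gap of width \<open>4 * d\<close>, which leaves an interval of width
    \<open>2 * d\<close> for the rational threshold.\<close>
  define d where "d = (f1 x - a) / 4"
  have d: "d > 0" using x(3) by (simp add: d_def)
  obtain y where y: "y \<in> D" "norm (y - x) < d"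
    using x(1) D(2) d by (metis closure_approachable dist_norm subsetD)
  have near: "\<bar>g y - g x\<bar> \<le> d" if "norm g \<le> 1" for g :: "'a \<Rightarrow>\<^sub>L real"
  proof -
    have "\<bar>g y - g x\<bar> \<le> norm g * norm (y - x)"
      using norm_blinfun[of g "y - x"] by (simp add: blinfun.bilinear_simps)
    also have "\<dots> \<le> 1 * norm (y - x)" by (intro mult_right_mono that) auto
    finally show ?thesis using y by simp
  qed
  obtain b where b: "b \<in> \<rat>" "a + d < b" "b < f1 x - d"
    using Rats_dense_in_real[of "a + d" "f1 x - d"] d by (auto simp: d_def field_simps)
  let ?C = "polar_ball {(- y, - b)}"
  have "f1 y > b" using near[OF nf1] b by (simp add: abs_le_iff)
  moreover obtain g0 where g0: "g0 \<in> L" "g0 \<in> ?E" using LE by blast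
  moreover from this have "norm g0 \<le> 1" "g0 y = f1 y"
    using y(1) D(1) unfolding E by auto
  ultimately have g0C: "g0 \<in> ?C"
    by (auto simp: polar_ball_def blinfun.minus_right)
  have L'C: "slice_derivative ?n L \<inter> ?C = {}"
  proof -
    have "g y < b" if g: "g \<in> polar_ball S" for g
    proof -
      have "norm g \<le> 1" using g by (simp add: polar_ball_def)
      then show ?thesis using near[of g] x(2)[OF g] b(2) by linarith
    qed
    then show ?thesis unfolding S by (force simp: polar_ball_def blinfun.minus_right)
  qed
  \<comment> \<open>The set \<open>L\<close>, defined from \<open>f\<close> and \<open>V\<close>, is
    now recovered from \<open>y\<close> and \<open>b\<close> alone, and this is the set for which
    \<open>slice_net n y b\<close> was chosen.\<close>
  have LC: "last_meeting ?n ?C = L"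
    by (rule last_meeting_eqI[OF L]) (use g0 g0C L'C in blast)+
  obtain g where g: "g \<in> slice_net n y b" "norm (g0 - g) \<le> ?n"
    using slice_net_close[OF LC L'C g0(1) g0C] by blast
  have "real k *\<^sub>R g \<in> real_generator y"
    using g(1) b(1) unfolding real_generator_def by blast
  moreover have "\<bar>f v - (real k *\<^sub>R g) v\<bar> \<le> e * norm v" if v: "v \<in> V" for v
  proof -
    have g0v: "g0 v = f1 v" using g0(2) v unfolding E by blast
    have "f v - (real k *\<^sub>R g) v = real k * (g0 - g) v"
      using g0v k by (simp add: f1_def blinfun.bilinear_simps field_simps)
    then have "\<bar>f v - (real k *\<^sub>R g) v\<bar> \<le> real k * (norm (g0 - g) * norm v)"
      using norm_blinfun[of "g0 - g" v] k by (simp add: abs_mult)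
    also have "\<dots> \<le> real k * (e / real k * norm v)"
      using g n k by (intro mult_left_mono mult_right_mono) auto
    finally show ?thesis using k by simp
  qed
  ultimately show ?thesis using y by blast
qed

section \<open>Separation without the Hahn-Banach theorem\<close>

lemma bdd_below_image_dist: "bdd_below (dist x ` Z)"
  by (rule bdd_belowI2[where m = 0]) simp

lemma convex_on_infdist:
  fixes Z :: "'a::real_normed_vector set"
  assumes "convex Z"
  shows "convex_on UNIV (\<lambda>x. infdist x Z)"
proof (cases "Z = {}")
  case True
  then show ?thesis by (simp add: infdist_def convex_on_def)
next
  case False
  have "infdist (u *\<^sub>R x + v *\<^sub>R y) Z \<le> u * infdist x Z + v * infdist y Z"
    if uv: "0 \<le> u" "0 \<le> v" "u + v = 1" for x y u v
  proof (rule field_le_epsilon)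
    fix e :: real assume e: "e > 0"
    have near: "\<exists>z\<in>Z. dist x z < infdist x Z + e" for x
      using cINF_less_iff[OF False, of "dist x" "infdist x Z + e"] e
      by (simp add: infdist_notempty[OF False] bdd_below_image_dist)
    obtain z w where zw: "z \<in> Z" "w \<in> Z" "dist x z < infdist x Z + e" "dist y w < infdist y Z + e"
      using near by meson
    have "u *\<^sub>R z + v *\<^sub>R w \<in> Z" using convexD[OF assms zw(1,2)] uv by blast
    then have "infdist (u *\<^sub>R x + v *\<^sub>R y) Z \<le> dist (u *\<^sub>R x + v *\<^sub>R y) (u *\<^sub>R z + v *\<^sub>R w)"
      by (rule infdist_le)
    also have "\<dots> = norm (u *\<^sub>R (x - z) + v *\<^sub>R (y - w))"
      by (simp add: dist_norm algebra_simps)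
    also have "\<dots> \<le> u * dist x z + v * dist y w"
      by (rule norm_triangle_le) (use uv in \<open>simp add: dist_norm\<close>)
    also have "\<dots> \<le> u * (infdist x Z + e) + v * (infdist y Z + e)"
      using zw uv by (intro add_mono mult_left_mono) auto
    also have "\<dots> = u * infdist x Z + v * infdist y Z + (u + v) * e"
      by (simp add: algebra_simps)
    finally show "infdist (u *\<^sub>R x + v *\<^sub>R y) Z \<le> u * infdist x Z + v * infdist y Z + e"
      using uv by simp
  qed
  then show ?thesis by (auto simp: convex_on_def)
qed

text \<open>
  The functional is a derivative of the distance to \<open>Z\<close> at a point close to \<open>x0\<close>.
\<close>

lemma asplund_separation:
  fixes Z :: "'a::banach set"
  assumes asp: "asplund TYPE('a)" and Z: "subspace Z" "closed Z" "x0 \<notin> Z"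
  obtains g :: "'a \<Rightarrow>\<^sub>L real" where "\<And>z. z \<in> Z \<Longrightarrow> blinfun_apply g z = 0" "blinfun_apply g x0 \<noteq> 0"
proof -
  define p where "p x = infdist x Z" for x
  have Zne: "Z \<noteq> {}" using subspace_0[OF Z(1)] by blast
  have conv: "convex_on UNIV p"
    unfolding p_def by (rule convex_on_infdist[OF subspace_imp_convex[OF Z(1)]])
  moreover have "continuous_on UNIV p"
    unfolding p_def by (intro continuous_intros)
  ultimately obtain D where D: "UNIV \<subseteq> closure D" "\<forall>x\<in>D. p differentiable (at x)"
    using asp unfolding asplund_def by (metis convex_UNIV open_UNIV)
  have p0: "p x0 > 0"
    using infdist_pos_not_in_closed[OF Z(2) Zne Z(3)] by (simp add: p_def)
  have "x0 \<in> closure D" using D by blast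
  then obtain x where x: "x \<in> D" "dist x x0 < p x0 / 2"
    using p0 by (metis closure_approachable half_gt_zero)
  obtain p' where p': "(p has_derivative p') (at x)"
    using D(2) x(1) by (auto simp: differentiable_def)
  then interpret p': bounded_linear p'
    by (rule has_derivative_bounded_linear)
  have directional: "\<exists>s>0. s \<le> 1 \<and> \<bar>p (x + s *\<^sub>R v) - p x - s * p' v\<bar> \<le> s * (e * norm v)"
    if e: "e > 0" for e v
  proof -
    obtain d where d: "d > 0" "\<And>y. norm (y - x) < d \<Longrightarrow> norm (p y - p x - p' (y - x)) \<le> e * norm (y - x)"
      using p' e unfolding has_derivative_at_alt by meson
    define s where "s = min 1 (d / (norm v + 1))"
    have pos: "0 < norm v + 1" by (simp add: add_nonneg_pos)
    have "s * norm v \<le> d / (norm v + 1) * norm v"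
      by (intro mult_right_mono) (auto simp: s_def)
    also have "\<dots> < d" using d(1) pos by (simp add: field_simps)
    finally have s: "s > 0" "s \<le> 1" "s * norm v < d"
      using d(1) pos by (auto simp: s_def)
    then show ?thesis
      using d(2)[of "x + s *\<^sub>R v"] by (intro exI[of _ s]) (simp add: p'.scaleR algebra_simps)
  qed
  have bound: "p' v \<le> c" if c: "\<And>s. s > 0 \<Longrightarrow> s \<le> 1 \<Longrightarrow> p (x + s *\<^sub>R v) - p x \<le> s * c" for v c
  proof (rule field_le_epsilon)
    fix e :: real assume e: "e > 0"
    have pos: "e / (norm v + 1) > 0" using e by (simp add: add_nonneg_pos)
    obtain s where s: "s > 0" "s \<le> 1" "\<bar>p (x + s *\<^sub>R v) - p x - s * p' v\<bar> \<le> s * (e / (norm v + 1) * norm v)"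
      using directional[OF pos] by blast
    have "e / (norm v + 1) * norm v \<le> e / (norm v + 1) * (norm v + 1)"
      using pos by (intro mult_left_mono) auto
    also have "\<dots> = e" by (simp add: add_nonneg_eq_0_iff)
    finally have "s * (e / (norm v + 1) * norm v) \<le> s * e"
      by (rule mult_left_mono) (use s(1) in simp)
    then have "s * p' v \<le> s * (c + e)"
      using s(3) c[OF s(1,2)] unfolding distrib_left by linarith
    then show "p' v \<le> c + e" using s(1) by simp
  qed
  \<comment> \<open>Translation along \<open>Z\<close> does not increase the distance to
    \<open>Z\<close>. Applied to \<open>z\<close> and \<open>- z\<close> this makes the derivative
    vanish on \<open>Z\<close>.\<close>
  have zero: "p' z \<le> 0" if z: "z \<in> Z" for z
  proof (rule bound)
    fix s :: real assume "s > 0"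
    have "p (x + s *\<^sub>R z) \<le> p x"
      unfolding p_def infdist_notempty[OF Zne, of x]
    proof (rule cINF_greatest[OF Zne])
      fix w assume "w \<in> Z"
      then have "w + s *\<^sub>R z \<in> Z" using Z(1) z by (auto intro: subspace_add subspace_scale)
      then show "infdist (x + s *\<^sub>R z) Z \<le> dist x w"
        using infdist_le[of "w + s *\<^sub>R z" Z "x + s *\<^sub>R z"] by (simp add: dist_norm)
    qed
    then show "p (x + s *\<^sub>R z) - p x \<le> s * 0" by simp
  qed
  have "p' z = 0" if z: "z \<in> Z" for z
    using zero[OF z] zero[of "- z"] subspace_neg[OF Z(1) z] by (simp add: p'.neg)
  moreover have "p' (x0 - x) \<ge> - dist x x0"
  proof -
    have "p' (x - x0) \<le> dist x x0"
    proof (rule bound)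
      fix s :: real assume s: "s > 0"
      have "p (x + s *\<^sub>R (x - x0)) \<le> p x + dist (x + s *\<^sub>R (x - x0)) x"
        unfolding p_def by (rule infdist_triangle)
      then show "p (x + s *\<^sub>R (x - x0)) - p x \<le> s * dist x x0"
        using s by (simp add: dist_norm)
    qed
    then show ?thesis using p'.neg[of "x - x0"] by simp
  qed
  moreover have "p x \<le> p' x"
  proof -
    \<comment> \<open>Convexity along the segment from \<open>x\<close> to \<open>0\<close>, where
      \<open>p\<close> vanishes.\<close>
    have "p' (- x) \<le> - p x"
    proof (rule bound)
      fix s :: real assume s: "s > 0" "s \<le> 1"
      have "p ((1 - s) *\<^sub>R x + s *\<^sub>R 0) \<le> (1 - s) * p x + s * p 0"
        by (rule convex_onD[OF conv]) (use s in auto)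
      moreover have "p 0 = 0"
        unfolding p_def by (rule infdist_zero[OF subspace_0[OF Z(1)]])
      ultimately show "p (x + s *\<^sub>R - x) - p x \<le> s * (- p x)"
        by (simp add: algebra_simps)
    qed
    then show ?thesis by (simp add: p'.neg)
  qed
  moreover have "p x0 \<le> p x + dist x0 x"
    unfolding p_def by (rule infdist_triangle)
  \<comment> \<open>Adding the estimates gives
    \<open>p' x0 \<ge> p x - dist x x0 \<ge> p x0 - 2 * dist x x0\<close>, which is positive because
    \<open>x\<close> was taken within \<open>p x0 / 2\<close> of \<open>x0\<close>.\<close>
  ultimately have "p' x0 \<noteq> 0" "\<forall>z\<in>Z. p' z = 0"
    using x(2) p0 p'.diff[of x0 x] by (auto simp: dist_commute)
  then show ?thesis
    using that[of "Blinfun p'"] by (simp add: bounded_linear_Blinfun_apply[OF p'.bounded_linear_axioms])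
qed

section \<open>Functionals over the scalar field\<close>

definition scalar_embedding :: "'k::real_or_complex \<Rightarrow> complex" where
  "scalar_embedding = (SOME h. (\<forall>a b. h (a + b) = h a + h b) \<and> (\<forall>a b. h (a * b) = h a * h b) \<and>
     (\<forall>a. cmod (h a) = norm a) \<and> (range h = \<real> \<or> range h = UNIV))"

lemma scalar_embedding:
  shows scalar_embedding_add: "scalar_embedding (a + b) = scalar_embedding a + scalar_embedding b"
    and scalar_embedding_mult: "scalar_embedding (a * b) = scalar_embedding a * scalar_embedding b"
    and norm_scalar_embedding: "cmod (scalar_embedding a) = norm a"
    and range_scalar_embedding: "range (scalar_embedding :: 'k::real_or_complex \<Rightarrow> _) = \<real> \<or>
       range (scalar_embedding :: 'k::real_or_complex \<Rightarrow> _) = UNIV"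
  using someI_ex[OF real_or_complex, folded scalar_embedding_def] by blast+

lemma scalar_embedding_diff: "scalar_embedding (a - b) = scalar_embedding a - scalar_embedding b"
  using scalar_embedding_add[of "a - b" b] by simp

lemma scalar_embedding_inject: "scalar_embedding a = scalar_embedding b \<longleftrightarrow> a = b"
  by (metis norm_scalar_embedding scalar_embedding_diff norm_eq_zero right_minus_eq)

lemma scalar_embedding_1: "scalar_embedding 1 = 1"
  by (metis mult_cancel_left1 mult_1 norm_one norm_scalar_embedding norm_zero one_neq_zero
      scalar_embedding_mult)

text \<open>
  The value at a real \<open>r\<close> has modulus \<open>\<bar>r\<bar>\<close> and distance \<open>\<bar>r - 1\<bar>\<close> from \<open>1\<close>, which determines it.
\<close>

lemma scalar_embedding_of_real:
  "scalar_embedding (of_real r :: 'k::real_or_complex) = of_real r"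
proof -
  let ?z = "scalar_embedding (of_real r :: 'k)"
  have "cmod ?z = \<bar>r\<bar>" by (simp add: norm_scalar_embedding)
  then have 1: "(Re ?z)\<^sup>2 + (Im ?z)\<^sup>2 = r\<^sup>2"
    by (metis cmod_power2 power2_abs)
  have "cmod (?z - 1) = norm (of_real r - 1 :: 'k)"
    by (metis norm_scalar_embedding scalar_embedding_1 scalar_embedding_diff)
  also have "\<dots> = \<bar>r - 1\<bar>"
    by (metis norm_of_real of_real_1 of_real_diff)
  finally have "(Re (?z - 1))\<^sup>2 + (Im (?z - 1))\<^sup>2 = (r - 1)\<^sup>2"
    by (metis cmod_power2 power2_abs)
  then have "Re ?z = r"
    using 1 by (simp add: power2_eq_square algebra_simps)
  then show ?thesis
    using 1 by (simp add: complex_eq_iff)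
qed

definition scalar_re :: "'k::real_or_complex \<Rightarrow> real" where
  "scalar_re c = Re (scalar_embedding c)"

lemma scalar_re_of_real [simp]: "scalar_re (of_real r) = r"
  by (simp add: scalar_re_def scalar_embedding_of_real)

lemma scalar_re_le: "\<bar>scalar_re c\<bar> \<le> norm c"
  by (metis abs_Re_le_cmod norm_scalar_embedding scalar_re_def)

lemma bounded_linear_scalar_re: "bounded_linear scalar_re"
  by (rule bounded_linear_intro[where K = 1])
    (auto simp: scalar_re_def scalar_embedding_add scaleR_conv_of_real scalar_embedding_mult
      scalar_embedding_of_real scalar_re_le[unfolded scalar_re_def])

lemma scalar_re_diff: "scalar_re (a - b) = scalar_re a - scalar_re b"
  by (simp add: scalar_re_def scalar_embedding_diff)

lemma exists_rotation:
  fixes c :: "'k::real_or_complex"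
  obtains u where "norm u = 1" "u * c = of_real (norm c)"
proof (cases "c = 0")
  case True
  then show ?thesis using that[of 1] by simp
next
  case False
  then show ?thesis
    using that[of "of_real (norm c) * inverse c"] by (simp add: norm_mult norm_inverse)
qed

lemma exists_countable_dense_scalars: "\<exists>Q :: 'k::real_or_complex set. countable Q \<and> closure Q = UNIV"
proof -
  let ?h = "scalar_embedding :: 'k \<Rightarrow> complex"
  obtain T where T: "countable T" "T \<subseteq> range ?h" "range ?h \<subseteq> closure T"
    using separable by metis
  have "inj ?h" by (auto simp: inj_def scalar_embedding_inject)
  then have "countable (?h -` T)"
    using T(1) by (meson countable_image_inj_eq countable_subset image_vimage_subset inj_on_subset subset_UNIV)
  moreover have "x \<in> closure (?h -` T)" for x
    unfolding closure_approachable
  proof (intro allI impI)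
    fix e :: real assume e: "0 < e"
    obtain t where "t \<in> T" "dist t (?h x) < e"
      using T(3) e by (metis closure_approachable rangeI subsetD)
    moreover from this obtain y where "t = ?h y" using T(2) by blast
    ultimately show "\<exists>y\<in>?h -` T. dist y x < e"
      by (metis dist_norm norm_scalar_embedding scalar_embedding_diff vimageI2)
  qed
  ultimately show ?thesis by blast
qed

section \<open>Passage between real functionals and functionals over the scalar field\<close>

context banach_space_over
begin

lemma in_dualI:
  assumes "\<And>c x. blinfun_apply f (smul c x) = c * blinfun_apply f x"
  shows "f \<in> dual smul"
  unfolding dual_def mem_Collect_eq
  by unfold_locales (auto simp: assms blinfun.add_right algebra_simps)

lemma dual_smul: "f \<in> dual smul \<Longrightarrow> blinfun_apply f (smul c x) = c * blinfun_apply f x"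
  by (simp add: dual_def Vector_Spaces.linear_def module_hom_def module_hom_axioms_def)

lemma dual_diff: "f \<in> dual smul \<Longrightarrow> g \<in> dual smul \<Longrightarrow> f - g \<in> dual smul"
  by (rule in_dualI) (simp add: blinfun.diff_left dual_smul algebra_simps)

text \<open>A scalar of modulus 1 rotates the value at \<open>v\<close> to its modulus. Hence bounds
  on real parts suffice on a set closed under scalars, and this is how real estimates pass to the
  dual.\<close>

lemma norm_le_of_scalar_re_le:
  assumes f: "f \<in> dual smul" and V: "\<And>c v. v \<in> V \<Longrightarrow> smul c v \<in> V"
    and le: "\<And>v. v \<in> V \<Longrightarrow> \<bar>scalar_re (blinfun_apply f v)\<bar> \<le> B * norm v" and v: "v \<in> V"
  shows "norm (blinfun_apply f v) \<le> B * norm v"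
proof -
  obtain u where u: "norm u = 1" "u * f v = of_real (norm (f v))"
    by (rule exists_rotation)
  have "norm (f v) = scalar_re (f (smul u v))"
    using u(2) by (simp add: dual_smul[OF f])
  also have "\<dots> \<le> B * norm (smul u v)"
    using le[OF V[OF v, of u]] by simp
  finally show ?thesis using u(1) by (simp add: norm_scale)
qed

text \<open>For complex scalars this is the classical formula \<open>g x - i * g (i x)\<close>; for
  real scalars the functional is \<open>g\<close> itself, up to the identification of the scalars
  with the reals.\<close>

lemma exists_dual_of_real:
  fixes g :: "'a \<Rightarrow>\<^sub>L real"
  shows "\<exists>f\<in>dual smul. \<forall>x. scalar_re (blinfun_apply f x) = blinfun_apply g x"
  using range_scalar_embedding[where 'k = 'k]
proof
  assume r: "range (scalar_embedding :: 'k \<Rightarrow> _) = \<real>"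
  have c: "c = of_real (scalar_re c)" for c :: 'k
  proof -
    have "scalar_embedding c \<in> \<real>" using r by blast
    then have "scalar_embedding c = of_real (scalar_re c)"
      by (simp add: scalar_re_def)
    then show ?thesis by (metis scalar_embedding_inject scalar_embedding_of_real)
  qed
  have bl: "bounded_linear (\<lambda>x. of_real (g x) :: 'k)"
    by (rule bounded_linear_compose[OF bounded_linear_of_real blinfun.bounded_linear_right])
  show ?thesis
  proof (intro bexI allI)
    show "Blinfun (\<lambda>x. of_real (g x) :: 'k) \<in> dual smul"
    proof (rule in_dualI, unfold bounded_linear_Blinfun_apply[OF bl])
      fix d x
      show "of_real (g (smul d x)) = d * (of_real (g x) :: 'k)"
        using c[of d] scale_of_real[of "scalar_re d" x] by (metis blinfun.scaleR_right of_real_mult real_scaleR_def)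
    qed
  qed (simp add: bounded_linear_Blinfun_apply[OF bl])
next
  assume "range (scalar_embedding :: 'k \<Rightarrow> _) = UNIV"
  then obtain i :: 'k where i: "scalar_embedding i = \<i>" by (metis UNIV_I imageE)
  have "scalar_embedding (i * i) = scalar_embedding (of_real (- 1) :: 'k)"
    by (simp only: scalar_embedding_mult scalar_embedding_of_real i) simp
  then have ii: "i * i = - 1"
    by (simp only: scalar_embedding_inject) simp
  have ni: "norm i = 1" using norm_scalar_embedding[of i] i by simp
  have c: "c = of_real (scalar_re c) + i * of_real (Im (scalar_embedding c))" for c :: 'k
    by (subst scalar_embedding_inject[symmetric])
      (simp add: scalar_embedding_add scalar_embedding_mult scalar_embedding_of_real i
        scalar_re_def complex_eq_iff)
  define f where "f x = of_real (g x) - i * of_real (g (smul i x))" for x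
  have bl: "bounded_linear f"
  proof (rule bounded_linear_intro[where K = "norm g + norm g"])
    fix x y r
    show "f (x + y) = f x + f y"
      by (simp add: f_def scale_right_distrib blinfun.add_right algebra_simps)
    have "smul i (r *\<^sub>R x) = r *\<^sub>R smul i x"
      by (metis scale_of_real scale_left_commute)
    then show "f (r *\<^sub>R x) = r *\<^sub>R f x"
      by (simp add: f_def blinfun.scaleR_right scaleR_conv_of_real algebra_simps)
    have "norm (f x) \<le> \<bar>g x\<bar> + \<bar>g (smul i x)\<bar>"
      unfolding f_def by (rule order_trans[OF norm_triangle_ineq4]) (simp add: norm_mult ni)
    also have "\<dots> \<le> norm g * norm x + norm g * norm (smul i x)"
      using norm_blinfun[of g x] norm_blinfun[of g "smul i x"] by simp
    finally show "norm (f x) \<le> norm x * (norm g + norm g)"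
      by (simp add: norm_scale ni algebra_simps)
  qed
  show ?thesis
  proof (intro bexI allI)
    show "Blinfun f \<in> dual smul"
    proof (rule in_dualI, unfold bounded_linear_Blinfun_apply[OF bl])
      fix d x
      obtain a b where d: "d = of_real a + i * of_real b" using c by blast
      have gd: "g (smul d x) = a * g x + b * g (smul i x)"
        unfolding d by (simp add: scale_left_distrib scale_of_real blinfun.add_right blinfun.scaleR_right
            mult.commute[of i] scale_scale[symmetric] del: scale_scale)
      have "smul i (smul d x) = a *\<^sub>R smul i x - b *\<^sub>R x"
      proof -
        have "i * d = of_real a * i - of_real b"
          using ii by (simp add: d algebra_simps flip: mult.assoc)
        then show ?thesis
          by (metis scale_left_diff_distrib scale_of_real scale_scale)
      qed
      then have gid: "g (smul i (smul d x)) = a * g (smul i x) - b * g x"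
        by (simp add: blinfun.diff_right blinfun.scaleR_right del: scale_scale)
      have product: "(A + i * B) * (G - i * H) = A * G + B * H - i * (A * H - B * G)" for A B G H
      proof -
        have "(A + i * B) * (G - i * H) = A * G - i * (A * H - B * G) - (i * i) * (B * H)"
          by (simp only: algebra_simps)
        then show ?thesis by (simp only: ii) simp
      qed
      show "f (smul d x) = d * f x"
        unfolding f_def gd gid of_real_add of_real_mult of_real_diff unfolding d
        by (rule product[symmetric])
    qed
  qed (simp add: bounded_linear_Blinfun_apply[OF bl] f_def scalar_re_def scalar_embedding_diff
      scalar_embedding_mult i scalar_embedding_of_real)
qed

definition dual_of_real :: "('a \<Rightarrow>\<^sub>L real) \<Rightarrow> ('a \<Rightarrow>\<^sub>L 'k)" where
  "dual_of_real g = (SOME f. f \<in> dual smul \<and> (\<forall>x. scalar_re (blinfun_apply f x) = blinfun_apply g x))"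

lemma dual_of_real: "dual_of_real g \<in> dual smul"
  and scalar_re_dual_of_real: "scalar_re (blinfun_apply (dual_of_real g) x) = blinfun_apply g x"
  using someI_ex[OF exists_dual_of_real[unfolded Bex_def], of g] unfolding dual_of_real_def by blast+

definition generator :: "'a \<Rightarrow> ('a \<Rightarrow>\<^sub>L 'k) set" where
  "generator x = dual_of_real ` real_generator x"

lemma countable_generator: "countable (generator x)"
  by (simp add: generator_def countable_real_generator)

lemma generator_subset_dual: "generator x \<subseteq> dual smul"
  by (auto simp: generator_def dual_of_real)

lemma subspace_imp_real_subspace: "module.subspace smul V \<Longrightarrow> Real_Vector_Spaces.subspace V"
  unfolding subspace_def real_vector.subspace_def by (metis scale_of_real)

lemma generator_dense:
  assumes asp: "asplund TYPE('a)" and V: "subspace V" and D: "D \<subseteq> V" "V \<subseteq> closure D"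
    and f: "f \<in> dual smul" and e: "0 < e"
  shows "\<exists>d\<in>D. \<exists>g\<in>generator d. \<forall>v\<in>V. norm (blinfun_apply f v - blinfun_apply g v) \<le> e * norm v"
proof -
  define r where "r = Blinfun (\<lambda>x. scalar_re (f x))"
  have r: "blinfun_apply r x = scalar_re (f x)" for x
    unfolding r_def
    by (simp add: bounded_linear_Blinfun_apply bounded_linear_compose[OF bounded_linear_scalar_re blinfun.bounded_linear_right])
  obtain d g where d: "d \<in> D" "g \<in> real_generator d" "\<forall>v\<in>V. \<bar>r v - g v\<bar> \<le> e * norm v"
    using real_generator_dense[OF asp subspace_imp_real_subspace[OF V] D e] by blast
  have "norm ((f - dual_of_real g) v) \<le> e * norm v" if "v \<in> V" for v
  proof (rule norm_le_of_scalar_re_le[OF _ _ _ that])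
    show "f - dual_of_real g \<in> dual smul" by (rule dual_diff[OF f dual_of_real])
    show "smul c v \<in> V" if "v \<in> V" for c v using V that by (rule subspace_scale)
    show "\<bar>scalar_re ((f - dual_of_real g) v)\<bar> \<le> e * norm v" if "v \<in> V" for v
      using d(3) that
      by (simp add: blinfun.diff_left r scalar_re_dual_of_real scalar_re_diff)
  qed
  then show ?thesis
    using d(1,2) by (auto simp: blinfun.diff_left generator_def)
qed

lemma dual_separation:
  assumes asp: "asplund TYPE('a)" and Z: "subspace Z" "closed Z" "x0 \<notin> Z"
  obtains f where "f \<in> dual smul" "\<And>z. z \<in> Z \<Longrightarrow> blinfun_apply f z = 0" "blinfun_apply f x0 \<noteq> 0"
proof -
  obtain g :: "'a \<Rightarrow>\<^sub>L real" where g: "\<And>z. z \<in> Z \<Longrightarrow> g z = 0" "g x0 \<noteq> 0"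
    using asplund_separation[OF asp subspace_imp_real_subspace[OF Z(1)] Z(2,3)] by blast
  have "norm (dual_of_real g z) \<le> 0 * norm z" if "z \<in> Z" for z
    by (rule norm_le_of_scalar_re_le[OF dual_of_real _ _ that])
      (use g subspace_scale[OF Z(1)] in \<open>auto simp: scalar_re_dual_of_real\<close>)
  moreover have "dual_of_real g x0 \<noteq> 0"
    using g(2) scalar_re_dual_of_real[of g x0] scalar_re_of_real[of 0] by (metis of_real_0)
  ultimately show ?thesis
    using that[OF dual_of_real[of g]] by simp
qed

text \<open>Completeness is not among the axioms of the scalar class. The limit is therefore taken
  among the real parts, whose values are in the complete type of reals, and then turned back into a
  functional in the dual.\<close>

lemma dual_Cauchy_converges:
  assumes f: "\<And>n. f n \<in> dual smul" and C: "Cauchy f"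
  obtains g where "g \<in> dual smul" "f \<longlonglongrightarrow> g"
proof -
  define r where "r n = Blinfun (\<lambda>x. scalar_re (f n x))" for n
  have r: "blinfun_apply (r n) x = scalar_re (f n x)" for x n
    unfolding r_def
    by (simp add: bounded_linear_Blinfun_apply bounded_linear_compose[OF bounded_linear_scalar_re blinfun.bounded_linear_right])
  have "norm (r m - r n) \<le> norm (f m - f n)" for m n
  proof (rule norm_blinfun_bound)
    fix x
    have "norm ((r m - r n) x) = \<bar>scalar_re ((f m - f n) x)\<bar>"
      by (simp add: blinfun.diff_left r scalar_re_diff)
    also have "\<dots> \<le> norm ((f m - f n) x)" by (rule scalar_re_le)
    also have "\<dots> \<le> norm (f m - f n) * norm x" by (rule norm_blinfun)
    finally show "norm ((r m - r n) x) \<le> norm (f m - f n) * norm x" .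
  qed simp
  then have "Cauchy r"
    using C unfolding Cauchy_def dist_norm by (meson le_less_trans)
  then obtain g where g: "r \<longlonglongrightarrow> g"
    by (auto simp: Cauchy_convergent_iff convergent_def)
  have le: "norm (f n - dual_of_real g) \<le> norm (r n - g)" for n
  proof (rule norm_blinfun_bound)
    fix x
    show "norm ((f n - dual_of_real g) x) \<le> norm (r n - g) * norm x"
    proof (rule norm_le_of_scalar_re_le[where V = UNIV])
      show "f n - dual_of_real g \<in> dual smul" by (rule dual_diff[OF f dual_of_real])
      show "\<bar>scalar_re ((f n - dual_of_real g) v)\<bar> \<le> norm (r n - g) * norm v" for v
        using norm_blinfun[of "r n - g" v]
        by (simp add: blinfun.diff_left r scalar_re_dual_of_real scalar_re_diff)
    qed auto
  qed simp
  have lim: "(\<lambda>n. norm (r n - g)) \<longlonglongrightarrow> 0"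
    using g by (simp add: LIM_zero tendsto_norm_zero)
  have "\<forall>\<^sub>F n in sequentially. norm (f n - dual_of_real g) \<le> norm (r n - g)"
    by (simp add: le)
  from Lim_null_comparison[OF this lim] have "(\<lambda>n. f n - dual_of_real g) \<longlonglongrightarrow> 0" .
  then have "f \<longlonglongrightarrow> dual_of_real g"
    by (rule LIM_zero_cancel)
  then show ?thesis using that dual_of_real by blast
qed

end

lemma separable_closure:
  assumes "countable D"
  shows "separable_space (top_of_set (closure D))"
  unfolding separable_space_def using assms closure_subset[of D]
  by (intro exI[of _ D]) (auto simp: closure_of_subtopology Int_absorb1)

section \<open>Closed spans and determining systems\<close>

text \<open>The scalar 1 is included so that generators lie in the rational span itself and not
  merely in its closure.\<close>

definition dense_scalars :: "'k::real_or_complex set" where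
  "dense_scalars = insert 1 (SOME Q. countable Q \<and> closure Q = UNIV)"

lemma dense_scalars:
  shows countable_dense_scalars: "countable (dense_scalars :: 'k::real_or_complex set)"
    and closure_dense_scalars: "closure (dense_scalars :: 'k::real_or_complex set) = UNIV"
    and one_in_dense_scalars: "(1 :: 'k::real_or_complex) \<in> dense_scalars"
proof -
  let ?Q = "SOME Q. countable Q \<and> closure Q = (UNIV :: 'k set)"
  have *: "countable ?Q \<and> closure ?Q = UNIV" by (rule someI_ex[OF exists_countable_dense_scalars])
  show "countable (dense_scalars :: 'k set)" "(1 :: 'k) \<in> dense_scalars"
    using * by (auto simp: dense_scalars_def)
  show "closure (dense_scalars :: 'k set) = UNIV"
    using * closure_mono[of ?Q "dense_scalars"] by (auto simp: dense_scalars_def)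
qed

text \<open>Interpreted both for the space and for its functionals, so that closed spans and
  determining systems are treated once for the two sides.\<close>

locale normed_space_over = vector_space scale
  for scale :: "'k::real_or_complex \<Rightarrow> 'z::real_normed_vector \<Rightarrow> 'z" (infixr "\<odot>" 75) +
  assumes norm_scale: "norm (c \<odot> x) = norm c * norm x"
begin

text \<open>Countable whenever \<open>C\<close> is, and closed under addition. The dense scalars
  need not be closed under multiplication, so only the closure of this set is a subspace in
  general.\<close>

definition rational_span :: "'z set \<Rightarrow> 'z set" where
  "rational_span C = (\<lambda>ps. \<Sum>(q, x)\<leftarrow>ps. q \<odot> x) ` lists (dense_scalars \<times> C)"

lemma countable_rational_span: "countable C \<Longrightarrow> countable (rational_span C)"
  unfolding rational_span_def
  by (intro countable_image countable_lists countable_SIGMA countable_dense_scalars)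

lemma rational_span_mono: "C \<subseteq> D \<Longrightarrow> rational_span C \<subseteq> rational_span D"
  unfolding rational_span_def by (intro image_mono lists_mono) auto

lemma subset_rational_span: "C \<subseteq> rational_span C"
proof
  fix x assume "x \<in> C"
  then have "[(1, x)] \<in> lists (dense_scalars \<times> C)" by (simp add: one_in_dense_scalars)
  then show "x \<in> rational_span C"
    unfolding rational_span_def by (rule rev_image_eqI) simp
qed

lemma rational_span_0: "0 \<in> rational_span C"
  unfolding rational_span_def by (rule rev_image_eqI[of "[]"]) auto

lemma rational_span_add:
  assumes "x \<in> rational_span C" "y \<in> rational_span C"
  shows "x + y \<in> rational_span C"
proof -
  obtain ps qs where "ps \<in> lists (dense_scalars \<times> C)" "qs \<in> lists (dense_scalars \<times> C)"
    "x = (\<Sum>(q, x)\<leftarrow>ps. q \<odot> x)" "y = (\<Sum>(q, x)\<leftarrow>qs. q \<odot> x)"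
    using assms unfolding rational_span_def by blast
  then show ?thesis
    unfolding rational_span_def by (intro rev_image_eqI[of "ps @ qs"]) auto
qed

lemma rational_span_subset_subspace:
  assumes "subspace W" "C \<subseteq> W"
  shows "rational_span C \<subseteq> W"
proof -
  have "(\<Sum>(q, x)\<leftarrow>ps. q \<odot> x) \<in> W" if "ps \<in> lists (dense_scalars \<times> C)" for ps
    using that
    by (induction ps) (use assms in \<open>auto intro: subspace_0 subspace_add subspace_scale\<close>)
  then show ?thesis unfolding rational_span_def by blast
qed

lemma rational_span_finite_support:
  assumes "x \<in> rational_span C"
  obtains F where "finite F" "F \<subseteq> C" "x \<in> rational_span F"
proof -
  obtain ps where ps: "ps \<in> lists (dense_scalars \<times> C)" "x = (\<Sum>(q, x)\<leftarrow>ps. q \<odot> x)"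
    using assms unfolding rational_span_def by blast
  have "set ps \<subseteq> dense_scalars \<times> C" using ps(1) by (auto simp: lists_eq_set)
  then have "set ps \<subseteq> dense_scalars \<times> snd ` set ps" by force
  then have "ps \<in> lists (dense_scalars \<times> snd ` set ps)" by (simp add: lists_eq_set)
  then have "x \<in> rational_span (snd ` set ps)"
    unfolding rational_span_def ps(2) by blast
  moreover have "snd ` set ps \<subseteq> C" using ps(1) by (auto simp: lists_eq_set)
  ultimately show ?thesis using that[of "snd ` set ps"] by simp
qed

lemma closure_rational_span_countable_support:
  assumes "x \<in> closure (rational_span C)"
  shows "\<exists>F. countable F \<and> F \<subseteq> C \<and> x \<in> closure (rational_span F)"
proof -
  obtain u where u: "\<And>n. u n \<in> rational_span C" "u \<longlonglongrightarrow> x"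
    using assms by (auto simp: closure_sequential)
  have "\<exists>F. finite F \<and> F \<subseteq> C \<and> u n \<in> rational_span F" for n
    using rational_span_finite_support[OF u(1)] by metis
  then obtain F where F: "\<And>n. finite (F n)" "\<And>n. F n \<subseteq> C" "\<And>n. u n \<in> rational_span (F n)"
    by metis
  have "u n \<in> rational_span (\<Union>n. F n)" for n
    using F(3)[of n] rational_span_mono[of "F n" "\<Union>n. F n"] by blast
  then have "x \<in> closure (rational_span (\<Union>n. F n))"
    using u(2) by (auto simp: closure_sequential)
  then show ?thesis
    using F by (intro exI[of _ "\<Union>n. F n"]) (auto intro: countable_finite)
qed

lemma rational_span_UN_incseq:
  assumes "incseq C"
  shows "rational_span (\<Union>n. C n) = (\<Union>n. rational_span (C n))"
proof
  show "(\<Union>n. rational_span (C n)) \<subseteq> rational_span (\<Union>n. C n)"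
    by (intro UN_least rational_span_mono) auto
  show "rational_span (\<Union>n. C n) \<subseteq> (\<Union>n. rational_span (C n))"
  proof
    fix x assume "x \<in> rational_span (\<Union>n. C n)"
    then obtain F where F: "finite F" "F \<subseteq> (\<Union>n. C n)" "x \<in> rational_span F"
      by (rule rational_span_finite_support)
    have "subset.chain UNIV (range C)"
      using assms by (auto simp: subset_chain_def) (metis incseqD linear subsetD)
    then obtain n where "F \<subseteq> C n"
      using finite_subset_Union_chain[OF F(1,2)] by blast
    then show "x \<in> (\<Union>n. rational_span (C n))"
      using F(3) rational_span_mono by blast
  qed
qed

lemma closure_add:
  assumes add: "\<And>x y. x \<in> S \<Longrightarrow> y \<in> S \<Longrightarrow> x + y \<in> S" and "x \<in> closure S" "y \<in> closure S"
  shows "x + y \<in> closure (S :: 'z set)"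
proof -
  obtain u v where "\<And>n. u n \<in> S" "u \<longlonglongrightarrow> x" "\<And>n. v n \<in> S" "v \<longlonglongrightarrow> y"
    using assms(2,3) by (auto simp: closure_sequential)
  then show ?thesis
    using add unfolding closure_sequential by (intro exI[of _ "\<lambda>n. u n + v n"]) (auto intro: tendsto_add)
qed

lemma tendsto_scale_right:
  assumes "u \<longlonglongrightarrow> x"
  shows "(\<lambda>n. c \<odot> u n) \<longlonglongrightarrow> c \<odot> x"
proof -
  have "(\<lambda>n. norm c * norm (u n - x)) \<longlonglongrightarrow> 0"
    using assms by (intro tendsto_mult_right_zero tendsto_norm_zero LIM_zero)
  moreover have "norm (c \<odot> u n - c \<odot> x) = norm c * norm (u n - x)" for n
    by (metis norm_scale scale_right_diff_distrib)
  ultimately show ?thesis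
    by (simp add: tendsto_iff dist_norm)
qed

lemma tendsto_scale_left:
  assumes "u \<longlonglongrightarrow> c"
  shows "(\<lambda>n. u n \<odot> x) \<longlonglongrightarrow> c \<odot> x"
proof -
  have "(\<lambda>n. norm (u n - c) * norm x) \<longlonglongrightarrow> 0"
    using assms by (intro tendsto_mult_left_zero tendsto_norm_zero LIM_zero)
  moreover have "norm (u n \<odot> x - c \<odot> x) = norm (u n - c) * norm x" for n
    by (metis norm_scale scale_left_diff_distrib)
  ultimately show ?thesis
    by (simp add: tendsto_iff dist_norm)
qed

lemma subspace_closure_rational_span: "subspace (closure (rational_span C))"
proof -
  have add: "x + y \<in> closure (rational_span C)"
    if "x \<in> closure (rational_span C)" "y \<in> closure (rational_span C)" for x y
    by (rule closure_add[OF rational_span_add that])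
  have "c \<odot> (\<Sum>(q, x)\<leftarrow>ps. q \<odot> x) \<in> closure (rational_span C)"
    if "ps \<in> lists (dense_scalars \<times> C)" for c ps
    using that
  proof (induction ps)
    case Nil
    show ?case using rational_span_0 closure_subset by (force simp: image_iff)
  next
    case (Cons p ps)
    obtain q x where p: "p = (q, x)" "x \<in> C" using Cons by (cases p) auto
    \<comment> \<open>The coefficient \<open>c * q\<close> may fall outside the dense scalars and
      has to be approximated by them.\<close>
    have "c * q \<in> closure dense_scalars" by (simp add: closure_dense_scalars)
    then obtain r where r: "\<And>n. r n \<in> dense_scalars" "r \<longlonglongrightarrow> c * q"
      by (auto simp: closure_sequential)
    have "r n \<odot> x \<in> rational_span C" for n
      unfolding rational_span_def using r(1)[of n] p(2) by (intro rev_image_eqI[of "[(r n, x)]"]) auto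
    then have "(c * q) \<odot> x \<in> closure (rational_span C)"
      unfolding closure_sequential
      using tendsto_scale_left[OF r(2), of x] by (intro exI[of _ "\<lambda>n. r n \<odot> x"]) blast
    from add[OF this Cons.IH] show ?case
      by (simp add: p scale_right_distrib)
  qed
  then have sc: "c \<odot> x \<in> closure (rational_span C)" if "x \<in> rational_span C" for c x
    using that unfolding rational_span_def by blast
  show ?thesis
    unfolding subspace_def
  proof (intro conjI ballI allI add)
    show "0 \<in> closure (rational_span C)" using rational_span_0 closure_subset by blast
    show "c \<odot> x \<in> closure (rational_span C)" if "x \<in> closure (rational_span C)" for c x
    proof -
      obtain u where u: "\<And>n. u n \<in> rational_span C" "u \<longlonglongrightarrow> x"
        using \<open>x \<in> closure (rational_span C)\<close> by (auto simp: closure_sequential)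
      show ?thesis
        by (rule Lim_in_closed_set[OF closed_closure _ _ tendsto_scale_right[OF u(2), of c]])
          (simp_all add: sc u(1))
    qed
  qed
qed

lemma closure_rational_span_least:
  assumes "subspace W" "closed W" "C \<subseteq> W"
  shows "closure (rational_span C) \<subseteq> W"
  by (rule closure_minimal[OF rational_span_subset_subspace[OF assms(1,3)] assms(2)])

lemma closure_rational_span_subset:
  assumes "C \<subseteq> closure (rational_span D)"
  shows "closure (rational_span C) \<subseteq> closure (rational_span D)"
  by (rule closure_rational_span_least[OF subspace_closure_rational_span _ assms]) simp

lemma subset_closure_rational_span: "C \<subseteq> closure (rational_span C)"
  using subset_rational_span closure_subset by blast

text \<open>By the last clause a \<theta>-closed set \<open>C\<close> is recovered from its closed
  span as the intersection with \<open>I\<close>. The argument \<open>u\<close> runs over the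
  rational span, not its closure, so that a countable set can be completed to a countable
  \<theta>-closed one.\<close>

definition determining_system :: "'z set \<Rightarrow> 'z set \<Rightarrow> ('z \<Rightarrow> 'z \<Rightarrow> 'z set) \<Rightarrow> bool" where
  "determining_system Z I \<theta> \<longleftrightarrow> I \<subseteq> Z \<and> Z \<subseteq> closure (rational_span I) \<and>
    (\<forall>\<alpha> u. countable (\<theta> \<alpha> u) \<and> \<theta> \<alpha> u \<subseteq> I) \<and>
    (\<forall>C \<subseteq> I. (\<forall>\<alpha>\<in>C. \<forall>u\<in>rational_span C. \<theta> \<alpha> u \<subseteq> C) \<longrightarrow> closure (rational_span C) \<inter> I \<subseteq> C)"

lemma determining_systemD:
  assumes "determining_system Z I \<theta>"
  shows "I \<subseteq> Z" "Z \<subseteq> closure (rational_span I)" "countable (\<theta> \<alpha> u)" "\<theta> \<alpha> u \<subseteq> I"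
    and "C \<subseteq> I \<Longrightarrow> (\<And>\<alpha> u. \<alpha> \<in> C \<Longrightarrow> u \<in> rational_span C \<Longrightarrow> \<theta> \<alpha> u \<subseteq> C) \<Longrightarrow>
      closure (rational_span C) \<inter> I \<subseteq> C"
  using assms unfolding determining_system_def by simp_all

text \<open>
  A well-ordered system \<open>I\<close> in which no vector lies in the closed span of its predecessors.
  If \<open>x\<close> lies in the closed span of \<open>C\<close> and \<open>\<alpha>\<close> is the first element of \<open>C\<close> after \<open>x\<close>, then
  \<open>\<theta>\<close>-closedness moves approximations of \<open>x\<close> into the span of \<open>{z \<in> C. z < \<alpha>}\<close>, all of whose
  elements precede \<open>x\<close> unless \<open>x \<in> C\<close>.
\<close>

lemma exists_determining_system: "\<exists>I \<theta>. determining_system Z I \<theta>"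
proof -
  obtain r :: "'z rel" where r: "Well_order r" "Field r = UNIV"
    using well_ordering[where 'a = 'z] by (elim exE conjE) (rule that)
  define less where "less x y \<longleftrightarrow> (x, y) \<in> r \<and> x \<noteq> y" for x y
  have wf: "wf {(x, y). less x y}"
  proof -
    have "{(x, y). less x y} = r - Id" by (auto simp: less_def)
    then show ?thesis using r by (simp add: well_order_on_def)
  qed
  have linear: "less x y \<or> x = y \<or> less y x" for x y
    using r unfolding less_def well_order_on_def linear_order_on_def total_on_def by auto
  have trans: "less x y \<Longrightarrow> less y z \<Longrightarrow> less x z" for x y z
    using r unfolding less_def well_order_on_def linear_order_on_def partial_order_on_def
      preorder_on_def trans_def antisym_def by blast
  have irrefl: "\<not> less x x" for x by (simp add: less_def)
  define I where "I = {x \<in> Z. x \<notin> closure (rational_span {z \<in> Z. less z x})}"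
  have IZ: "I \<subseteq> Z" by (auto simp: I_def)
  have span: "x \<in> Z \<longrightarrow> x \<in> closure (rational_span I)" for x
    using wf
  proof (induction x rule: wf_induct_rule)
    case (less x)
    show ?case
    proof (intro impI)
      assume x: "x \<in> Z"
      show "x \<in> closure (rational_span I)"
      proof (cases "x \<in> I")
        case True
        then show ?thesis using subset_closure_rational_span by blast
      next
        case False
        have "{z \<in> Z. less z x} \<subseteq> closure (rational_span I)" using less by auto
        then have "closure (rational_span {z \<in> Z. less z x}) \<subseteq> closure (rational_span I)"
          by (rule closure_rational_span_subset)
        then show ?thesis using False x by (auto simp: I_def)
      qed
    qed
  qed
  define J where "J \<alpha> = {z \<in> I. less z \<alpha>}" for \<alpha>
  \<comment> \<open>\<open>S\<close> collects the supports of a minimising sequence for the distance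
    from \<open>u\<close> to the span of the predecessors of \<alpha>.\<close>
  have "\<exists>S. countable S \<and> S \<subseteq> J \<alpha> \<and>
      (\<forall>w \<in> rational_span (J \<alpha>). \<forall>e>0. \<exists>v \<in> rational_span S. dist u v < dist u w + e)" for \<alpha> u
  proof -
    have ne: "rational_span (J \<alpha>) \<noteq> {}" using rational_span_0 by blast
    let ?m = "infdist u (rational_span (J \<alpha>))"
    have "\<exists>w \<in> rational_span (J \<alpha>). dist u w < ?m + 1 / real (Suc n)" for n
      using cINF_less_iff[OF ne bdd_below_image_dist, of u "?m + 1 / real (Suc n)"]
      by (simp add: infdist_notempty[OF ne])
    then obtain w where w: "\<And>n. w n \<in> rational_span (J \<alpha>)" "\<And>n. dist u (w n) < ?m + 1 / real (Suc n)"
      by metis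
    have "\<exists>F. finite F \<and> F \<subseteq> J \<alpha> \<and> w n \<in> rational_span F" for n
      using rational_span_finite_support[OF w(1)] by metis
    then obtain F where F: "\<And>n. finite (F n)" "\<And>n. F n \<subseteq> J \<alpha>" "\<And>n. w n \<in> rational_span (F n)"
      by metis
    have "\<exists>v \<in> rational_span (\<Union>n. F n). dist u v < dist u w' + e"
      if w': "w' \<in> rational_span (J \<alpha>)" and e: "e > 0" for w' e
    proof -
      obtain n where n: "1 / real (Suc n) < e" using e by (rule nat_approx_posE)
      have "dist u (w n) < dist u w' + e"
        using w(2)[of n] n infdist_le[OF w', of u] by linarith
      moreover have "w n \<in> rational_span (\<Union>n. F n)"
        using F(3)[of n] rational_span_mono[of "F n" "\<Union>n. F n"] by blast
      ultimately show ?thesis by blast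
    qed
    moreover have "countable (\<Union>n. F n)"
      using F(1) by (intro countable_UN countableI_type countable_finite)
    moreover have "(\<Union>n. F n) \<subseteq> J \<alpha>"
      using F(2) by blast
    ultimately show ?thesis by blast
  qed
  then obtain \<theta> where \<theta>: "\<And>\<alpha> u. countable (\<theta> \<alpha> u)" "\<And>\<alpha> u. \<theta> \<alpha> u \<subseteq> J \<alpha>"
    "\<And>\<alpha> u w e. w \<in> rational_span (J \<alpha>) \<Longrightarrow> e > 0 \<Longrightarrow>
       \<exists>v \<in> rational_span (\<theta> \<alpha> u). dist u v < dist u w + e"
    by metis
  have "x \<in> C"
    if C: "C \<subseteq> I" "\<forall>\<alpha>\<in>C. \<forall>u\<in>rational_span C. \<theta> \<alpha> u \<subseteq> C"
      and x: "x \<in> closure (rational_span C)" "x \<in> I" for C x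
  proof (rule ccontr)
    assume xC: "x \<notin> C"
    have "x \<in> closure (rational_span {z \<in> C. less z x})"
    proof (cases "\<exists>c\<in>C. less x c")
      case False
      then have "{z \<in> C. less z x} = C" using linear xC by blast
      then show ?thesis using x by simp
    next
      case True
      have "{c \<in> C. less x c} \<noteq> {}" using True by blast
      then obtain \<alpha> where "\<alpha> \<in> {c \<in> C. less x c}"
        "\<forall>c. (c, \<alpha>) \<in> {(x, y). less x y} \<longrightarrow> c \<notin> {c \<in> C. less x c}"
        using wf unfolding wf_eq_minimal by (metis all_not_in_conv)
      then have \<alpha>: "\<alpha> \<in> C" "less x \<alpha>" "\<And>c. less c \<alpha> \<Longrightarrow> \<not> (c \<in> C \<and> less x c)"
        by auto
      have sub: "C \<inter> J \<alpha> \<subseteq> {z \<in> C. less z x}"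
        using \<alpha>(3) linear xC by (auto simp: J_def)
      have xJ: "x \<in> rational_span (J \<alpha>)"
        using x(2) \<alpha>(2) subset_rational_span[of "J \<alpha>"] by (auto simp: J_def)
      show ?thesis
        unfolding closure_approachable
      proof (intro allI impI)
        fix e :: real assume e: "0 < e"
        \<comment> \<open>Since \<open>x\<close> itself precedes \<alpha>, the approximant
          \<open>v\<close> is nearly as close to \<open>u\<close> as \<open>x\<close> is. The three
          parts are the distance from \<open>u\<close> to \<open>x\<close>, the same distance again
          in the bound for \<open>v\<close>, and the slack.\<close>
        then have "e/3 > 0" by simp
        then obtain u where u: "u \<in> rational_span C" "dist u x < e/3"
          using x(1) unfolding closure_approachable by blast
        obtain v where v: "v \<in> rational_span (\<theta> \<alpha> u)" "dist u v < dist u x + e/3"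
          using \<theta>(3)[OF xJ \<open>e/3 > 0\<close>] by blast
        have "\<theta> \<alpha> u \<subseteq> {z \<in> C. less z x}"
          using C(2) \<alpha>(1) u(1) \<theta>(2)[of \<alpha> u] sub by blast
        then have "v \<in> rational_span {z \<in> C. less z x}"
          using v(1) rational_span_mono by blast
        moreover have "dist v x < e"
          using u(2) v(2) dist_triangle[of v x u] by (simp add: dist_commute)
        ultimately show "\<exists>y\<in>rational_span {z \<in> C. less z x}. dist y x < e" by blast
      qed
    qed
    moreover have "closure (rational_span {z \<in> C. less z x}) \<subseteq> closure (rational_span {z \<in> Z. less z x})"
      using C(1) IZ by (intro closure_mono rational_span_mono) auto
    ultimately show False
      using x(2) unfolding I_def by blast
  qed
  then have "closure (rational_span C) \<inter> I \<subseteq> C"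
    if "C \<subseteq> I" "\<forall>\<alpha>\<in>C. \<forall>u\<in>rational_span C. \<theta> \<alpha> u \<subseteq> C" for C
    using that by (intro subsetI) (elim IntE)
  moreover have "Z \<subseteq> closure (rational_span I)" using span by blast
  moreover have "\<theta> \<alpha> u \<subseteq> I" for \<alpha> u
    using \<theta>(2)[of \<alpha> u] unfolding J_def by blast
  ultimately have "determining_system Z I \<theta>"
    unfolding determining_system_def using IZ \<theta>(1) by simp
  then show ?thesis by blast
qed

text \<open>Applied with \<open>R\<close> the rational span on one side and \<open>N\<close> mapping
  to subsets of the other side. Each approximation uses finitely many elements, each of which comes
  from a finite part of \<open>A\<close>.\<close>

lemma rational_span_UN_countable_origin:
  assumes x: "x \<in> closure (rational_span (\<Union>y\<in>R A. N y))"
    and support: "\<And>y. y \<in> R A \<Longrightarrow> \<exists>F. finite F \<and> F \<subseteq> A \<and> y \<in> R F"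
    and mono: "\<And>A B. A \<subseteq> B \<Longrightarrow> R A \<subseteq> R B"
  shows "\<exists>S. countable S \<and> S \<subseteq> A \<and> x \<in> closure (rational_span (\<Union>y\<in>R S. N y))"
proof -
  obtain F where F: "countable F" "F \<subseteq> (\<Union>y\<in>R A. N y)" "x \<in> closure (rational_span F)"
    using closure_rational_span_countable_support[OF x] by blast
  have "\<exists>E. finite E \<and> E \<subseteq> A \<and> z \<in> (\<Union>y\<in>R E. N y)" if z: "z \<in> F" for z
  proof -
    obtain y where y: "y \<in> R A" "z \<in> N y" using F(2) z by blast
    show ?thesis using support[OF y(1)] y(2) by blast
  qed
  then obtain E where E: "\<And>z. z \<in> F \<Longrightarrow> finite (E z) \<and> E z \<subseteq> A \<and> z \<in> (\<Union>y\<in>R (E z). N y)"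
    by metis
  let ?S = "\<Union>z\<in>F. E z"
  have "countable ?S" "?S \<subseteq> A"
    using F(1) E by (auto intro: countable_finite)
  moreover have "F \<subseteq> (\<Union>y\<in>R ?S. N y)"
  proof
    fix z assume z: "z \<in> F"
    then have "R (E z) \<subseteq> R ?S" by (intro mono) auto
    then show "z \<in> (\<Union>y\<in>R ?S. N y)" using E[OF z] by blast
  qed
  then have "x \<in> closure (rational_span (\<Union>y\<in>R ?S. N y))"
    using F(3) closure_mono[OF rational_span_mono] by blast
  ultimately show ?thesis by blast
qed

lemma sep_subspaces_closure_rational_span:
  assumes "countable C" "closure (rational_span C) \<subseteq> Z"
  shows "closure (rational_span C) \<in> sep_subspaces scale Z"
  using assms subspace_closure_rational_span
  by (simp add: sep_subspaces_def separable_closure countable_rational_span)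

end

section \<open>The dual as a normed space, and countable norming sets\<close>

context banach_space_over
begin

lemma norm_dual_scale:
  fixes c :: 'k and f :: "'a \<Rightarrow>\<^sub>L 'k"
  shows "norm (dual_scale c f) = norm c * norm f"
proof (rule antisym)
  have le: "norm (dual_scale c f) \<le> norm c * norm f" for c :: 'k and f :: "'a \<Rightarrow>\<^sub>L 'k"
  proof (rule norm_blinfun_bound)
    show "norm (dual_scale c f x) \<le> norm c * norm f * norm x" for x
      using mult_left_mono[OF norm_blinfun[of f x] norm_ge_zero[of c]]
      by (simp add: dual_scale_apply norm_mult mult.assoc)
  qed simp
  show "norm (dual_scale c f) \<le> norm c * norm f" by (rule le)
  show "norm c * norm f \<le> norm (dual_scale c f)"
  proof (cases "c = 0")
    case False
    have "dual_scale (inverse c) (dual_scale c f) = f"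
      using False by (intro blinfun_eqI) (simp add: dual_scale_apply)
    then have "norm f \<le> norm (inverse c) * norm (dual_scale c f)"
      using le[of "inverse c" "dual_scale c f"] by simp
    then show ?thesis
      using False by (simp add: norm_divide field_simps)
  qed simp
qed

sublocale primal: normed_space_over smul
  by unfold_locales (rule norm_scale)

sublocale dual: normed_space_over "dual_scale :: 'k \<Rightarrow> ('a \<Rightarrow>\<^sub>L 'k) \<Rightarrow> _"
  by unfold_locales
    (auto intro!: blinfun_eqI simp: dual_scale_apply blinfun.bilinear_simps algebra_simps norm_dual_scale)

lemma subspace_dual: "dual.subspace (dual smul)"
  unfolding dual.subspace_def
  by (auto intro!: in_dualI simp: blinfun.bilinear_simps dual_smul dual_scale_apply algebra_simps)

lemma closed_dual: "closed (dual smul)"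
proof -
  have "f \<in> dual smul \<longleftrightarrow> (\<forall>c x. blinfun_apply f (smul c x) = c * blinfun_apply f x)" for f
    by (metis in_dualI dual_smul)
  then have "dual smul = (\<Inter>c. \<Inter>x. {f. blinfun_apply f (smul c x) = c * blinfun_apply f x})"
    by auto
  moreover have "closed {f. blinfun_apply f (smul c x) = c * blinfun_apply f x}" for c x
    by (intro closed_Collect_eq continuous_intros)
  ultimately show ?thesis by (metis (no_types, lifting) closed_INT)
qed

lemma exists_almost_norming:
  fixes f :: "'a \<Rightarrow>\<^sub>L 'k"
  assumes e: "0 < e"
  shows "\<exists>v. norm v \<le> 1 \<and> norm f - e < norm (blinfun_apply f v)"
proof (rule ccontr)
  assume "\<not> ?thesis"
  then have le: "norm (f v) \<le> norm f - e" if "norm v \<le> 1" for v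
    using that by force
  have "norm f \<le> norm f - e"
  proof (rule norm_blinfun_bound)
    show "0 \<le> norm f - e" using le[of 0] by simp
    fix v
    show "norm (f v) \<le> (norm f - e) * norm v"
    proof (cases "v = 0")
      case False
      have "norm (f ((1 / norm v) *\<^sub>R v)) \<le> norm f - e"
        by (rule le) simp
      then show ?thesis
        using False by (simp add: blinfun.scaleR_right field_simps)
    qed simp
  qed
  then show False using e by simp
qed

definition norming :: "('a \<Rightarrow>\<^sub>L 'k) \<Rightarrow> 'a set" where
  "norming f = range (\<lambda>n. SOME v. norm v \<le> 1 \<and> norm f - 1 / Suc n < norm (blinfun_apply f v))"

lemma countable_norming: "countable (norming f)"
  by (simp add: norming_def)

lemma norming:
  assumes e: "0 < e"
  obtains v where "v \<in> norming f" "norm v \<le> 1" "norm f - e < norm (blinfun_apply f v)"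
proof -
  obtain n where n: "1 / Suc n < e" using e by (rule nat_approx_posE)
  define v where "v = (SOME v. norm v \<le> 1 \<and> norm f - 1 / Suc n < norm (blinfun_apply f v))"
  have "norm v \<le> 1 \<and> norm f - 1 / Suc n < norm (blinfun_apply f v)"
    unfolding v_def by (rule someI_ex[OF exists_almost_norming]) simp
  moreover have "v \<in> norming f" unfolding norming_def v_def by blast
  ultimately show ?thesis using that n by fastforce
qed

text \<open>If \<open>x\<close> were outside, a nonzero functional \<open>f\<close> would vanish on
  the span. A functional \<open>g\<close> in \<open>S\<close> close to \<open>f\<close> then has
  small values at its own norming vectors, although its norm is close to that of
  \<open>f\<close>.\<close>

lemma closure_span_norming:
  assumes asp: "asplund TYPE('a)" and S: "dual smul \<subseteq> closure S"
  shows "x \<in> closure (primal.rational_span (\<Union>f\<in>S. norming f))"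
proof (rule ccontr)
  let ?Z = "closure (primal.rational_span (\<Union>f\<in>S. norming f))"
  assume "x \<notin> ?Z"
  then obtain f where f: "f \<in> dual smul" "\<And>z. z \<in> ?Z \<Longrightarrow> f z = 0" "f x \<noteq> 0"
    using dual_separation[OF asp primal.subspace_closure_rational_span closed_closure] by blast
  have pos: "norm f / 4 > 0" using f(3) by auto
  obtain g where g: "g \<in> S" "dist g f < norm f / 4"
    using S f(1) pos by (meson closure_approachable subsetD)
  obtain v where v: "v \<in> norming g" "norm v \<le> 1" "norm g - norm f / 4 < norm (g v)"
    using norming[OF pos] by blast
  have "f v = 0"
  proof (rule f(2))
    show "v \<in> ?Z"
      using v(1) g(1) primal.subset_closure_rational_span[of "\<Union>f\<in>S. norming f"] by blast
  qed
  then have "norm (g v) = norm ((g - f) v)" by (simp add: blinfun.diff_left)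
  also have "\<dots> \<le> norm (g - f) * norm v" by (rule norm_blinfun)
  also have "\<dots> \<le> norm (g - f) * 1" by (intro mult_left_mono v) auto
  finally have "norm (g v) < norm f / 4" using g(2) by (simp add: dist_norm)
  moreover have "norm f - norm g < norm f / 4"
    using g(2) norm_triangle_ineq2[of f g] by (simp add: dist_norm norm_minus_commute)
  ultimately show False using v(3) pos by linarith
qed

lemma closure_generator:
  assumes asp: "asplund TYPE('a)" and S: "closure S = UNIV"
  shows "dual smul \<subseteq> closure (\<Union>x\<in>S. generator x)"
proof
  fix f assume f: "f \<in> dual smul"
  show "f \<in> closure (\<Union>x\<in>S. generator x)"
    unfolding closure_approachable
  proof (intro allI impI)
    fix e :: real assume e: "0 < e"
    then have e2: "0 < e / 2" by simp
    obtain d g where g: "d \<in> S" "g \<in> generator d" "\<And>v. norm (f v - g v) \<le> e / 2 * norm v"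
      using generator_dense[OF asp subspace_UNIV _ _ f e2, of S] S by auto
    have "norm (f - g) \<le> e / 2"
      by (rule norm_blinfun_bound) (use e g(3) in \<open>auto simp: blinfun.diff_left\<close>)
    then have "dist g f < e"
      using e by (simp add: dist_norm norm_minus_commute)
    then show "\<exists>g\<in>\<Union>x\<in>S. generator x. dist g f < e" using g by blast
  qed
qed

end

section \<open>Countable generating sets\<close>

locale asplund_systems = banach_space_over smul
  for smul :: "'k::real_or_complex \<Rightarrow> 'a::banach \<Rightarrow> 'a" +
  fixes I :: "'a set" and \<theta> :: "'a \<Rightarrow> 'a \<Rightarrow> 'a set"
    and J :: "('a \<Rightarrow>\<^sub>L 'k) set" and \<eta> :: "('a \<Rightarrow>\<^sub>L 'k) \<Rightarrow> ('a \<Rightarrow>\<^sub>L 'k) \<Rightarrow> ('a \<Rightarrow>\<^sub>L 'k) set"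
  assumes asplund: "asplund TYPE('a)"
    and I: "primal.determining_system UNIV I \<theta>"
    and J: "dual.determining_system (dual smul) J \<eta>"
begin

definition support :: "'a \<Rightarrow> 'a set" where
  "support x = (SOME F. countable F \<and> F \<subseteq> I \<and> x \<in> closure (primal.rational_span F))"

text \<open>The type also contains functionals that are only real-linear. For these just a countable
  subset of \<open>J\<close> is promised, so that countability and inclusion in \<open>J\<close>
  hold for all arguments.\<close>

definition dual_support :: "('a \<Rightarrow>\<^sub>L 'k) \<Rightarrow> ('a \<Rightarrow>\<^sub>L 'k) set" where
  "dual_support f = (SOME F. countable F \<and> F \<subseteq> J \<and>
     (f \<in> dual smul \<longrightarrow> f \<in> closure (dual.rational_span F)))"

text \<open>Countably many functionals whose norming vectors generate \<open>x\<close>. They tie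
  \<open>x\<close> to \<open>J\<close>, and so make the first side expressible through the second;
  \<open>dual_origin\<close> does the converse.\<close>

definition origin :: "'a \<Rightarrow> ('a \<Rightarrow>\<^sub>L 'k) set" where
  "origin x = (SOME S. countable S \<and> S \<subseteq> J \<and>
     x \<in> closure (primal.rational_span (\<Union>f\<in>dual.rational_span S. norming f)))"

definition dual_origin :: "('a \<Rightarrow>\<^sub>L 'k) \<Rightarrow> 'a set" where
  "dual_origin f = (SOME S. countable S \<and> S \<subseteq> I \<and> (f \<in> dual smul \<longrightarrow>
     f \<in> closure (dual.rational_span (\<Union>x\<in>primal.rational_span S. generator x))))"

lemma support: "countable (support x)" "support x \<subseteq> I" "x \<in> closure (primal.rational_span (support x))"
proof -
  have "x \<in> closure (primal.rational_span I)"
    using primal.determining_systemD(2)[OF I] by blast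
  from someI_ex[OF primal.closure_rational_span_countable_support[OF this], folded support_def]
  show "countable (support x)" "support x \<subseteq> I" "x \<in> closure (primal.rational_span (support x))"
    by blast+
qed

lemma dual_support: "countable (dual_support f)" "dual_support f \<subseteq> J"
  "f \<in> dual smul \<Longrightarrow> f \<in> closure (dual.rational_span (dual_support f))"
proof -
  have "\<exists>F. countable F \<and> F \<subseteq> J \<and> (f \<in> dual smul \<longrightarrow> f \<in> closure (dual.rational_span F))"
  proof (cases "f \<in> dual smul")
    case True
    then have "f \<in> closure (dual.rational_span J)"
      using dual.determining_systemD(2)[OF J] by blast
    then show ?thesis
      using dual.closure_rational_span_countable_support by blast
  qed blast
  from someI_ex[OF this, folded dual_support_def]
  show "countable (dual_support f)" "dual_support f \<subseteq> J"
    "f \<in> dual smul \<Longrightarrow> f \<in> closure (dual.rational_span (dual_support f))"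
    by blast+
qed

lemma origin: "countable (origin x)" "origin x \<subseteq> J"
  "x \<in> closure (primal.rational_span (\<Union>f\<in>dual.rational_span (origin x). norming f))"
proof -
  have "dual smul \<subseteq> closure (dual.rational_span J)"
    by (rule dual.determining_systemD(2)[OF J])
  then have "x \<in> closure (primal.rational_span (\<Union>f\<in>dual.rational_span J. norming f))"
    by (rule closure_span_norming[OF asplund])
  from primal.rational_span_UN_countable_origin[where R = dual.rational_span, OF this]
  have "\<exists>S. countable S \<and> S \<subseteq> J \<and>
     x \<in> closure (primal.rational_span (\<Union>f\<in>dual.rational_span S. norming f))"
    by (metis dual.rational_span_finite_support dual.rational_span_mono)
  from someI_ex[OF this, folded origin_def]
  show "countable (origin x)" "origin x \<subseteq> J"
    "x \<in> closure (primal.rational_span (\<Union>f\<in>dual.rational_span (origin x). norming f))"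
    by blast+
qed

lemma dual_origin: "countable (dual_origin f)" "dual_origin f \<subseteq> I"
  "f \<in> dual smul \<Longrightarrow> f \<in> closure (dual.rational_span (\<Union>x\<in>primal.rational_span (dual_origin f). generator x))"
proof -
  have "\<exists>S. countable S \<and> S \<subseteq> I \<and> (f \<in> dual smul \<longrightarrow>
     f \<in> closure (dual.rational_span (\<Union>x\<in>primal.rational_span S. generator x)))"
  proof (cases "f \<in> dual smul")
    case True
    have "closure (primal.rational_span I) = UNIV"
      using primal.determining_systemD(2)[OF I] by blast
    then have "dual smul \<subseteq> closure (\<Union>x\<in>primal.rational_span I. generator x)"
      by (rule closure_generator[OF asplund])
    also have "\<dots> \<subseteq> closure (dual.rational_span (\<Union>x\<in>primal.rational_span I. generator x))"
      by (intro closure_mono dual.subset_rational_span)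
    finally have "f \<in> closure (dual.rational_span (\<Union>x\<in>primal.rational_span I. generator x))"
      using True by blast
    from dual.rational_span_UN_countable_origin[where R = primal.rational_span, OF this]
    have "\<exists>S. countable S \<and> S \<subseteq> I \<and>
       f \<in> closure (dual.rational_span (\<Union>x\<in>primal.rational_span S. generator x))"
      by (metis primal.rational_span_finite_support primal.rational_span_mono)
    then show ?thesis by blast
  qed blast
  from someI_ex[OF this, folded dual_origin_def]
  show "countable (dual_origin f)" "dual_origin f \<subseteq> I"
    "f \<in> dual smul \<Longrightarrow> f \<in> closure (dual.rational_span (\<Union>x\<in>primal.rational_span (dual_origin f). generator x))"
    by blast+
qed

text \<open>
  A set \<open>N\<close> encodes a pair of subsets of \<open>I\<close> and \<open>J\<close>. The three parts required on each side make
  the span determine its half of \<open>N\<close>, make each span norming respectively dense for the other, and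
  make each span a monotone function of the other half.
\<close>

definition required :: "('a + ('a \<Rightarrow>\<^sub>L 'k)) set \<Rightarrow> ('a + ('a \<Rightarrow>\<^sub>L 'k)) set" where
  "required N =
     (let C = Inl -` N; D = Inr -` N in
       Inl ` ((\<Union>\<alpha>\<in>C. \<Union>u\<in>primal.rational_span C. \<theta> \<alpha> u) \<union>
         (\<Union>f\<in>dual.rational_span D. \<Union>v\<in>norming f. support v) \<union> (\<Union>f\<in>D. dual_origin f)) \<union>
       Inr ` ((\<Union>\<alpha>\<in>D. \<Union>u\<in>dual.rational_span D. \<eta> \<alpha> u) \<union>
         (\<Union>x\<in>primal.rational_span C. \<Union>g\<in>generator x. dual_support g) \<union> (\<Union>x\<in>C. origin x)))"

definition good :: "('a + ('a \<Rightarrow>\<^sub>L 'k)) set \<Rightarrow> bool" where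
  "good N \<longleftrightarrow> countable N \<and> N \<subseteq> Inl ` I \<union> Inr ` J \<and> required N \<subseteq> N"

lemma \<theta>: "countable (\<theta> \<alpha> u)" "\<theta> \<alpha> u \<subseteq> I"
  and \<eta>: "countable (\<eta> \<beta> f)" "\<eta> \<beta> f \<subseteq> J"
  by (fact primal.determining_systemD(3,4)[OF I] dual.determining_systemD(3,4)[OF J])+

lemma required_subset: "required N \<subseteq> Inl ` I \<union> Inr ` J"
  using \<theta>(2) \<eta>(2) support(2) dual_support(2) origin(2) dual_origin(2)
  unfolding required_def Let_def by blast

lemma countable_vimage_inj: "inj f \<Longrightarrow> countable N \<Longrightarrow> countable (f -` N)"
  by (metis countable_image_inj_eq countable_subset image_vimage_subset inj_on_subset subset_UNIV)

lemma countable_required: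
  assumes "countable N"
  shows "countable (required N)"
proof -
  have "countable (Inl -` N)" "countable (Inr -` N)"
    using assms by (auto intro: countable_vimage_inj)
  then show ?thesis
    unfolding required_def Let_def
    by (intro countable_Un countable_image countable_UN \<theta> \<eta> support dual_support origin dual_origin
        primal.countable_rational_span dual.countable_rational_span countable_norming countable_generator)
qed

lemma UN_UN_incseq:
  assumes "incseq A" "incseq B"
  shows "(\<Union>x\<in>(\<Union>n. A n). \<Union>y\<in>(\<Union>n. B n). h x y) = (\<Union>n. \<Union>x\<in>A n. \<Union>y\<in>B n. h x y)"
proof
  show "(\<Union>x\<in>(\<Union>n. A n). \<Union>y\<in>(\<Union>n. B n). h x y) \<subseteq> (\<Union>n. \<Union>x\<in>A n. \<Union>y\<in>B n. h x y)"
  proof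
    fix z assume "z \<in> (\<Union>x\<in>(\<Union>n. A n). \<Union>y\<in>(\<Union>n. B n). h x y)"
    then obtain m n x y where *: "x \<in> A m" "y \<in> B n" "z \<in> h x y" by blast
    have "A m \<subseteq> A (max m n)" "B n \<subseteq> B (max m n)"
      by (intro incseqD[OF assms(1)] incseqD[OF assms(2)] max.cobounded1 max.cobounded2)+
    then have "x \<in> A (max m n)" "y \<in> B (max m n)" using * by auto
    then show "z \<in> (\<Union>n. \<Union>x\<in>A n. \<Union>y\<in>B n. h x y)" using *(3) by blast
  qed
qed blast

text \<open>Every element of \<open>required N\<close> is already required by finitely many elements
  of \<open>N\<close>. This continuity makes saturation finish after countably many steps, and it
  makes unions of increasing sequences of good sets good.\<close>

lemma required_UN_incseq:
  assumes "incseq N"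
  shows "required (\<Union>n. N n) = (\<Union>n. required (N n))"
proof -
  have inc: "incseq (\<lambda>n. Inl -` N n)" "incseq (\<lambda>n. Inr -` N n)"
    using assms by (auto simp: incseq_def)
  have "incseq (\<lambda>n. primal.rational_span (Inl -` N n))" "incseq (\<lambda>n. dual.rational_span (Inr -` N n))"
    using inc by (simp_all add: incseq_def primal.rational_span_mono dual.rational_span_mono)
  note pairs = UN_UN_incseq[OF inc(1) this(1), of \<theta>] UN_UN_incseq[OF inc(2) this(2), of \<eta>]
  show ?thesis
    unfolding required_def Let_def vimage_UN primal.rational_span_UN_incseq[OF inc(1)]
      dual.rational_span_UN_incseq[OF inc(2)] pairs
    unfolding UN_UN_flatten
    by (simp only: UN_Un_distrib image_Un image_UN)
qed

lemma good_UN_incseq: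
  assumes "incseq N" "\<And>n. good (N n)"
  shows "good (\<Union>n. N n)"
  unfolding good_def required_UN_incseq[OF assms(1)]
  using assms(2) by (simp add: good_def UN_subset_iff) (meson UN_upper UNIV_I order_trans)

lemma exists_good:
  assumes "countable N" "N \<subseteq> Inl ` I \<union> Inr ` J"
  obtains M where "good M" "N \<subseteq> M"
proof -
  define S where "S n = ((\<lambda>N. N \<union> required N) ^^ n) N" for n
  have step: "S (Suc n) = S n \<union> required (S n)" for n by (simp add: S_def)
  have inc: "incseq S" by (rule incseq_SucI) (auto simp: step)
  have "countable (S n) \<and> S n \<subseteq> Inl ` I \<union> Inr ` J" for n
  proof (induction n)
    case 0
    then show ?case using assms by (simp add: S_def)
  next
    case (Suc n)
    then show ?case using countable_required required_subset by (auto simp: step)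
  qed
  moreover have "required (\<Union>n. S n) \<subseteq> (\<Union>n. S n)"
    using required_UN_incseq[OF inc] step by blast
  ultimately have "good (\<Union>n. S n)" unfolding good_def by auto
  moreover have "N \<subseteq> (\<Union>n. S n)" using UN_upper[of 0 UNIV S] by (simp add: S_def)
  ultimately show ?thesis using that by blast
qed

section \<open>Closed spans of the two halves of a good set\<close>

definition first :: "('a + ('a \<Rightarrow>\<^sub>L 'k)) set \<Rightarrow> 'a set" where
  "first N = closure (primal.rational_span (Inl -` N))"

definition second :: "('a + ('a \<Rightarrow>\<^sub>L 'k)) set \<Rightarrow> ('a \<Rightarrow>\<^sub>L 'k) set" where
  "second N = closure (dual.rational_span (Inr -` N))"

lemma first_mono: "N \<subseteq> M \<Longrightarrow> first N \<subseteq> first M"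
  unfolding first_def by (intro closure_mono primal.rational_span_mono) auto

lemma second_mono: "N \<subseteq> M \<Longrightarrow> second N \<subseteq> second M"
  unfolding second_def by (intro closure_mono dual.rational_span_mono) auto

lemma closure_UN_closure: "closure (\<Union>n. closure (A n)) = closure (\<Union>n. A n)"
proof
  show "closure (\<Union>n. closure (A n)) \<subseteq> closure (\<Union>n. A n)"
    by (intro closure_minimal UN_least closure_mono UN_upper) auto
  show "closure (\<Union>n. A n) \<subseteq> closure (\<Union>n. closure (A n))"
    by (intro closure_mono UN_mono order_refl closure_subset)
qed

lemma first_UN_incseq:
  assumes "incseq N"
  shows "first (\<Union>n. N n) = closure (\<Union>n. first (N n))"
proof -
  have "incseq (\<lambda>n. Inl -` N n)" using assms by (auto simp: incseq_def)
  from primal.rational_span_UN_incseq[OF this] show ?thesis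
    unfolding first_def vimage_UN closure_UN_closure by simp
qed

lemma second_UN_incseq:
  assumes "incseq N"
  shows "second (\<Union>n. N n) = closure (\<Union>n. second (N n))"
proof -
  have "incseq (\<lambda>n. Inr -` N n)" using assms by (auto simp: incseq_def)
  from dual.rational_span_UN_incseq[OF this] show ?thesis
    unfolding second_def vimage_UN closure_UN_closure by simp
qed

lemma good_vimage:
  assumes "good N"
  shows "Inl -` N \<subseteq> I" "Inr -` N \<subseteq> J" "countable (Inl -` N)" "countable (Inr -` N)"
    "N = Inl ` (Inl -` N) \<union> Inr ` (Inr -` N)"
  using assms unfolding good_def by (auto intro: countable_vimage_inj)

lemma good_required:
  assumes "good N"
  shows "\<alpha> \<in> Inl -` N \<Longrightarrow> u \<in> primal.rational_span (Inl -` N) \<Longrightarrow> \<theta> \<alpha> u \<subseteq> Inl -` N"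
    and "f \<in> dual.rational_span (Inr -` N) \<Longrightarrow> v \<in> norming f \<Longrightarrow> support v \<subseteq> Inl -` N"
    and "f \<in> Inr -` N \<Longrightarrow> dual_origin f \<subseteq> Inl -` N"
    and "\<beta> \<in> Inr -` N \<Longrightarrow> f \<in> dual.rational_span (Inr -` N) \<Longrightarrow> \<eta> \<beta> f \<subseteq> Inr -` N"
    and "x \<in> primal.rational_span (Inl -` N) \<Longrightarrow> g \<in> generator x \<Longrightarrow> dual_support g \<subseteq> Inr -` N"
    and "x \<in> Inl -` N \<Longrightarrow> origin x \<subseteq> Inr -` N"
proof -
  note r = assms[unfolded good_def required_def Let_def image_subset_iff_subset_vimage Un_subset_iff
      UN_subset_iff]
  show "\<alpha> \<in> Inl -` N \<Longrightarrow> u \<in> primal.rational_span (Inl -` N) \<Longrightarrow> \<theta> \<alpha> u \<subseteq> Inl -` N"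
    "f \<in> dual.rational_span (Inr -` N) \<Longrightarrow> v \<in> norming f \<Longrightarrow> support v \<subseteq> Inl -` N"
    "f \<in> Inr -` N \<Longrightarrow> dual_origin f \<subseteq> Inl -` N"
    "\<beta> \<in> Inr -` N \<Longrightarrow> f \<in> dual.rational_span (Inr -` N) \<Longrightarrow> \<eta> \<beta> f \<subseteq> Inr -` N"
    "x \<in> primal.rational_span (Inl -` N) \<Longrightarrow> g \<in> generator x \<Longrightarrow> dual_support g \<subseteq> Inr -` N"
    "x \<in> Inl -` N \<Longrightarrow> origin x \<subseteq> Inr -` N"
    using r by simp_all
qed

lemma first_Int:
  assumes N: "good N"
  shows "first N \<inter> I = Inl -` N"
proof
  show "first N \<inter> I \<subseteq> Inl -` N"
    unfolding first_def
    by (rule primal.determining_systemD(5)[OF I good_vimage(1)[OF N] good_required(1)[OF N]])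
  show "Inl -` N \<subseteq> first N \<inter> I"
    unfolding first_def
    by (rule Int_greatest[OF primal.subset_closure_rational_span good_vimage(1)[OF N]])
qed

lemma second_Int:
  assumes N: "good N"
  shows "second N \<inter> J = Inr -` N"
proof
  show "second N \<inter> J \<subseteq> Inr -` N"
    unfolding second_def
    by (rule dual.determining_systemD(5)[OF J good_vimage(2)[OF N] good_required(4)[OF N]])
  show "Inr -` N \<subseteq> second N \<inter> J"
    unfolding second_def
    by (rule Int_greatest[OF dual.subset_closure_rational_span good_vimage(2)[OF N]])
qed

lemma second_subset_dual: "good N \<Longrightarrow> second N \<subseteq> dual smul"
  unfolding second_def
  using good_vimage(2) dual.determining_systemD(1)[OF J]
  by (intro dual.closure_rational_span_least[OF subspace_dual closed_dual]) blast

lemma norming_subset_first: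
  assumes "good N" "f \<in> dual.rational_span (Inr -` N)"
  shows "norming f \<subseteq> first N"
proof
  fix v assume v: "v \<in> norming f"
  have "closure (primal.rational_span (support v)) \<subseteq> first N"
    unfolding first_def using good_required(2)[OF assms v]
    by (intro closure_mono primal.rational_span_mono)
  then show "v \<in> first N" using support(3) by blast
qed

lemma generator_subset_second:
  assumes "good N" "x \<in> primal.rational_span (Inl -` N)"
  shows "generator x \<subseteq> second N"
proof
  fix g assume g: "g \<in> generator x"
  have "closure (dual.rational_span (dual_support g)) \<subseteq> second N"
    unfolding second_def using good_required(5)[OF assms g]
    by (intro closure_mono dual.rational_span_mono)
  then show "g \<in> second N" using dual_support(3) g generator_subset_dual by blast
qed

lemma second_eq:
  assumes N: "good N"
  shows "second N = closure (dual.rational_span (\<Union>x\<in>primal.rational_span (Inl -` N). generator x))"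
    (is "_ = ?R")
proof
  have "Inr -` N \<subseteq> ?R"
  proof
    fix f assume f: "f \<in> Inr -` N"
    then have "f \<in> dual smul"
      using good_vimage(2)[OF N] dual.determining_systemD(1)[OF J] by blast
    moreover have "closure (dual.rational_span (\<Union>x\<in>primal.rational_span (dual_origin f). generator x)) \<subseteq> ?R"
      by (intro closure_mono dual.rational_span_mono UN_mono primal.rational_span_mono
          good_required(3)[OF N f] order_refl)
    ultimately show "f \<in> ?R" using dual_origin(3) by blast
  qed
  then show "second N \<subseteq> ?R"
    unfolding second_def by (rule dual.closure_rational_span_subset)
  have "(\<Union>x\<in>primal.rational_span (Inl -` N). generator x) \<subseteq> second N"
    using generator_subset_second[OF N] by blast
  then show "?R \<subseteq> second N"
    unfolding second_def by (rule dual.closure_rational_span_subset)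
qed

lemma first_eq:
  assumes N: "good N"
  shows "first N = closure (primal.rational_span (\<Union>f\<in>dual.rational_span (Inr -` N). norming f))"
    (is "_ = ?R")
proof
  have "Inl -` N \<subseteq> ?R"
  proof
    fix x assume x: "x \<in> Inl -` N"
    have "closure (primal.rational_span (\<Union>f\<in>dual.rational_span (origin x). norming f)) \<subseteq> ?R"
      by (intro closure_mono dual.rational_span_mono UN_mono primal.rational_span_mono
          good_required(6)[OF N x] order_refl)
    then show "x \<in> ?R" using origin(3) by blast
  qed
  then show "first N \<subseteq> ?R"
    unfolding first_def by (rule primal.closure_rational_span_subset)
  have "(\<Union>f\<in>dual.rational_span (Inr -` N). norming f) \<subseteq> first N"
    using norming_subset_first[OF N] by blast
  then show "?R \<subseteq> first N"
    unfolding first_def by (rule primal.closure_rational_span_subset)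
qed

text \<open>\<open>first_Int\<close> recovers the left half of a good set from its first side, and
  \<open>second_eq\<close> expresses the second side monotonically through that half.\<close>

lemma second_subset_of_first_subset:
  assumes "good N" "good M" "first N \<subseteq> first M"
  shows "second N \<subseteq> second M"
proof -
  have "Inl -` N \<subseteq> Inl -` M"
    unfolding first_Int[OF assms(1), symmetric] first_Int[OF assms(2), symmetric]
    using assms(3) by blast
  then show ?thesis
    unfolding second_eq[OF assms(1)] second_eq[OF assms(2)]
    by (intro closure_mono dual.rational_span_mono UN_mono primal.rational_span_mono) auto
qed

lemma first_subset_of_second_subset:
  assumes "good N" "good M" "second N \<subseteq> second M"
  shows "first N \<subseteq> first M"
proof -
  have "Inr -` N \<subseteq> Inr -` M"
    unfolding second_Int[OF assms(1), symmetric] second_Int[OF assms(2), symmetric]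
    using assms(3) by blast
  then show ?thesis
    unfolding first_eq[OF assms(1)] first_eq[OF assms(2)]
    by (intro closure_mono dual.rational_span_mono UN_mono primal.rational_span_mono) auto
qed

text \<open>With its counterpart for \<open>second\<close> this turns inclusion of sides into
  inclusion of the index sets, to which all order statements of the theorem reduce.\<close>

lemma first_subset_iff:
  assumes N: "good N" and M: "good M"
  shows "first N \<subseteq> first M \<longleftrightarrow> N \<subseteq> M"
proof
  assume le: "first N \<subseteq> first M"
  then have le': "second N \<subseteq> second M" by (rule second_subset_of_first_subset[OF N M])
  have "Inl -` N \<subseteq> Inl -` M"
    unfolding first_Int[OF N, symmetric] first_Int[OF M, symmetric] using le by blast
  moreover have "Inr -` N \<subseteq> Inr -` M"
    unfolding second_Int[OF N, symmetric] second_Int[OF M, symmetric] using le' by blast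
  ultimately have "Inl ` (Inl -` N) \<union> Inr ` (Inr -` N) \<subseteq> M" by blast
  then show "N \<subseteq> M" by (rule ord_eq_le_trans[OF good_vimage(5)[OF N]])
qed (rule first_mono)

lemma second_subset_iff:
  assumes N: "good N" and M: "good M"
  shows "second N \<subseteq> second M \<longleftrightarrow> N \<subseteq> M"
  using first_subset_of_second_subset[OF N M] first_subset_iff[OF N M] second_mono[of N M] by (elim iffE) iprover

text \<open>Norming vectors for a dense part of \<open>second N\<close> lie in
  \<open>first N\<close>, so restriction to \<open>first N\<close> is isometric on
  \<open>second N\<close>. The bound \<open>B\<close> is left free: it is used with 0 for
  uniqueness, with the errors of approximations for the Cauchy property, and with
  \<open>norm f\<close> for contractivity.\<close>

lemma norm_second_le:
  assumes N: "good N" and y: "y \<in> second N" and B: "0 \<le> B"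
    and le: "\<And>v. v \<in> first N \<Longrightarrow> norm (blinfun_apply y v) \<le> B * norm v"
  shows "norm y \<le> B"
proof (rule field_le_epsilon)
  fix e :: real assume "0 < e"
  then have e: "0 < e / 4" by simp
  obtain d where d: "d \<in> dual.rational_span (Inr -` N)" "dist d y < e / 4"
    using y e unfolding second_def closure_approachable by blast
  obtain v where v: "v \<in> norming d" "norm v \<le> 1" "norm d - e / 4 < norm (d v)"
    using norming[OF e] by blast
  have "norm (y v) \<le> B * norm v"
    using norming_subset_first[OF N d(1)] v(1) le by blast
  also have "\<dots> \<le> B" using mult_left_mono[OF v(2) B] by simp
  finally have 1: "norm (y v) \<le> B" .
  have "norm ((d - y) v) \<le> norm (d - y) * norm v" by (rule norm_blinfun)
  also have "\<dots> \<le> norm (d - y)" using mult_left_mono[OF v(2) norm_ge_zero[of "d - y"]] by simp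
  finally have 2: "norm (d v - y v) < e / 4" using d(2) by (simp add: dist_norm blinfun.diff_left)
  have 3: "norm (d v) - norm (y v) \<le> norm (d v - y v)" by (rule norm_triangle_ineq2)
  have "norm y - norm d \<le> norm (d - y)" by (metis norm_minus_commute norm_triangle_ineq2)
  then have 4: "norm y - norm d < e / 4" using d(2) by (simp add: dist_norm)
  show "norm y \<le> B + e" using 1 2 3 4 v(3) e by linarith
qed

lemma subspace_first: "subspace (first N)"
  unfolding first_def by (rule primal.subspace_closure_rational_span)

lemma subspace_second: "dual.subspace (second N)"
  unfolding second_def by (rule dual.subspace_closure_rational_span)

text \<open>Surjectivity of the restriction. Generators of vectors in a dense part of
  \<open>first N\<close> approximate \<open>f\<close> there and belong to \<open>second N\<close>;
  by the isometry the approximations form a Cauchy sequence, and the limit agrees with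
  \<open>f\<close> on \<open>first N\<close>.\<close>

lemma exists_second:
  assumes N: "good N" and f: "f \<in> dual smul"
  shows "\<exists>y\<in>second N. \<forall>v\<in>first N. blinfun_apply y v = blinfun_apply f v"
proof -
  have "\<exists>g\<in>second N. \<forall>v\<in>first N. norm (f v - blinfun_apply g v) \<le> inverse (real (Suc n)) * norm v" for n
  proof -
    obtain d g where "d \<in> primal.rational_span (Inl -` N)" "g \<in> generator d"
      "\<forall>v\<in>first N. norm (f v - blinfun_apply g v) \<le> inverse (real (Suc n)) * norm v"
      using generator_dense[OF asplund subspace_first[of N] _ _ f, of "primal.rational_span (Inl -` N)" "inverse (real (Suc n))"]
        closure_subset unfolding first_def by auto
    then show ?thesis using generator_subset_second[OF N] by blast
  qed
  then obtain g where g: "\<And>n. g n \<in> second N"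
    "\<And>n v. v \<in> first N \<Longrightarrow> norm (f v - blinfun_apply (g n) v) \<le> inverse (real (Suc n)) * norm v"
    by metis
  have near: "norm (g m - g n) \<le> inverse (real (Suc m)) + inverse (real (Suc n))" for m n
  proof (rule norm_second_le[OF N])
    show "g m - g n \<in> second N" by (rule dual.subspace_diff[OF subspace_second g(1) g(1)])
    fix v assume v: "v \<in> first N"
    have "norm ((g m - g n) v) = norm ((f v - g n v) - (f v - g m v))"
      by (simp add: blinfun.diff_left)
    also have "\<dots> \<le> norm (f v - g n v) + norm (f v - g m v)" by (rule norm_triangle_ineq4)
    also have "\<dots> \<le> inverse (real (Suc n)) * norm v + inverse (real (Suc m)) * norm v"
      by (intro add_mono g(2) v)
    finally show "norm ((g m - g n) v) \<le> (inverse (real (Suc m)) + inverse (real (Suc n))) * norm v"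
      by (simp add: distrib_right)
  qed simp
  have "Cauchy g"
  proof (rule CauchyI)
    fix e :: real assume "0 < e"
    then obtain k where k: "inverse (real (Suc k)) < e / 2"
      by (metis half_gt_zero reals_Archimedean)
    have "norm (g m - g n) < e" if "m \<ge> k" "n \<ge> k" for m n
    proof -
      have "inverse (real (Suc m)) \<le> inverse (real (Suc k))" "inverse (real (Suc n)) \<le> inverse (real (Suc k))"
        using that by (auto intro: le_imp_inverse_le)
      then show ?thesis using near[of m n] k by linarith
    qed
    then show "\<exists>M. \<forall>m\<ge>M. \<forall>n\<ge>M. norm (g m - g n) < e" by blast
  qed
  moreover have "g n \<in> dual smul" for n using g(1) second_subset_dual[OF N] by blast
  ultimately obtain y where y: "g \<longlonglongrightarrow> y"
    using dual_Cauchy_converges by metis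
  have "closed (second N)" unfolding second_def by simp
  then have "y \<in> second N"
    using g(1) y by (rule closed_sequentially)
  moreover have "y v = f v" if v: "v \<in> first N" for v
  proof -
    have "(\<lambda>n. g n v) \<longlonglongrightarrow> y v" using y by (intro tendsto_intros)
    moreover have "(\<lambda>n. g n v) \<longlonglongrightarrow> f v"
    proof (rule LIM_zero_cancel)
      have "(\<lambda>n. inverse (real (Suc n)) * norm v) \<longlonglongrightarrow> 0"
        by (intro tendsto_mult_left_zero LIMSEQ_inverse_real_of_nat)
      moreover have "\<forall>\<^sub>F n in sequentially. norm (g n v - f v) \<le> inverse (real (Suc n)) * norm v"
        using g(2)[OF v] by (simp add: norm_minus_commute)
      ultimately show "(\<lambda>n. g n v - f v) \<longlonglongrightarrow> 0" by (rule Lim_null_comparison[rotated])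
    qed
    ultimately show ?thesis by (rule LIMSEQ_unique)
  qed
  ultimately show ?thesis by blast
qed

end

lemma sep_subspaces_dense:
  assumes "V \<in> sep_subspaces s Z"
  obtains D where "countable D" "D \<subseteq> V" "V \<subseteq> closure D"
proof -
  obtain D where D: "countable D" "D \<subseteq> V" "top_of_set V closure_of D = V"
    using assms unfolding sep_subspaces_def separable_space_def by auto
  then have "V \<subseteq> closure (V \<inter> D)" "V \<inter> D = D"
    by (auto simp: closure_of_subtopology)
  then have "V \<subseteq> closure D" by simp
  then show ?thesis using that D by blast
qed

section \<open>Families indexed by countable sets\<close>

text \<open>An increasing sequence of images lifts, by \<open>iff\<close>, to an increasing sequence
  of indices, so closedness under unions can be checked there. This serves the rectangles and both
  kinds of sides.\<close>

lemma rich_image: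
  assumes sep: "\<And>N. N \<in> \<N> \<Longrightarrow> \<phi> N \<in> sep_subspaces s Z"
    and cofinal: "\<And>V. V \<in> sep_subspaces s Z \<Longrightarrow> \<exists>N\<in>\<N>. V \<subseteq> \<phi> N"
    and iff: "\<And>N M. N \<in> \<N> \<Longrightarrow> M \<in> \<N> \<Longrightarrow> \<phi> N \<subseteq> \<phi> M \<longleftrightarrow> N \<subseteq> M"
    and UN: "\<And>N. (\<And>n. N n \<in> \<N>) \<Longrightarrow> incseq N \<Longrightarrow>
      (\<Union>n. N n) \<in> \<N> \<and> \<phi> (\<Union>n. N n) = closure (\<Union>n. \<phi> (N n))"
  shows "rich s Z (\<phi> ` \<N>)"
  unfolding rich_def
proof (intro conjI allI impI ballI)
  show "\<phi> ` \<N> \<subseteq> sep_subspaces s Z" using sep by blast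
  show "\<exists>V'\<in>\<phi> ` \<N>. V \<subseteq> V'" if "V \<in> sep_subspaces s Z" for V
    using cofinal[OF that] by blast
  fix W :: "nat \<Rightarrow> 'b set" assume W: "range W \<subseteq> \<phi> ` \<N> \<and> incseq W"
  then have "\<exists>N. N \<in> \<N> \<and> W n = \<phi> N" for n by blast
  then obtain N where N: "\<And>n. N n \<in> \<N>" "\<And>n. W n = \<phi> (N n)" by metis
  have "incseq N"
    using W N by (auto simp: incseq_def iff[symmetric])
  from UN[OF N(1) this] show "closure (\<Union>n. W n) \<in> \<phi> ` \<N>"
    unfolding N(2) by (metis image_eqI)
qed

text \<open>Suprema and strict increase are order notions, hence invariant under an order embedding
  onto the new index family. This is how the one skeleton acquires its three index families.\<close>

lemma one_projectional_skeleton_image: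
  assumes sk: "one_projectional_skeleton s Z \<N> (\<subseteq>) P"
    and iff: "\<And>N M. N \<in> \<N> \<Longrightarrow> M \<in> \<N> \<Longrightarrow> \<phi> N \<subseteq> \<phi> M \<longleftrightarrow> N \<subseteq> M"
    and Q: "\<And>N. N \<in> \<N> \<Longrightarrow> Q (\<phi> N) = P N"
  shows "one_projectional_skeleton s Z (\<phi> ` \<N>) (\<subseteq>) Q"
proof -
  have sup: "supremum_on (\<phi> ` \<N>) (\<subseteq>) (range (\<lambda>n. \<phi> (N n))) (\<phi> t) \<longleftrightarrow> supremum_on \<N> (\<subseteq>) (range N) t"
    if "\<And>n. N n \<in> \<N>" "t \<in> \<N>" for N :: "nat \<Rightarrow> 'c set" and t
    using that by (auto simp: supremum_on_def iff)
  have pick: "\<exists>N. (\<forall>n. N n \<in> \<N>) \<and> \<sigma> = (\<lambda>n. \<phi> (N n))" if "range \<sigma> \<subseteq> \<phi> ` \<N>" for \<sigma> :: "nat \<Rightarrow> 'd set"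
  proof -
    have "\<exists>N. N \<in> \<N> \<and> \<sigma> n = \<phi> N" for n using that by blast
    then show ?thesis by metis
  qed
  have psk: "projectional_skeleton s Z \<N> (\<subseteq>) P" and norm: "\<And>N. N \<in> \<N> \<Longrightarrow> op_norm_on Z (P N) \<le> 1"
    using sk by (auto simp: one_projectional_skeleton_def)
  have "directed_sigma_complete \<N> (\<subseteq>)"
    using psk by (simp add: projectional_skeleton_def)
  then have dir: "\<N> \<noteq> {}" "\<forall>N\<in>\<N>. \<forall>M\<in>\<N>. \<exists>L\<in>\<N>. N \<subseteq> L \<and> M \<subseteq> L"
    "\<And>N :: nat \<Rightarrow> _. range N \<subseteq> \<N> \<Longrightarrow> (\<forall>n. N n \<subseteq> N (Suc n)) \<Longrightarrow> \<exists>t. supremum_on \<N> (\<subseteq>) (range N) t"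
    by (simp_all add: directed_sigma_complete_def)
  have closure: "P t ` Z = closure (\<Union>n. P (N n) ` Z)"
    if "range N \<subseteq> \<N>" "\<forall>n. N n \<subseteq> N (Suc n) \<and> N n \<noteq> N (Suc n)" "supremum_on \<N> (\<subseteq>) (range N) t"
    for N :: "nat \<Rightarrow> _" and t
    using psk that unfolding projectional_skeleton_def by simp
  show ?thesis
    unfolding one_projectional_skeleton_def projectional_skeleton_def directed_sigma_complete_def
  proof (intro conjI allI impI)
    show "reflp_on (\<phi> ` \<N>) (\<subseteq>)" "antisymp_on (\<phi> ` \<N>) (\<subseteq>)" "transp_on (\<phi> ` \<N>) (\<subseteq>)"
      by (auto intro!: reflp_onI antisymp_onI transp_onI)
    show "\<phi> ` \<N> \<noteq> {}" using dir(1) by simp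
    show "\<forall>s\<in>\<phi> ` \<N>. \<forall>t\<in>\<phi> ` \<N>. \<exists>u\<in>\<phi> ` \<N>. s \<subseteq> u \<and> t \<subseteq> u"
      using dir(2) by (simp add: iff)
    show "\<exists>t. supremum_on (\<phi> ` \<N>) (\<subseteq>) (range \<sigma>) t"
      if \<sigma>: "range \<sigma> \<subseteq> \<phi> ` \<N> \<and> (\<forall>n. \<sigma> n \<subseteq> \<sigma> (Suc n))" for \<sigma> :: "nat \<Rightarrow> 'd set"
    proof -
      obtain N where N: "\<forall>n. N n \<in> \<N>" "\<sigma> = (\<lambda>n. \<phi> (N n))"
        using pick[OF conjunct1[OF \<sigma>]] by (elim exE conjE)
      have "range N \<subseteq> \<N>" "\<forall>n. N n \<subseteq> N (Suc n)" using \<sigma> N by (auto simp: iff)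
      from dir(3)[OF this] obtain t where t: "supremum_on \<N> (\<subseteq>) (range N) t" ..
      then have "t \<in> \<N>" by (simp add: supremum_on_def)
      then have "supremum_on (\<phi> ` \<N>) (\<subseteq>) (range \<sigma>) (\<phi> t)"
        unfolding N(2) using sup[of N t] N(1) t by simp
      then show ?thesis ..
    qed
    show "Q t ` Z = closure (\<Union>n. Q (\<sigma> n) ` Z)"
      if \<sigma>: "range \<sigma> \<subseteq> \<phi> ` \<N> \<and> (\<forall>n. \<sigma> n \<subseteq> \<sigma> (Suc n) \<and> \<sigma> n \<noteq> \<sigma> (Suc n)) \<and>
        supremum_on (\<phi> ` \<N>) (\<subseteq>) (range \<sigma>) t" for \<sigma> :: "nat \<Rightarrow> 'd set" and t
    proof -
      obtain N where N: "\<forall>n. N n \<in> \<N>" "\<sigma> = (\<lambda>n. \<phi> (N n))"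
        using pick[OF conjunct1[OF \<sigma>]] by (elim exE conjE)
      have "t \<in> \<phi> ` \<N>" using \<sigma> by (simp add: supremum_on_def)
      then obtain u where u: "u \<in> \<N>" "t = \<phi> u" by blast
      have "range N \<subseteq> \<N>" "\<forall>n. N n \<subseteq> N (Suc n) \<and> N n \<noteq> N (Suc n)"
        using \<sigma> N by (auto simp: iff) metis
      moreover have "supremum_on \<N> (\<subseteq>) (range N) u"
        using sup[of N u] \<sigma> N u by simp
      ultimately have "P u ` Z = closure (\<Union>n. P (N n) ` Z)" by (rule closure)
      then show ?thesis using N u Q by simp
    qed
  qed (use psk norm in \<open>simp_all add: projectional_skeleton_def Q iff\<close>)
qed

lemma inj_on_of_subset_iff:
  assumes "\<And>N M. N \<in> \<N> \<Longrightarrow> M \<in> \<N> \<Longrightarrow> \<phi> N \<subseteq> \<phi> M \<longleftrightarrow> N \<subseteq> M"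
  shows "inj_on \<phi> \<N>"
proof (rule inj_onI)
  fix N M assume "N \<in> \<N>" "M \<in> \<N>" "\<phi> N = \<phi> M"
  then have "N \<subseteq> M" "M \<subseteq> N" using assms[of N M] assms[of M N] by simp_all
  then show "N = M" by simp
qed

lemma inclusion_isomorphic_images:
  assumes "\<And>N M. N \<in> \<N> \<Longrightarrow> M \<in> \<N> \<Longrightarrow> \<phi> N \<subseteq> \<phi> M \<longleftrightarrow> N \<subseteq> M"
    and "\<And>N M. N \<in> \<N> \<Longrightarrow> M \<in> \<N> \<Longrightarrow> \<psi> N \<subseteq> \<psi> M \<longleftrightarrow> N \<subseteq> M"
  shows "inclusion_isomorphic (\<phi> ` \<N>) (\<psi> ` \<N>)"
proof -
  have inj: "inj_on \<phi> \<N>" "inj_on \<psi> \<N>"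
    by (rule inj_on_of_subset_iff, rule assms, assumption+)+
  let ?f = "\<lambda>V. \<psi> (inv_into \<N> \<phi> V)"
  have f: "?f (\<phi> N) = \<psi> N" if "N \<in> \<N>" for N using that inj by simp
  have "bij_betw ?f (\<phi> ` \<N>) (\<psi> ` \<N>)"
    unfolding bij_betw_def inj_on_def using inj by (auto simp: image_image inj_on_eq_iff)
  then show ?thesis
    unfolding inclusion_isomorphic_def using assms inj by (intro exI[of _ ?f]) simp
qed

section \<open>Bidual elements and weak* closures\<close>

context banach_space_over
begin

text \<open>A Helly-type statement by elimination: a functional \<open>f\<close> in \<open>F\<close>
  that does not vanish on \<open>V\<close> is split off with a vector \<open>w\<close> where it
  takes the value 1, and the remaining conditions are solved in the kernel of \<open>f\<close> in
  \<open>V\<close>.\<close>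

lemma bidual_interpolation:
  assumes "finite F" "F \<subseteq> dual smul" "subspace V"
    and "\<And>f g. f \<in> dual smul \<Longrightarrow> g \<in> dual smul \<Longrightarrow> \<psi> (f + g) = \<psi> f + \<psi> g"
    and "\<And>c f. f \<in> dual smul \<Longrightarrow> \<psi> (dual_scale c f) = c * \<psi> f"
    and "\<And>g. g \<in> dual smul \<Longrightarrow> (\<And>v. v \<in> V \<Longrightarrow> blinfun_apply g v = 0) \<Longrightarrow> \<psi> g = 0"
  shows "\<exists>v\<in>V. \<forall>f\<in>F. blinfun_apply f v = \<psi> f"
  using assms
proof (induction F arbitrary: V \<psi>)
  case empty
  then show ?case using subspace_0 by blast
next
  case (insert f F)
  note V = insert.prems(2) and add = insert.prems(3) and scale = insert.prems(4)
    and zero = insert.prems(5)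
  have f: "f \<in> dual smul" and F: "F \<subseteq> dual smul" using insert.prems(1) by auto
  show ?case
  proof (cases "\<forall>v\<in>V. f v = 0")
    case True
    then have "\<psi> f = 0" using zero f by blast
    then show ?thesis using insert.IH[OF F V add scale zero] True by fastforce
  next
    case False
    then obtain w0 where w0: "w0 \<in> V" "f w0 \<noteq> 0" by blast
    define w where "w = smul (inverse (f w0)) w0"
    have w: "w \<in> V" "f w = 1"
      using w0 V f by (auto simp: w_def dual_smul subspace_scale)
    define V1 where "V1 = {v \<in> V. f v = 0}"
    \<comment> \<open>Subtracts evaluation at the multiple of \<open>w\<close> that will be added at
      the end to attain the value at \<open>f\<close>.\<close>
    define \<psi>1 where "\<psi>1 g = \<psi> g - \<psi> f * blinfun_apply g w" for g
    have "\<exists>v\<in>V1. \<forall>g\<in>F. blinfun_apply g v = \<psi>1 g"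
    proof (rule insert.IH[OF F])
      show "subspace V1"
        using V f unfolding subspace_def V1_def by (auto simp: blinfun.add_right dual_smul)
      show "\<psi>1 (g + h) = \<psi>1 g + \<psi>1 h" if "g \<in> dual smul" "h \<in> dual smul" for g h
        using add[OF that] by (simp add: \<psi>1_def blinfun.add_left algebra_simps)
      show "\<psi>1 (dual_scale c g) = c * \<psi>1 g" if "g \<in> dual smul" for c g
        using scale[OF that] by (simp add: \<psi>1_def dual_scale_apply algebra_simps)
      show "\<psi>1 g = 0" if g: "g \<in> dual smul" "\<And>v. v \<in> V1 \<Longrightarrow> blinfun_apply g v = 0" for g
      proof -
        \<comment> \<open>The correction makes \<open>g + ?h\<close> vanish at \<open>w\<close> as
          well as on \<open>V1\<close>, hence on all of \<open>V\<close>, where the hypothesis on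
          \<psi> applies.\<close>
        let ?h = "dual_scale (- g w) f"
        have h: "?h \<in> dual smul" by (rule dual.subspace_scale[OF subspace_dual f])
        have zero': "\<psi> (g + ?h) = 0"
        proof (rule zero)
          show "g + ?h \<in> dual smul" by (rule dual.subspace_add[OF subspace_dual g(1) h])
          fix v assume v: "v \<in> V"
          have "v - smul (f v) w \<in> V1"
            using v w V f by (auto simp: V1_def blinfun.diff_right dual_smul subspace_diff subspace_scale)
          from g(2)[OF this] show "(g + ?h) v = 0"
            using g(1) by (simp add: blinfun.bilinear_simps dual_smul dual_scale_apply algebra_simps)
        qed
        have "\<psi> g + - g w * \<psi> f = 0"
          unfolding scale[OF f, symmetric] add[OF g(1) h, symmetric] by (rule zero')
        then show ?thesis by (simp add: \<psi>1_def algebra_simps)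
      qed
    qed
    then obtain v1 where v1: "v1 \<in> V" "f v1 = 0" "\<And>g. g \<in> F \<Longrightarrow> blinfun_apply g v1 = \<psi> g - \<psi> f * g w"
      by (auto simp: V1_def \<psi>1_def)
    show ?thesis
    proof (intro bexI ballI)
      show "v1 + smul (\<psi> f) w \<in> V" using v1 w V by (simp add: subspace_add subspace_scale)
      fix g assume "g \<in> insert f F"
      then show "g (v1 + smul (\<psi> f) w) = \<psi> g"
        using v1 w F f by (auto simp: blinfun.add_right dual_smul subset_iff)
    qed
  qed
qed

lemma bidualD:
  assumes "\<psi> \<in> bidual smul"
  shows "\<psi> \<in> extensional (dual smul)"
    and "f \<in> dual smul \<Longrightarrow> g \<in> dual smul \<Longrightarrow> \<psi> (f + g) = \<psi> f + \<psi> g"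
    and "f \<in> dual smul \<Longrightarrow> \<psi> (dual_scale c f) = c * \<psi> f"
    and "\<exists>B. \<forall>f\<in>dual smul. norm (\<psi> f) \<le> B * norm f"
  using assms unfolding bidual_def by blast+

lemma canonical_in_bidual: "canonical smul v \<in> bidual smul"
  unfolding bidual_def canonical_def
proof (intro CollectI conjI ballI allI)
  fix f g :: "'a \<Rightarrow>\<^sub>L 'k" and c :: 'k assume f: "f \<in> dual smul"
  show "(\<lambda>f\<in>dual smul. blinfun_apply f v) (dual_scale c f) = c * (\<lambda>f\<in>dual smul. blinfun_apply f v) f"
    using f dual.subspace_scale[OF subspace_dual f, of c] by (simp add: dual_scale_apply)
  assume g: "g \<in> dual smul"
  show "(\<lambda>f\<in>dual smul. blinfun_apply f v) (f + g) = (\<lambda>f\<in>dual smul. blinfun_apply f v) f + (\<lambda>f\<in>dual smul. blinfun_apply f v) g"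
    using f g dual.subspace_add[OF subspace_dual f g] by (simp add: blinfun.add_left)
next
  show "\<exists>B. \<forall>f\<in>dual smul. norm ((\<lambda>f\<in>dual smul. blinfun_apply f v) f) \<le> B * norm f"
    by (intro exI[of _ "norm v"]) (auto simp: norm_blinfun mult.commute[of "norm v"])
qed simp

lemma topspace_weak_star_topology: "topspace (weak_star_topology smul) = bidual smul"
  using bidualD(1) by (auto simp: weak_star_topology_def PiE_def)

lemma continuous_map_weak_star_apply:
  "f \<in> dual smul \<Longrightarrow> continuous_map (weak_star_topology smul) euclidean (\<lambda>\<psi>. \<psi> f)"
  unfolding weak_star_topology_def
  by (intro continuous_map_from_subtopology continuous_map_product_projection)

text \<open>
  The functionals in the range of the adjoint are those that factor through \<open>P\<close>, and these
  can be interpolated exactly at finitely many points by elements of \<open>V\<close>.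
\<close>

lemma adjoint_range_eq_closure:
  assumes P: "projection_on dual_scale (dual smul) P" and V: "subspace V"
    and agree: "\<And>f v. f \<in> dual smul \<Longrightarrow> v \<in> V \<Longrightarrow> blinfun_apply (P f) v = blinfun_apply f v"
    and ker: "\<And>f. f \<in> dual smul \<Longrightarrow> (\<And>v. v \<in> V \<Longrightarrow> blinfun_apply f v = 0) \<Longrightarrow> P f = 0"
  shows "adjoint_range smul P = (weak_star_topology smul) closure_of (canonical smul ` V)"
proof
  have PZ: "P f \<in> dual smul" if "f \<in> dual smul" for f
    using P that by (auto simp: projection_on_def)
  have Padd: "P (f + g) = P f + P g" if "f \<in> dual smul" "g \<in> dual smul" for f g
    using P that by (simp add: projection_on_def)
  have Pscale: "P (dual_scale c f) = dual_scale c (P f)" if "f \<in> dual smul" for c f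
    using P that by (simp add: projection_on_def)
  obtain B where B: "\<And>f. f \<in> dual smul \<Longrightarrow> norm (P f) \<le> B * norm f"
    using P unfolding projection_on_def by blast
  have bd: "compose (dual smul) \<phi> P \<in> bidual smul" if \<phi>: "\<phi> \<in> bidual smul" for \<phi>
  proof -
    obtain C where C: "\<And>f. f \<in> dual smul \<Longrightarrow> norm (\<phi> f) \<le> C * norm f" using bidualD(4)[OF \<phi>] by blast
    have "norm (\<phi> (P f)) \<le> \<bar>C\<bar> * B * norm f" if f: "f \<in> dual smul" for f
    proof -
      have "norm (\<phi> (P f)) \<le> C * norm (P f)" by (rule C[OF PZ[OF f]])
      also have "\<dots> \<le> \<bar>C\<bar> * norm (P f)" by (intro mult_right_mono) auto
      also have "\<dots> \<le> \<bar>C\<bar> * (B * norm f)" by (intro mult_left_mono B f) auto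
      finally show ?thesis by (simp add: mult.assoc)
    qed
    then show ?thesis
      unfolding bidual_def
      using bidualD(2,3)[OF \<phi>] PZ Padd Pscale dual.subspace_add[OF subspace_dual]
        dual.subspace_scale[OF subspace_dual]
      by (auto simp: compose_def)
  qed
  show "adjoint_range smul P \<subseteq> (weak_star_topology smul) closure_of (canonical smul ` V)"
  proof
    fix \<psi> assume "\<psi> \<in> adjoint_range smul P"
    then obtain \<phi> where \<phi>: "\<phi> \<in> bidual smul" "\<psi> = compose (dual smul) \<phi> P"
      by (auto simp: adjoint_range_def)
    have \<psi>: "\<psi> \<in> bidual smul" using bd \<phi> by simp
    have zero: "\<psi> g = 0" if "g \<in> dual smul" "\<And>v. v \<in> V \<Longrightarrow> g v = 0" for g
    proof -
      have "\<psi> g = \<phi> (dual_scale 0 g)"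
        using ker[OF that] that(1) by (simp add: \<phi>(2) compose_def)
      then show ?thesis using bidualD(3)[OF \<phi>(1) that(1), of 0] by simp
    qed
    show "\<psi> \<in> (weak_star_topology smul) closure_of (canonical smul ` V)"
      unfolding in_closure_of topspace_weak_star_topology
    proof (intro conjI allI impI \<psi>)
      fix T assume T: "\<psi> \<in> T \<and> openin (weak_star_topology smul) T"
      then obtain U where U: "openin (product_topology (\<lambda>_. euclidean) (dual smul)) U" "T = U \<inter> bidual smul"
        by (auto simp: weak_star_topology_def openin_subtopology)
      have "\<psi> \<in> U" using T U by blast
      then obtain W where W: "finite {f \<in> dual smul. W f \<noteq> topspace euclidean}"
        "\<psi> \<in> Pi\<^sub>E (dual smul) W" "Pi\<^sub>E (dual smul) W \<subseteq> U"
        using U(1) unfolding openin_product_topology_alt by blast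
      obtain v where v: "v \<in> V" "\<forall>f\<in>{f \<in> dual smul. W f \<noteq> topspace euclidean}. blinfun_apply f v = \<psi> f"
        using bidual_interpolation[OF W(1) _ V bidualD(2,3)[OF \<psi>] zero] by blast
      have "canonical smul v \<in> Pi\<^sub>E (dual smul) W"
      proof
        fix f assume f: "f \<in> dual smul"
        show "canonical smul v f \<in> W f"
        proof (cases "W f = UNIV")
          case False
          then have "canonical smul v f = \<psi> f" using v(2) f by (simp add: canonical_def)
          then show ?thesis using W(2) f by auto
        qed simp
      qed (simp add: canonical_def)
      then have "canonical smul v \<in> T" using U(2) W(3) canonical_in_bidual by blast
      then show "\<exists>y. y \<in> canonical smul ` V \<and> y \<in> T" using v(1) by blast
    qed
  qed
  show "(weak_star_topology smul) closure_of (canonical smul ` V) \<subseteq> adjoint_range smul P"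
  proof
    fix \<psi> assume cl: "\<psi> \<in> (weak_star_topology smul) closure_of (canonical smul ` V)"
    then have \<psi>: "\<psi> \<in> bidual smul"
      by (metis in_closure_of topspace_weak_star_topology)
    have "\<psi> f = \<psi> (P f)" if f: "f \<in> dual smul" for f
      by (rule forall_in_closure_of_eq[OF cl _ continuous_map_weak_star_apply[OF f]
            continuous_map_weak_star_apply[OF PZ[OF f]]])
        (use f PZ[OF f] agree[OF f] in \<open>auto simp: canonical_def\<close>)
    then have "\<psi> = compose (dual smul) \<psi> P"
      using bidualD(1)[OF \<psi>] by (intro extensionalityI[of _ "dual smul"]) (auto simp: compose_def)
    then show "\<psi> \<in> adjoint_range smul P"
      using \<psi> unfolding adjoint_range_def by blast
  qed
qed

end

section \<open>The projections\<close>

context asplund_systems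
begin

definition proj :: "('a + ('a \<Rightarrow>\<^sub>L 'k)) set \<Rightarrow> ('a \<Rightarrow>\<^sub>L 'k) \<Rightarrow> ('a \<Rightarrow>\<^sub>L 'k)" where
  "proj N f = (SOME y. y \<in> second N \<and> (\<forall>v\<in>first N. blinfun_apply y v = blinfun_apply f v))"

lemma proj:
  assumes "good N" "f \<in> dual smul"
  shows proj_in_second: "proj N f \<in> second N"
    and proj_apply: "v \<in> first N \<Longrightarrow> blinfun_apply (proj N f) v = blinfun_apply f v"
  using someI_ex[OF exists_second[OF assms, unfolded Bex_def], folded proj_def] by blast+

text \<open>The difference lies in \<open>second N\<close> and vanishes on \<open>first N\<close>,
  so it is 0 by \<open>norm_second_le\<close>. Linearity, idempotence and compatibility of the
  projections all follow from this uniqueness.\<close>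

lemma proj_eqI:
  assumes N: "good N" and f: "f \<in> dual smul" and y: "y \<in> second N"
    and eq: "\<And>v. v \<in> first N \<Longrightarrow> blinfun_apply y v = blinfun_apply f v"
  shows "proj N f = y"
proof -
  have "norm (proj N f - y) \<le> 0"
  proof (rule norm_second_le[OF N])
    show "proj N f - y \<in> second N"
      by (rule dual.subspace_diff[OF subspace_second proj_in_second[OF N f] y])
    show "norm (blinfun_apply (proj N f - y) v) \<le> 0 * norm v" if "v \<in> first N" for v
      using eq[OF that] proj_apply[OF N f that] by (simp add: blinfun.diff_left)
  qed simp
  then show ?thesis by simp
qed

lemma proj_in_dual: "good N \<Longrightarrow> f \<in> dual smul \<Longrightarrow> proj N f \<in> dual smul"
  using proj_in_second second_subset_dual by blast

lemma norm_proj_le: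
  assumes N: "good N" and f: "f \<in> dual smul"
  shows "norm (proj N f) \<le> norm f"
  by (rule norm_second_le[OF N proj_in_second[OF N f]])
    (auto simp: proj_apply[OF N f] norm_blinfun)

lemma proj_second: "good N \<Longrightarrow> y \<in> second N \<Longrightarrow> proj N y = y"
  using second_subset_dual by (intro proj_eqI) auto

lemma projection_on_proj:
  assumes N: "good N"
  shows "projection_on dual_scale (dual smul) (proj N)"
  unfolding projection_on_def
proof (intro conjI ballI allI)
  show "proj N \<in> dual smul \<rightarrow> dual smul" using proj_in_dual[OF N] by blast
  show "\<exists>B. \<forall>f\<in>dual smul. norm (proj N f) \<le> B * norm f"
    using norm_proj_le[OF N] by (intro exI[of _ 1]) simp
  fix f assume f: "f \<in> dual smul"
  show "proj N (proj N f) = proj N f" by (rule proj_second[OF N proj_in_second[OF N f]])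
  show "proj N (dual_scale c f) = dual_scale c (proj N f)" for c
    by (rule proj_eqI[OF N])
      (auto simp: dual_scale_apply proj_apply[OF N f] intro!: dual.subspace_scale[OF subspace_dual f]
        dual.subspace_scale[OF subspace_second proj_in_second[OF N f]])
  fix g assume g: "g \<in> dual smul"
  show "proj N (f + g) = proj N f + proj N g"
    by (rule proj_eqI[OF N])
      (auto simp: blinfun.add_left proj_apply[OF N f] proj_apply[OF N g]
        intro!: dual.subspace_add[OF subspace_dual f g]
        dual.subspace_add[OF subspace_second proj_in_second[OF N f] proj_in_second[OF N g]])
qed

lemma proj_image: "good N \<Longrightarrow> proj N ` dual smul = second N"
  using proj_in_second proj_second second_subset_dual by (auto simp: image_iff) (metis subsetD)

lemma proj_eq_0_iff:
  assumes N: "good N" and f: "f \<in> dual smul"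
  shows "proj N f = 0 \<longleftrightarrow> (\<forall>v\<in>first N. blinfun_apply f v = 0)"
  using proj_apply[OF N f] proj_eqI[OF N f dual.subspace_0[OF subspace_second]] by fastforce

lemma proj_kernel: "good N \<Longrightarrow> {f \<in> dual smul. proj N f = 0} = annihilator smul (first N)"
  using proj_eq_0_iff by (auto simp: annihilator_def)

lemma adjoint_range_proj:
  assumes N: "good N"
  shows "adjoint_range smul (proj N) = (weak_star_topology smul) closure_of (canonical smul ` first N)"
  by (rule adjoint_range_eq_closure[OF projection_on_proj[OF N] subspace_first])
    (simp_all add: proj_apply[OF N] proj_eq_0_iff[OF N])

lemma proj_proj:
  assumes N: "good N" and M: "good M" and le: "N \<subseteq> M" and f: "f \<in> dual smul"
  shows "proj M (proj N f) = proj N f" "proj N (proj M f) = proj N f"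
proof -
  show "proj M (proj N f) = proj N f"
    using proj_in_second[OF N f] second_mono[OF le] by (intro proj_second[OF M]) auto
  show "proj N (proj M f) = proj N f"
    using first_mono[OF le] proj_apply[OF N f] proj_apply[OF M f]
    by (intro proj_eqI[OF N proj_in_dual[OF M f] proj_in_second[OF N f]]) auto
qed

lemma op_norm_proj_le:
  assumes N: "good N"
  shows "op_norm_on (dual smul) (proj N) \<le> 1"
  unfolding op_norm_on_def
proof (rule cSUP_least)
  show "{f \<in> dual smul. norm f \<le> 1} \<noteq> {}" using dual.subspace_0[OF subspace_dual] by force
  show "norm (proj N f) \<le> 1" if "f \<in> {f \<in> dual smul. norm f \<le> 1}" for f
    using norm_proj_le[OF N, of f] that by auto
qed

text \<open>A projection fixes the unit vectors of its range, so only a nonzero range is at stake.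
  Some functional is nonzero at \<open>v\<close>, and its projection has the same value
  there.\<close>

lemma op_norm_proj:
  assumes N: "good N" and v: "v \<in> first N" "v \<noteq> 0"
  shows "op_norm_on (dual smul) (proj N) = 1"
proof (rule antisym[OF op_norm_proj_le[OF N]])
  obtain f where f: "f \<in> dual smul" "f v \<noteq> 0"
    using dual_separation[OF asplund subspace_single_0, of v] v(2) by auto
  define y where "y = proj N f"
  have y: "y \<in> second N" "y \<noteq> 0"
    using proj_in_second[OF N f(1)] proj_apply[OF N f(1) v(1)] f(2) by (auto simp: y_def)
  define u where "u = dual_scale (of_real (1 / norm y)) y"
  have u: "u \<in> second N" "norm u = 1"
    using y dual.subspace_scale[OF subspace_second y(1)]
    by (auto simp: u_def dual.norm_scale norm_divide)
  have "norm (proj N u) \<le> op_norm_on (dual smul) (proj N)"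
    unfolding op_norm_on_def
  proof (rule cSUP_upper)
    show "u \<in> {f \<in> dual smul. norm f \<le> 1}" using u second_subset_dual[OF N] by auto
    show "bdd_above ((\<lambda>f. norm (proj N f)) ` {f \<in> dual smul. norm f \<le> 1})"
      by (rule bdd_aboveI2[where M = 1]) (use norm_proj_le[OF N] order_trans in auto)
  qed
  then show "1 \<le> op_norm_on (dual smul) (proj N)"
    using u proj_second[OF N u(1)] by simp
qed

text \<open>\<open>B\<close> is a seed contained in every member. It serves to put a nonzero vector
  into every first side, so that no projection of the family is 0 when the space is
  nontrivial.\<close>

definition family :: "('a + ('a \<Rightarrow>\<^sub>L 'k)) set \<Rightarrow> ('a + ('a \<Rightarrow>\<^sub>L 'k)) set set" where
  "family B = {N. good N \<and> B \<subseteq> N}"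

lemma family_UN_incseq:
  assumes "\<And>n. N n \<in> family B" "incseq N"
  shows "(\<Union>n. N n) \<in> family B"
proof -
  have "good (\<Union>n. N n)" using assms by (intro good_UN_incseq) (auto simp: family_def)
  moreover have "B \<subseteq> (\<Union>n. N n)" using assms(1)[of 0] by (auto simp: family_def)
  ultimately show ?thesis by (simp add: family_def)
qed

text \<open>Taking \<open>D\<close> as a set of pairs gives cofinality for the rectangles at once;
  for one kind of side the other coordinate is filled with 0.\<close>

lemma exists_family:
  assumes B: "countable B" "B \<subseteq> Inl ` I \<union> Inr ` J" and D: "countable D" "D \<subseteq> UNIV \<times> dual smul"
  shows "\<exists>N\<in>family B. D \<subseteq> first N \<times> second N"
proof -
  let ?N = "B \<union> (Inl ` (\<Union>d\<in>D. support (fst d)) \<union> Inr ` (\<Union>d\<in>D. dual_support (snd d)))"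
  have "countable ?N" using B D support(1) dual_support(1) by auto
  moreover have "?N \<subseteq> Inl ` I \<union> Inr ` J" using B(2) support(2) dual_support(2) by blast
  ultimately obtain M where M: "good M" "?N \<subseteq> M" by (rule exists_good)
  have "x \<in> first M \<and> f \<in> second M" if d: "(x, f) \<in> D" for x f
  proof
    have "support x \<subseteq> Inl -` M" "dual_support f \<subseteq> Inr -` M" using M(2) d by force+
    then have *: "closure (primal.rational_span (support x)) \<subseteq> first M"
      "closure (dual.rational_span (dual_support f)) \<subseteq> second M"
      unfolding first_def second_def
      by (auto intro!: closure_mono primal.rational_span_mono dual.rational_span_mono)
    show "x \<in> first M" using *(1) support(3) by blast
    have "f \<in> dual smul" using D(2) d by blast
    then show "f \<in> second M" using *(2) dual_support(3) by blast
  qed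
  then show ?thesis using M by (intro bexI[of _ M]) (auto simp: family_def)
qed

lemma skeleton_family:
  assumes B: "countable B" "B \<subseteq> Inl ` I \<union> Inr ` J"
  shows "one_projectional_skeleton dual_scale (dual smul) (family B) (\<subseteq>) proj"
proof -
  have good: "good N" if "N \<in> family B" for N using that by (simp add: family_def)
  \<comment> \<open>The union of an increasing sequence stays in the family, so suprema of index
    sets are plain unions and closures appear only on the side of the subspaces.\<close>
  have sup: "supremum_on (family B) (\<subseteq>) (range N) t \<longleftrightarrow> t = (\<Union>n. N n)"
    if "range N \<subseteq> family B" "\<forall>n. N n \<subseteq> N (Suc n)" for N :: "nat \<Rightarrow> _" and t
  proof -
    have "(\<Union>n. N n) \<in> family B"
      using that by (intro family_UN_incseq incseq_SucI) auto
    then show ?thesis unfolding supremum_on_def by blast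
  qed
  have directed: "directed_sigma_complete (family B) (\<subseteq>)"
    unfolding directed_sigma_complete_def
  proof (intro conjI ballI allI impI)
    show "reflp_on (family B) (\<subseteq>)" "antisymp_on (family B) (\<subseteq>)" "transp_on (family B) (\<subseteq>)"
      by (auto intro!: reflp_onI antisymp_onI transp_onI)
    show "family B \<noteq> {}" using exists_family[OF B, of "{}"] by auto
    fix N M assume NM: "N \<in> family B" "M \<in> family B"
    then have "countable (N \<union> M)" "N \<union> M \<subseteq> Inl ` I \<union> Inr ` J"
      by (auto simp: family_def good_def)
    then obtain L where "good L" "N \<union> M \<subseteq> L" by (rule exists_good)
    then show "\<exists>L\<in>family B. N \<subseteq> L \<and> M \<subseteq> L"
      using NM by (intro bexI[of _ L]) (auto simp: family_def)
  qed (use sup in blast)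
  have separable: "separable_space (top_of_set (proj N ` dual smul))" if "N \<in> family B" for N
    unfolding proj_image[OF good[OF that]] second_def
    by (intro separable_closure dual.countable_rational_span good_vimage(4) good that)
  have cover: "dual smul = (\<Union>N\<in>family B. proj N ` dual smul)"
  proof
    show "dual smul \<subseteq> (\<Union>N\<in>family B. proj N ` dual smul)"
    proof
      fix f assume "f \<in> dual smul"
      then obtain N where "N \<in> family B" "f \<in> second N"
        using exists_family[OF B, of "{(0, f)}"] by auto
      then show "f \<in> (\<Union>N\<in>family B. proj N ` dual smul)" using proj_image good by blast
    qed
  qed (use proj_in_dual good in blast)
  have closure: "proj t ` dual smul = closure (\<Union>n. proj (N n) ` dual smul)"
    if N: "range N \<subseteq> family B" "\<forall>n. N n \<subseteq> N (Suc n)" "supremum_on (family B) (\<subseteq>) (range N) t"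
    for N :: "nat \<Rightarrow> _" and t
  proof -
    have t: "t = (\<Union>n. N n)" using sup N by blast
    have gN: "good (N n)" for n using N(1) good by blast
    have inc: "incseq N" using N(2) by (intro incseq_SucI) auto
    show ?thesis
      unfolding t by (simp only: proj_image gN good_UN_incseq[OF inc gN] second_UN_incseq[OF inc])
  qed
  show ?thesis
    unfolding one_projectional_skeleton_def projectional_skeleton_def
  proof (intro conjI ballI allI impI)
    fix N M assume "N \<in> family B" "M \<in> family B"
    note NM = this[THEN good]
    show "projection_on dual_scale (dual smul) (proj N)" by (rule projection_on_proj[OF NM(1)])
    show "op_norm_on (dual smul) (proj N) \<le> 1" by (rule op_norm_proj_le[OF NM(1)])
    fix f assume "N \<subseteq> M" "f \<in> dual smul"
    from proj_proj[OF NM this]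
    show "proj M (proj N f) = proj N f" "proj N (proj M f) = proj N f" .
  qed (use directed separable cover closure in simp_all)
qed

section \<open>Richness of the sides and of the rectangles\<close>

lemma rectangle_subset_iff:
  assumes "good N" "good M"
  shows "first N \<times> second N \<subseteq> first M \<times> second M \<longleftrightarrow> N \<subseteq> M"
  using first_subset_iff[OF assms] second_subset_iff[OF assms] subspace_0[OF subspace_first[of N]]
    dual.subspace_0[OF subspace_second[of N]]
  by (auto simp: times_subset_iff)

lemma first_in_sep_subspaces: "good N \<Longrightarrow> first N \<in> sep_subspaces smul UNIV"
  unfolding first_def by (intro primal.sep_subspaces_closure_rational_span good_vimage(3)) auto

lemma second_in_sep_subspaces: "good N \<Longrightarrow> second N \<in> sep_subspaces dual_scale (dual smul)"
  using second_subset_dual[of N] unfolding second_def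
  by (intro dual.sep_subspaces_closure_rational_span good_vimage(4)) auto

lemma rectangle_in_sep_subspaces:
  assumes N: "good N"
  shows "first N \<times> second N \<in> sep_subspaces (module_prod.scale smul dual_scale) (UNIV \<times> dual smul)"
proof -
  interpret prod: module_prod smul "dual_scale :: 'k \<Rightarrow> ('a \<Rightarrow>\<^sub>L 'k) \<Rightarrow> _" ..
  have "prod.p.subspace (first N \<times> second N)"
    by (rule prod.subspace_Times[OF subspace_first subspace_second])
  moreover have "closed (first N \<times> second N)"
    unfolding first_def second_def by (intro closed_Times closed_closure)
  moreover have "separable_space (top_of_set (first N \<times> second N))"
    unfolding first_def second_def closure_Times[symmetric]
    by (intro separable_closure countable_SIGMA primal.countable_rational_span
        dual.countable_rational_span good_vimage(3,4)[OF N])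
  ultimately show ?thesis
    using second_subset_dual[OF N] by (auto simp: sep_subspaces_def)
qed

lemma rich_first:
  assumes B: "countable B" "B \<subseteq> Inl ` I \<union> Inr ` J"
  shows "rich smul UNIV (first ` family B)"
proof (rule rich_image)
  show "first N \<in> sep_subspaces smul UNIV" if "N \<in> family B" for N
    using that by (simp add: family_def first_in_sep_subspaces)
  show "first N \<subseteq> first M \<longleftrightarrow> N \<subseteq> M" if "N \<in> family B" "M \<in> family B" for N M
    using that by (simp add: family_def first_subset_iff)
  show "(\<Union>n. N n) \<in> family B \<and> first (\<Union>n. N n) = closure (\<Union>n. first (N n))"
    if "\<And>n. N n \<in> family B" "incseq N" for N
    using family_UN_incseq[OF that] first_UN_incseq[OF that(2)] by blast
  fix V assume "V \<in> sep_subspaces smul UNIV"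
  then obtain D where D: "countable D" "V \<subseteq> closure D" by (rule sep_subspaces_dense)
  obtain N where N: "N \<in> family B" "D \<times> {0} \<subseteq> first N \<times> second N"
    using exists_family[OF B, of "D \<times> {0}"] D(1) dual.subspace_0[OF subspace_dual] by auto
  have "closure D \<subseteq> first N"
    using N(2) by (intro closure_minimal) (auto simp: first_def)
  then show "\<exists>N\<in>family B. V \<subseteq> first N" using N(1) D(2) by blast
qed

lemma rich_second:
  assumes B: "countable B" "B \<subseteq> Inl ` I \<union> Inr ` J"
  shows "rich dual_scale (dual smul) (second ` family B)"
proof (rule rich_image)
  show "second N \<in> sep_subspaces dual_scale (dual smul)" if "N \<in> family B" for N
    using that by (simp add: family_def second_in_sep_subspaces)
  show "second N \<subseteq> second M \<longleftrightarrow> N \<subseteq> M" if "N \<in> family B" "M \<in> family B" for N M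
    using that by (simp add: family_def second_subset_iff)
  show "(\<Union>n. N n) \<in> family B \<and> second (\<Union>n. N n) = closure (\<Union>n. second (N n))"
    if "\<And>n. N n \<in> family B" "incseq N" for N
    using family_UN_incseq[OF that] second_UN_incseq[OF that(2)] by blast
  fix Y assume Y: "Y \<in> sep_subspaces dual_scale (dual smul)"
  then obtain D where D: "countable D" "D \<subseteq> Y" "Y \<subseteq> closure D" by (rule sep_subspaces_dense)
  have "Y \<subseteq> dual smul" using Y by (simp add: sep_subspaces_def)
  then obtain N where N: "N \<in> family B" "{0} \<times> D \<subseteq> first N \<times> second N"
    using exists_family[OF B, of "{0} \<times> D"] D(1,2) by auto
  have "closure D \<subseteq> second N"
    using N(2) by (intro closure_minimal) (auto simp: second_def)
  then show "\<exists>N\<in>family B. Y \<subseteq> second N" using N(1) D(3) by blast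
qed

lemma rich_rectangles:
  assumes B: "countable B" "B \<subseteq> Inl ` I \<union> Inr ` J"
  shows "rich (module_prod.scale smul dual_scale) (UNIV \<times> dual smul) ((\<lambda>N. first N \<times> second N) ` family B)"
proof (rule rich_image)
  show "first N \<times> second N \<in> sep_subspaces (module_prod.scale smul dual_scale) (UNIV \<times> dual smul)"
    if "N \<in> family B" for N
    using that by (simp add: family_def rectangle_in_sep_subspaces)
  show "first N \<times> second N \<subseteq> first M \<times> second M \<longleftrightarrow> N \<subseteq> M" if "N \<in> family B" "M \<in> family B" for N M
    using that by (simp add: family_def rectangle_subset_iff)
  show "(\<Union>n. N n) \<in> family B \<and>
      first (\<Union>n. N n) \<times> second (\<Union>n. N n) = closure (\<Union>n. first (N n) \<times> second (N n))"
    if N: "\<And>n. N n \<in> family B" and inc: "incseq N" for N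
  proof
    \<comment> \<open>Monotonicity of both factors is what lets the union of the rectangles be the
      rectangle of the unions.\<close>
    have "incseq (\<lambda>n. first (N n))" "incseq (\<lambda>n. second (N n))"
      using inc by (simp_all add: incseq_def first_mono second_mono)
    from UN_UN_incseq[OF this, of "\<lambda>x f. {(x, f)}"]
    have "(\<Union>n. first (N n)) \<times> (\<Union>n. second (N n)) = (\<Union>n. first (N n) \<times> second (N n))"
      by (simp add: Sigma_def)
    then show "first (\<Union>n. N n) \<times> second (\<Union>n. N n) = closure (\<Union>n. first (N n) \<times> second (N n))"
      unfolding first_UN_incseq[OF inc] second_UN_incseq[OF inc] closure_Times[symmetric] by simp
  qed (rule family_UN_incseq[OF N inc])
  fix W :: "('a \<times> ('a \<Rightarrow>\<^sub>L 'k)) set"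
  assume W: "W \<in> sep_subspaces (module_prod.scale smul dual_scale) (UNIV \<times> dual smul)"
  then obtain D where D: "countable D" "D \<subseteq> W" "W \<subseteq> closure D" by (rule sep_subspaces_dense)
  have "W \<subseteq> UNIV \<times> dual smul" using W unfolding sep_subspaces_def by blast
  then obtain N where N: "N \<in> family B" "D \<subseteq> first N \<times> second N"
    using exists_family[OF B D(1)] D(2) by blast
  have "closure D \<subseteq> first N \<times> second N"
    using N(2) by (intro closure_minimal closed_Times) (auto simp: first_def second_def)
  then show "\<exists>N\<in>family B. W \<subseteq> first N \<times> second N" using N(1) D(3) by blast
qed

end

theorem theorem13:
  fixes smul :: "'k::real_or_complex \<Rightarrow> 'a::banach \<Rightarrow> 'a"
  assumes "banach_space_over smul"
    and "asplund TYPE('a)"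
  shows "\<exists>A \<subseteq> rectangles smul.
    rich (module_prod.scale smul dual_scale) (UNIV \<times> dual smul) A \<and>
    (\<forall>V Y V' Y'. V \<times> Y \<in> A \<and> V' \<times> Y' \<in> A \<longrightarrow>
       (V \<subseteq> V' \<longleftrightarrow> Y \<subseteq> Y') \<and> (V \<subseteq> V' \<longleftrightarrow> V \<times> Y \<subseteq> V' \<times> Y')) \<and>
    rich smul UNIV (first_sides smul A) \<and>
    rich dual_scale (dual smul) (second_sides smul A) \<and>
    inclusion_isomorphic A (first_sides smul A) \<and>
    inclusion_isomorphic A (second_sides smul A) \<and>
    inclusion_isomorphic (first_sides smul A) (second_sides smul A) \<and>
    (\<exists>P :: ('a \<times> ('a \<Rightarrow>\<^sub>L 'k)) set \<Rightarrow> ('a \<Rightarrow>\<^sub>L 'k) \<Rightarrow> ('a \<Rightarrow>\<^sub>L 'k).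
       (\<forall>V Y. V \<times> Y \<in> A \<longrightarrow>
          projection_on dual_scale (dual smul) (P (V \<times> Y)) \<and>
          ((\<exists>x::'a. x \<noteq> 0) \<longrightarrow> op_norm_on (dual smul) (P (V \<times> Y)) = 1) \<and>
          P (V \<times> Y) ` dual smul = Y \<and>
          {f \<in> dual smul. P (V \<times> Y) f = 0} = annihilator smul V \<and>
          adjoint_range smul (P (V \<times> Y)) =
            (weak_star_topology smul) closure_of (canonical smul ` V)) \<and>
       one_projectional_skeleton dual_scale (dual smul) A (\<subseteq>) P \<and>
       range (canonical smul) \<subseteq> (\<Union>\<gamma>\<in>A. adjoint_range smul (P \<gamma>)) \<and>
       (\<exists>Q. (\<forall>V Y. V \<times> Y \<in> A \<longrightarrow> Q V = P (V \<times> Y)) \<and>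
            one_projectional_skeleton dual_scale (dual smul) (first_sides smul A) (\<subseteq>) Q) \<and>
       (\<exists>Q. (\<forall>V Y. V \<times> Y \<in> A \<longrightarrow> Q Y = P (V \<times> Y)) \<and>
            one_projectional_skeleton dual_scale (dual smul) (second_sides smul A) (\<subseteq>) Q))"
proof -
  interpret banach_space_over smul by (rule assms(1))
  obtain I \<theta> where I: "primal.determining_system UNIV I \<theta>"
    using primal.exists_determining_system by blast
  obtain J \<eta> where J: "dual.determining_system (dual smul) J \<eta>"
    using dual.exists_determining_system by blast
  interpret asplund_systems smul I \<theta> J \<eta>
    by unfold_locales (fact assms(2) I J)+
  \<comment> \<open>In a nontrivial space the system contains a nonzero vector, since its closed
    span is everything. Requiring it in every index set excludes the first side \<open>{0}\<close>,
    whose projection would be 0 and have norm 0.\<close>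
  have "\<exists>B. countable B \<and> B \<subseteq> Inl ` I \<union> Inr ` J \<and>
      ((\<exists>x::'a. x \<noteq> 0) \<longrightarrow> (\<exists>i. i \<noteq> 0 \<and> Inl i \<in> B))"
  proof (cases "\<exists>i\<in>I. i \<noteq> 0")
    case True
    then obtain i where "i \<in> I" "i \<noteq> 0" by blast
    then show ?thesis by (intro exI[of _ "{Inl i}"]) auto
  next
    case False
    then have "closure (primal.rational_span I) \<subseteq> {0}"
      by (intro primal.closure_rational_span_least subspace_single_0) auto
    then have "(x :: 'a) = 0" for x
      using primal.determining_systemD(2)[OF I] by blast
    then show ?thesis by (intro exI[of _ "{}"]) simp
  qed
  then obtain B :: "('a + ('a \<Rightarrow>\<^sub>L 'k)) set" where B: "countable B" "B \<subseteq> Inl ` I \<union> Inr ` J"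
    "(\<exists>x::'a. x \<noteq> 0) \<longrightarrow> (\<exists>i. i \<noteq> 0 \<and> Inl i \<in> B)"
    by (elim exE conjE)
  define rect where "rect N = first N \<times> second N" for N
  define A where "A = rect ` family B"
  have good: "good N" if "N \<in> family B" for N using that by (simp add: family_def)
  have iff: "rect N \<subseteq> rect M \<longleftrightarrow> N \<subseteq> M" "first N \<subseteq> first M \<longleftrightarrow> N \<subseteq> M" "second N \<subseteq> second M \<longleftrightarrow> N \<subseteq> M"
    if "N \<in> family B" "M \<in> family B" for N M
    unfolding rect_def
    by (rule rectangle_subset_iff first_subset_iff second_subset_iff, (rule good[OF that(1)] good[OF that(2)])+)+
  have inj: "inj_on rect (family B)" "inj_on first (family B)" "inj_on second (family B)"
    by (rule inj_on_of_subset_iff, rule iff, assumption+)+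
  \<comment> \<open>A product determines its factors only when both are nonempty; here each contains
    0.\<close>
  have elem: "\<exists>N\<in>family B. V = first N \<and> Y = second N" if VY: "V \<times> Y \<in> A" for V Y
  proof -
    obtain N where N: "N \<in> family B" "V \<times> Y = first N \<times> second N"
      using VY by (auto simp: A_def rect_def)
    moreover have "first N \<noteq> {}" "second N \<noteq> {}"
      using subspace_0[OF subspace_first[of N]] dual.subspace_0[OF subspace_second[of N]] by blast+
    ultimately show ?thesis by (metis times_eq_iff)
  qed
  have sides_sep: "first N \<in> sep_subspaces smul UNIV" "second N \<in> sep_subspaces dual_scale (dual smul)"
    "first N \<times> second N \<in> A" if N: "N \<in> family B" for N
    using N by (auto simp: A_def rect_def intro: first_in_sep_subspaces second_in_sep_subspaces good)
  have firsts: "first_sides smul A = first ` family B"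
    unfolding first_sides_def using elem sides_sep by (intro equalityI subsetI) (auto, blast+)
  have seconds: "second_sides smul A = second ` family B"
    unfolding second_sides_def using elem sides_sep by (intro equalityI subsetI) (auto, blast+)
  define P where "P \<gamma> = proj (inv_into (family B) rect \<gamma>)" for \<gamma>
  define Q1 where "Q1 V = proj (inv_into (family B) first V)" for V
  define Q2 where "Q2 Y = proj (inv_into (family B) second Y)" for Y
  have P: "P (rect N) = proj N" "Q1 (first N) = proj N" "Q2 (second N) = proj N" if "N \<in> family B" for N
    using that inj by (simp_all add: P_def Q1_def Q2_def)
  note skeleton = skeleton_family[OF B(1,2)]
  have A_rect: "A \<subseteq> rectangles smul"
    unfolding A_def rect_def rectangles_def using sides_sep(1,2) by blast
  have A_rich: "rich (module_prod.scale smul dual_scale) (UNIV \<times> dual smul) A"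
    unfolding A_def rect_def by (rule rich_rectangles[OF B(1,2)])
  have A_iff: "(V \<subseteq> V' \<longleftrightarrow> Y \<subseteq> Y') \<and> (V \<subseteq> V' \<longleftrightarrow> V \<times> Y \<subseteq> V' \<times> Y')"
    if VY: "V \<times> Y \<in> A" "V' \<times> Y' \<in> A" for V Y V' Y'
  proof -
    obtain N M where NM: "N \<in> family B" "M \<in> family B" "V = first N" "Y = second N"
        "V' = first M" "Y' = second M"
      using elem[OF VY(1)] elem[OF VY(2)] by blast
    show ?thesis unfolding NM(3-6) rect_def[symmetric] iff[OF NM(1,2)] by simp
  qed
  have proj_props: "projection_on dual_scale (dual smul) (P (V \<times> Y)) \<and>
      ((\<exists>x::'a. x \<noteq> 0) \<longrightarrow> op_norm_on (dual smul) (P (V \<times> Y)) = 1) \<and>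
      P (V \<times> Y) ` dual smul = Y \<and>
      {f \<in> dual smul. P (V \<times> Y) f = 0} = annihilator smul V \<and>
      adjoint_range smul (P (V \<times> Y)) = (weak_star_topology smul) closure_of (canonical smul ` V)"
    if VY: "V \<times> Y \<in> A" for V Y
  proof -
    obtain N where N: "N \<in> family B" "V = first N" "Y = second N" using elem[OF VY] by blast
    have gN: "good N" by (rule good[OF N(1)])
    have "op_norm_on (dual smul) (proj N) = 1" if nontrivial: "\<exists>x::'a. x \<noteq> 0"
    proof -
      obtain i where i: "i \<noteq> 0" "Inl i \<in> B" using B(3) nontrivial by blast
      have "i \<in> Inl -` N" using i(2) N(1) by (auto simp: family_def)
      then have "i \<in> first N" unfolding first_def using primal.subset_closure_rational_span by blast
      then show ?thesis by (rule op_norm_proj[OF gN _ i(1)])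
    qed
    then show ?thesis
      unfolding N(2,3) rect_def[symmetric] P(1)[OF N(1)]
      using projection_on_proj[OF gN] proj_image[OF gN] proj_kernel[OF gN] adjoint_range_proj[OF gN]
      by simp
  qed
  have cover: "range (canonical smul) \<subseteq> (\<Union>\<gamma>\<in>A. adjoint_range smul (P \<gamma>))"
  proof
    fix \<psi> assume "\<psi> \<in> range (canonical smul)"
    then obtain x where x: "\<psi> = canonical smul x" by blast
    obtain N where N: "N \<in> family B" "x \<in> first N"
      using exists_family[OF B(1,2), of "{(x, 0)}"] dual.subspace_0[OF subspace_dual] by auto
    have "canonical smul ` first N \<subseteq> (weak_star_topology smul) closure_of (canonical smul ` first N)"
      using canonical_in_bidual by (intro closure_of_subset) (auto simp: topspace_weak_star_topology)
    then have "\<psi> \<in> adjoint_range smul (P (rect N))"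
      unfolding P(1)[OF N(1)] adjoint_range_proj[OF good[OF N(1)]] x using N(2) by blast
    then show "\<psi> \<in> (\<Union>\<gamma>\<in>A. adjoint_range smul (P \<gamma>))" using N(1) by (auto simp: A_def)
  qed
  have sides: "Q1 V = P (V \<times> Y)" "Q2 Y = P (V \<times> Y)" if VY: "V \<times> Y \<in> A" for V Y
  proof -
    obtain N where N: "N \<in> family B" "V = first N" "Y = second N" using elem[OF VY] by blast
    show "Q1 V = P (V \<times> Y)" "Q2 Y = P (V \<times> Y)"
      unfolding N(2,3) rect_def[symmetric] P[OF N(1)] by simp_all
  qed
  have skeletons: "one_projectional_skeleton dual_scale (dual smul) A (\<subseteq>) P"
    "one_projectional_skeleton dual_scale (dual smul) (first_sides smul A) (\<subseteq>) Q1"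
    "one_projectional_skeleton dual_scale (dual smul) (second_sides smul A) (\<subseteq>) Q2"
    unfolding firsts seconds unfolding A_def
    by (rule one_projectional_skeleton_image[OF skeleton]; fact iff P)+
  have isos: "inclusion_isomorphic A (first_sides smul A)"
    "inclusion_isomorphic A (second_sides smul A)"
    "inclusion_isomorphic (first_sides smul A) (second_sides smul A)"
    unfolding firsts seconds unfolding A_def
    by (rule inclusion_isomorphic_images; fact iff)+
  show ?thesis
  proof (intro exI[of _ A] exI[of _ P] conjI)
    show "\<exists>Q. (\<forall>V Y. V \<times> Y \<in> A \<longrightarrow> Q V = P (V \<times> Y)) \<and>
        one_projectional_skeleton dual_scale (dual smul) (first_sides smul A) (\<subseteq>) Q"
      using sides(1) skeletons(2) by (intro exI[of _ Q1]) simp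
    show "\<exists>Q. (\<forall>V Y. V \<times> Y \<in> A \<longrightarrow> Q Y = P (V \<times> Y)) \<and>
        one_projectional_skeleton dual_scale (dual smul) (second_sides smul A) (\<subseteq>) Q"
      using sides(2) skeletons(3) by (intro exI[of _ Q2]) simp
    show "rich smul UNIV (first_sides smul A)" unfolding firsts by (rule rich_first[OF B(1,2)])
    show "rich dual_scale (dual smul) (second_sides smul A)" unfolding seconds by (rule rich_second[OF B(1,2)])
    show "\<forall>V Y V' Y'. V \<times> Y \<in> A \<and> V' \<times> Y' \<in> A \<longrightarrow>
        (V \<subseteq> V' \<longleftrightarrow> Y \<subseteq> Y') \<and> (V \<subseteq> V' \<longleftrightarrow> V \<times> Y \<subseteq> V' \<times> Y')"
      by (intro allI impI A_iff) (elim conjE, assumption)+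
    show "\<forall>V Y. V \<times> Y \<in> A \<longrightarrow>
          projection_on dual_scale (dual smul) (P (V \<times> Y)) \<and>
          ((\<exists>x::'a. x \<noteq> 0) \<longrightarrow> op_norm_on (dual smul) (P (V \<times> Y)) = 1) \<and>
          P (V \<times> Y) ` dual smul = Y \<and>
          {f \<in> dual smul. P (V \<times> Y) f = 0} = annihilator smul V \<and>
          adjoint_range smul (P (V \<times> Y)) =
            (weak_star_topology smul) closure_of (canonical smul ` V)"
      by (intro allI impI) (rule proj_props)
  qed (fact A_rect A_rich isos skeletons cover)+
qed

end
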